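(* Let $\lambda$ and $\mu$ be partitions. For every integer $j\ge 0$, define partitions $\lambda^j:=\lambda\sqcup(1^j)$ and $\mu^j:=(\mu+(j))\sqcup(1^j)$. Then the sequence $\big(a^{\mu^j}_{\lambda^j,(2)}\big)_{j\ge 0}$ is eventually constant.
   Context: $\mu+(j)$ is component-wise addition, i.e. $j$ is added to the first part of $\mu$; $\lambda\sqcup\nu$ is the partition obtained by taking the disjoint union of the parts of $\lambda$ and $\nu$ and reordering into non-increasing order; $(1^j)$ is the partition with $j$ parts equal to $1$. For partitions $\lambda,\mu,\nu$, the plethysm coefficient $a^\mu_{\lambda,\nu}:=\langle s_\lambda\circ s_\nu,s_\mu\rangle$ is the multiplicity of the Schur function $s_\mu$ in the plethysm $s_\lambda\circ s_\nu$; it is $0$ if $|\mu|\ne|\lambda|\cdot|\nu|$. *)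

theory Defs
  imports
    Complex_Main
    "HOL-Library.FuncSet"
    "HOL-Library.More_List"
    "HOL-Library.Poly_Mapping"
begin

section \<open>Partitions\<close>

definition is_partition :: "nat list \<Rightarrow> bool" where
  "is_partition xs \<longleftrightarrow> sorted_wrt (\<ge>) xs \<and> 0 \<notin> set xs"

text \<open>Stripping trailing zeros lets \<open>[j]\<close> stand for the one-row partition \<open>(j)\<close> also when \<open>j = 0\<close>.\<close>

definition part_add :: "nat list \<Rightarrow> nat list \<Rightarrow> nat list" where
  "part_add xs ys = strip_while ((=) 0)
     (map (\<lambda>i. nth_default 0 xs i + nth_default 0 ys i) [0..<max (length xs) (length ys)])"

definition part_union :: "nat list \<Rightarrow> nat list \<Rightarrow> nat list" where
  "part_union xs ys = rev (sort (xs @ ys))"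

lemma is_partition_part_union:
  "is_partition xs \<Longrightarrow> is_partition ys \<Longrightarrow> is_partition (part_union xs ys)"
  by (auto simp: is_partition_def part_union_def sorted_wrt_rev)

lemma is_partition_part_add_row:
  assumes "is_partition xs"
  shows "is_partition (part_add xs [j])"
proof (cases xs)
  case Nil
  then show ?thesis by (simp add: is_partition_def part_add_def strip_while_def)
next
  case (Cons a ys)
  have "map (\<lambda>i. nth_default 0 xs i + nth_default 0 [j] i) [0..<length xs] = (a + j) # ys"
  proof (rule nth_equalityI)
    fix i assume "i < length (map (\<lambda>i. nth_default 0 xs i + nth_default 0 [j] i) [0..<length xs])"
    then show "map (\<lambda>i. nth_default 0 xs i + nth_default 0 [j] i) [0..<length xs] ! i = ((a + j) # ys) ! i"
      using Cons by (cases i) (simp_all add: nth_default_def del: upt_Suc)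
  qed (simp add: Cons)
  moreover have "last ((a + j) # ys) \<noteq> 0"
  proof (cases "ys = []")
    case False
    then have "last ys \<in> set ys" by simp
    then have "last ys \<noteq> 0" using assms Cons unfolding is_partition_def by (metis list.set_intros(2))
    then show ?thesis using False by simp
  qed (use assms Cons in \<open>simp add: is_partition_def\<close>)
  then have "strip_while ((=) 0) ((a + j) # ys) = (a + j) # ys"
    by (intro strip_while_idem) (auto simp: no_trailing_unfold split: if_splits)
  ultimately have "part_add xs [j] = (a + j) # ys"
    using Cons by (simp add: part_add_def)
  then show ?thesis
    using assms Cons unfolding is_partition_def by (auto intro: trans_le_add1)
qed


section \<open>Formal power series in countably many variables\<close>

text \<open>An exponent vector \<open>\<alpha>\<close> of type \<^typ>\<open>nat \<Rightarrow>\<^sub>0 nat\<close> stands for the monomial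
  \<open>\<Prod>i. x\<^sub>i ^ \<alpha>\<^sub>i\<close>, with variables \<open>x\<^sub>0, x\<^sub>1, \<dots>\<close>.\<close>

typedef 'a mps = "UNIV :: ((nat \<Rightarrow>\<^sub>0 nat) \<Rightarrow> 'a) set"
  morphisms mps_coeff Abs_mps ..

setup_lifting type_definition_mps

lemma mps_eqI: "(\<And>\<alpha>. mps_coeff f \<alpha> = mps_coeff g \<alpha>) \<Longrightarrow> f = g"
  by transfer auto

lemma finite_antidiagonal:
  fixes \<alpha> :: "nat \<Rightarrow>\<^sub>0 nat"
  shows "finite {(\<beta>, \<gamma>). \<beta> + \<gamma> = \<alpha>}"
proof -
  let ?P = "PiE (Poly_Mapping.keys \<alpha>) (\<lambda>i. {..Poly_Mapping.lookup \<alpha> i})"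
  let ?S = "{\<beta>. \<exists>\<gamma>. \<beta> + \<gamma> = \<alpha>}"
  have zero: "Poly_Mapping.lookup \<beta> i = 0" if "\<beta> \<in> ?S" "i \<notin> Poly_Mapping.keys \<alpha>" for \<beta> i
    using that by (auto simp: in_keys_iff lookup_add)
  have "inj_on (\<lambda>\<beta>. restrict (Poly_Mapping.lookup \<beta>) (Poly_Mapping.keys \<alpha>)) ?S"
  proof (rule inj_onI)
    fix \<beta> \<beta>' assume S: "\<beta> \<in> ?S" "\<beta>' \<in> ?S"
      and eq: "restrict (Poly_Mapping.lookup \<beta>) (Poly_Mapping.keys \<alpha>) = restrict (Poly_Mapping.lookup \<beta>') (Poly_Mapping.keys \<alpha>)"
    show "\<beta> = \<beta>'"
    proof (rule poly_mapping_eqI)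
      fix i
      show "Poly_Mapping.lookup \<beta> i = Poly_Mapping.lookup \<beta>' i"
      proof (cases "i \<in> Poly_Mapping.keys \<alpha>")
        case True
        then show ?thesis using fun_cong[OF eq, of i] by simp
      next
        case False
        then show ?thesis using zero S by metis
      qed
    qed
  qed
  moreover have "(\<lambda>\<beta>. restrict (Poly_Mapping.lookup \<beta>) (Poly_Mapping.keys \<alpha>)) ` ?S \<subseteq> ?P"
    by (auto simp: lookup_add)
  moreover have "finite ?P"
    by (intro finite_PiE) auto
  ultimately have "finite ?S"
    by (meson finite_imageD finite_subset)
  then have "finite (?S \<times> ?S)"
    by (rule finite_cartesian_product) fact
  moreover have "{(\<beta>, \<gamma>). \<beta> + \<gamma> = \<alpha>} \<subseteq> ?S \<times> ?S"
    using add.commute by fastforce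
  ultimately show ?thesis
    by (rule finite_subset[rotated])
qed

instantiation mps :: (comm_ring_1) comm_ring_1
begin

lift_definition zero_mps :: "'a mps" is "\<lambda>_. 0" .
lift_definition one_mps :: "'a mps" is "\<lambda>\<alpha>. if \<alpha> = 0 then 1 else 0" .
lift_definition plus_mps :: "'a mps \<Rightarrow> 'a mps \<Rightarrow> 'a mps" is "\<lambda>f g \<alpha>. f \<alpha> + g \<alpha>" .
lift_definition uminus_mps :: "'a mps \<Rightarrow> 'a mps" is "\<lambda>f \<alpha>. - f \<alpha>" .
lift_definition minus_mps :: "'a mps \<Rightarrow> 'a mps \<Rightarrow> 'a mps" is "\<lambda>f g \<alpha>. f \<alpha> - g \<alpha>" .
lift_definition times_mps :: "'a mps \<Rightarrow> 'a mps \<Rightarrow> 'a mps" is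
  "\<lambda>f g \<alpha>. \<Sum>(\<beta>, \<gamma>) | \<beta> + \<gamma> = \<alpha>. f \<beta> * g \<gamma>" .

instance
proof
  fix f g h :: "'a mps"
  show "f * g * h = f * (g * h)"
  proof (transfer, rule ext)
    fix f g h :: "(nat \<Rightarrow>\<^sub>0 nat) \<Rightarrow> 'a" and \<alpha>
    let ?A = "\<lambda>\<alpha> :: nat \<Rightarrow>\<^sub>0 nat. {(\<beta>, \<gamma>). \<beta> + \<gamma> = \<alpha>}"
    have "(\<Sum>(\<beta>, \<gamma>)\<in>?A \<alpha>. (\<Sum>(\<delta>, \<epsilon>)\<in>?A \<beta>. f \<delta> * g \<epsilon>) * h \<gamma>) =
          (\<Sum>p\<in>?A \<alpha>. \<Sum>q\<in>?A (fst p). f (fst q) * g (snd q) * h (snd p))"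
      by (simp add: case_prod_unfold sum_distrib_right)
    also have "\<dots> = (\<Sum>(p, q)\<in>Sigma (?A \<alpha>) (\<lambda>p. ?A (fst p)). f (fst q) * g (snd q) * h (snd p))"
      by (intro sum.Sigma ballI finite_antidiagonal)
    also have "\<dots> = (\<Sum>(p, q)\<in>Sigma (?A \<alpha>) (\<lambda>p. ?A (snd p)). f (fst p) * (g (fst q) * h (snd q)))"
      by (rule sum.reindex_bij_witness
          [where i = "\<lambda>(p, q). ((fst p + fst q, snd q), (fst p, fst q))"
             and j = "\<lambda>(p, q). ((fst q, snd q + snd p), (snd q, snd p))"])
        (auto simp: add.assoc mult.assoc)
    also have "\<dots> = (\<Sum>p\<in>?A \<alpha>. \<Sum>q\<in>?A (snd p). f (fst p) * (g (fst q) * h (snd q)))"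
      by (intro sum.Sigma[symmetric] ballI finite_antidiagonal)
    also have "\<dots> = (\<Sum>(\<beta>, \<gamma>)\<in>?A \<alpha>. f \<beta> * (\<Sum>(\<delta>, \<epsilon>)\<in>?A \<gamma>. g \<delta> * h \<epsilon>))"
      by (simp add: case_prod_unfold sum_distrib_left)
    finally show "(\<Sum>(\<beta>, \<gamma>)\<in>?A \<alpha>. (\<Sum>(\<delta>, \<epsilon>)\<in>?A \<beta>. f \<delta> * g \<epsilon>) * h \<gamma>) =
      (\<Sum>(\<beta>, \<gamma>)\<in>?A \<alpha>. f \<beta> * (\<Sum>(\<delta>, \<epsilon>)\<in>?A \<gamma>. g \<delta> * h \<epsilon>))" .
  qed
  show "f * g = g * f"
    by (transfer, rule ext, rule sum.reindex_bij_witness[where i = prod.swap and j = prod.swap])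
      (auto simp: add.commute mult.commute)
  show "1 * f = f"
  proof (transfer, rule ext)
    fix f :: "(nat \<Rightarrow>\<^sub>0 nat) \<Rightarrow> 'a" and \<alpha>
    have "(\<Sum>(\<beta>, \<gamma>) | \<beta> + \<gamma> = \<alpha>. (if \<beta> = 0 then 1 else 0) * f \<gamma>) =
          (\<Sum>(\<beta>, \<gamma>)\<in>{(0 :: nat \<Rightarrow>\<^sub>0 nat, \<alpha>)}. (if \<beta> = 0 then 1 else 0) * f \<gamma>)"
      by (rule sum.mono_neutral_right) (auto simp: finite_antidiagonal split: if_splits)
    then show "(\<Sum>(\<beta>, \<gamma>) | \<beta> + \<gamma> = \<alpha>. (if \<beta> = 0 then 1 else 0) * f \<gamma>) = f \<alpha>"
      by simp
  qed
  show "(f + g) * h = f * h + g * h"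
    by transfer (simp add: fun_eq_iff case_prod_unfold distrib_right sum.distrib)
  show "(0 :: 'a mps) \<noteq> 1"
    by transfer (auto simp: fun_eq_iff intro: exI[of _ 0])
qed (transfer; simp add: fun_eq_iff algebra_simps)+

end

lift_definition mps_scale :: "'a::comm_ring_1 \<Rightarrow> 'a mps \<Rightarrow> 'a mps" is
  "\<lambda>c f \<alpha>. c * f \<alpha>" .


section \<open>Schur functions and power sums\<close>

definition cells :: "nat list \<Rightarrow> (nat \<times> nat) set" where
  "cells xs = {(i, j). i < length xs \<and> j < xs ! i}"

text \<open>Fillings are extensional functions on the diagram, so that distinct elements of \<open>ssyt xs\<close>
  are distinct tableaux; the entries start at \<open>0\<close>, in accordance with the variables.\<close>

definition ssyt :: "nat list \<Rightarrow> (nat \<times> nat \<Rightarrow> nat) set" where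
  "ssyt xs = {T \<in> cells xs \<rightarrow>\<^sub>E UNIV.
     (\<forall>i j. (i, Suc j) \<in> cells xs \<longrightarrow> T (i, j) \<le> T (i, Suc j)) \<and>
     (\<forall>i j. (Suc i, j) \<in> cells xs \<longrightarrow> T (i, j) < T (Suc i, j))}"

definition tableau_weight :: "nat list \<Rightarrow> (nat \<times> nat \<Rightarrow> nat) \<Rightarrow> (nat \<Rightarrow>\<^sub>0 nat)" where
  "tableau_weight xs T = (\<Sum>c\<in>cells xs. Poly_Mapping.single (T c) 1)"

lift_definition schur :: "nat list \<Rightarrow> rat mps" is
  "\<lambda>xs \<alpha>. of_nat (card {T \<in> ssyt xs. tableau_weight xs T = \<alpha>})" .

lift_definition psum :: "nat \<Rightarrow> rat mps" is
  "\<lambda>n \<alpha>. if \<exists>i. \<alpha> = Poly_Mapping.single i n then 1 else 0" .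

definition psum_part :: "nat list \<Rightarrow> rat mps" where
  "psum_part \<rho> = prod_list (map psum \<rho>)"

text \<open>The families \<open>(schur \<lambda>)\<close> and \<open>(psum_part \<rho>)\<close>, indexed by partitions, are bases of the
  \<open>\<rat>\<close>-algebra of symmetric functions. The following are the coordinates of a symmetric
  function with respect to a basis; they are meaningless for other power series.\<close>

definition basis_coeffs :: "(nat list \<Rightarrow> rat mps) \<Rightarrow> rat mps \<Rightarrow> (nat list \<Rightarrow>\<^sub>0 rat)" where
  "basis_coeffs b f = (THE c. Poly_Mapping.keys c \<subseteq> Collect is_partition \<and>
     f = (\<Sum>\<rho>\<in>Poly_Mapping.keys c. mps_scale (Poly_Mapping.lookup c \<rho>) (b \<rho>)))"

text \<open>The Hall inner product, for which the Schur functions are orthonormal.\<close>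

definition hall_inner :: "rat mps \<Rightarrow> rat mps \<Rightarrow> rat" where
  "hall_inner f g = (\<Sum>\<rho>\<in>Poly_Mapping.keys (basis_coeffs schur f).
     Poly_Mapping.lookup (basis_coeffs schur f) \<rho> * Poly_Mapping.lookup (basis_coeffs schur g) \<rho>)"


section \<open>Plethysm\<close>

text \<open>The substitution \<open>g(x\<^sub>0\<^sup>n, x\<^sub>1\<^sup>n, \<dots>)\<close>, that is \<open>p\<^sub>n \<circ> g\<close>, for \<open>n > 0\<close>.\<close>

lift_definition psum_plethysm :: "nat \<Rightarrow> rat mps \<Rightarrow> rat mps" is
  "\<lambda>n g \<alpha>. if \<forall>i. n dvd Poly_Mapping.lookup \<alpha> i then g (Poly_Mapping.map (\<lambda>e. e div n) \<alpha>) else 0" .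

text \<open>\<open>f \<mapsto> f \<circ> g\<close> is the \<open>\<rat>\<close>-algebra homomorphism sending \<open>p\<^sub>n\<close> to \<open>p\<^sub>n \<circ> g\<close>.\<close>

definition plethysm :: "rat mps \<Rightarrow> rat mps \<Rightarrow> rat mps" where
  "plethysm f g = (\<Sum>\<rho>\<in>Poly_Mapping.keys (basis_coeffs psum_part f).
     mps_scale (Poly_Mapping.lookup (basis_coeffs psum_part f) \<rho>)
       (prod_list (map (\<lambda>n. psum_plethysm n g) \<rho>)))"

definition plethysm_coeff :: "nat list \<Rightarrow> nat list \<Rightarrow> nat list \<Rightarrow> rat" where
  "plethysm_coeff lam nu mu = hall_inner (plethysm (schur lam) (schur nu)) (schur mu)"

end

theory Submission
  imports Defs "Jordan_Normal_Form.Determinant"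
begin

text \<open>
  Write \<open>a\<^sub>N\<close> for the Vandermonde product in \<open>N\<close> variables. Since \<open>a\<^sub>N s\<^sub>\<nu>\<close> is an alternant, the
  multiplicity of \<open>s\<^sub>\<mu>\<close> in a symmetric function \<open>F\<close> is the coefficient of \<open>x\<^sup>\<mu>\<^sup>+\<^sup>\<delta>\<close> in
  \<open>a\<^sub>N F\<close> (here \<open>psi\<close>), where \<open>\<delta> = (N - 1, \<dots>, 1, 0)\<close>. The proof follows these coefficients for
  \<open>N = l + j\<close> as \<open>j\<close> grows.

  The Pieri rule for \<open>e\<^sub>m\<close> expresses \<open>s\<^sub>\<lambda>\<close> for \<open>\<lambda>\<close> with a long first column of length \<open>m\<close> through
  products \<open>e\<^sub>n s\<^sub>\<kappa>\<close>, with finitely many \<open>\<kappa>\<close> and finitely many \<open>n - m\<close>. Plethysm with \<open>h\<^sub>2\<close> is a ring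
  homomorphism, so it suffices to treat \<open>e\<^sub>n \<circ> h\<^sub>2\<close> and multiplication by a fixed polynomial in
  power sums. The latter preserves stability, because multiplying by \<open>p\<^sub>k\<close> lowers a single exponent
  by \<open>k\<close>, and within the long tail \<open>j, \<dots>, 2, 1\<close> only lowering \<open>k\<close> to \<open>0\<close> survives.

  Up to sign, \<open>a\<^sub>N (e\<^sub>n \<circ> h\<^sub>2)\<close> is a homogeneous part of the denominator
  \<open>a\<^sub>N \<Prod>\<^sub>i\<^sub>\<le>\<^sub>k (1 - x\<^sub>i x\<^sub>k)\<close> of type C. The coefficients of the latter are antisymmetric under permutations of
  the exponents and under every reflection \<open>\<gamma>\<^sub>i \<mapsto> 2 N - \<gamma>\<^sub>i\<close>. Reflecting the first exponent, moving it
  to the end and setting the last variable to \<open>0\<close> relates the coefficients for \<open>j + 1\<close> and \<open>j\<close>.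
\<close>

section \<open>Monomials, truncation and permutation of variables\<close>

text \<open>The outer partition and the target both grow with j, so the reductions leave the family
  of coefficients under study. Stability is therefore claimed for all exponent vectors with first
  entry 2 j plus a constant and further leading entries j plus constants, and for all constant
  shifts of the index of the outer function. These growth rates are forced: one more cell in the
  first row and in the first column raises the first exponent by 2 and the others by 1. So the first
  exponent keeps a constant distance to 2 N, the mirror image of 0. If this distance is not 0, two
  exponents coincide up to reflection, or one is its own mirror image, and the coefficient vanishes
  for large j. If it is 0, passing from j to j + 1 multiplies the coefficient of the denominator by
  -1, and the sign of e_n in the expansion of the product compensates. Plethysm and the Hall inner
  product are defined through coordinates given by a definite description. Hence independence of the
  power sum products and of the Schur functions, and membership of Schur functions in the algebra of
  power sums, come before any computation. The Schur side rests on the bialternant formula, proved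
  by matching two recursions in N.\<close>

abbreviation "lookup \<equiv> Poly_Mapping.lookup"
abbreviation "keys \<equiv> Poly_Mapping.keys"
abbreviation "single \<equiv> Poly_Mapping.single"

lemma mps_coeff_mult:
  "mps_coeff (f * g) \<alpha> = (\<Sum>(\<beta>, \<gamma>) | \<beta> + \<gamma> = \<alpha>. mps_coeff f \<beta> * mps_coeff g \<gamma>)"
  by (simp add: times_mps.rep_eq)

lemma mps_coeff_simps [simp]:
  "mps_coeff 0 \<alpha> = 0"
  "mps_coeff 1 \<alpha> = (if \<alpha> = 0 then 1 else 0)"
  "mps_coeff (f + g) \<alpha> = mps_coeff f \<alpha> + mps_coeff g \<alpha>"
  "mps_coeff (f - g) \<alpha> = mps_coeff f \<alpha> - mps_coeff g \<alpha>"
  "mps_coeff (- f) \<alpha> = - mps_coeff f \<alpha>"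
  "mps_coeff (mps_scale c f) \<alpha> = c * mps_coeff f \<alpha>"
  by (simp_all add: zero_mps.rep_eq one_mps.rep_eq plus_mps.rep_eq minus_mps.rep_eq
      uminus_mps.rep_eq mps_scale.rep_eq)

lemma mps_coeff_sum [simp]: "mps_coeff (sum f A) \<alpha> = (\<Sum>x\<in>A. mps_coeff (f x) \<alpha>)"
  by (induction A rule: infinite_finite_induct) auto

lemma mps_scale_mult_left: "mps_scale c f * g = mps_scale c (f * g)"
  by (rule mps_eqI) (simp add: mps_coeff_mult sum_distrib_left case_prod_unfold mult.assoc)

lemma mps_scale_mult_right: "f * mps_scale c g = mps_scale c (f * g)"
  by (metis mps_scale_mult_left mult.commute)

lemma mps_scale_scale: "mps_scale c (mps_scale d f) = mps_scale (c * d) f"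
  by (rule mps_eqI) (simp add: mult.assoc)

lemma mps_scale_add_left: "mps_scale (c + d) f = mps_scale c f + mps_scale d f"
  by (rule mps_eqI) (simp add: distrib_right)

lemma mps_scale_sum: "mps_scale c (sum f A) = (\<Sum>x\<in>A. mps_scale c (f x))"
  by (rule mps_eqI) (simp add: sum_distrib_left)

lemma mps_scale_1 [simp]: "mps_scale 1 f = f"
  by (rule mps_eqI) simp

lemma mps_scale_0 [simp]: "mps_scale 0 f = 0"
  by (rule mps_eqI) simp

lemma mps_scale_minus_1: "mps_scale (-1) f = - f"
  by (rule mps_eqI) simp

lemma mps_coeff_Abs [simp]: "mps_coeff (Abs_mps f) \<alpha> = f \<alpha>"
  by (simp add: Abs_mps_inverse)

definition mon :: "(nat \<Rightarrow>\<^sub>0 nat) \<Rightarrow> rat mps" where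
  "mon \<alpha> = Abs_mps (\<lambda>\<beta>. if \<beta> = \<alpha> then 1 else 0)"

lemma mps_coeff_mon: "mps_coeff (mon \<alpha>) \<beta> = (if \<beta> = \<alpha> then 1 else 0)"
  by (simp add: mon_def)

definition mvar :: "nat \<Rightarrow> rat mps" where
  "mvar i = mon (single i 1)"

lemma mps_coeff_mon_mult_add [simp]: "mps_coeff (mon \<alpha> * f) (\<alpha> + \<beta>) = mps_coeff f \<beta>"
proof -
  have "mps_coeff (mon \<alpha> * f) (\<alpha> + \<beta>)
      = (\<Sum>(\<beta>', \<gamma>)\<in>{(\<alpha>, \<beta>)}. mps_coeff (mon \<alpha>) \<beta>' * mps_coeff f \<gamma>)"
    unfolding mps_coeff_mult
    by (rule sum.mono_neutral_right) (auto simp: finite_antidiagonal mps_coeff_mon split: if_splits)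
  then show ?thesis by (simp add: mps_coeff_mon)
qed

lemma mps_coeff_mon_mult_eq_0:
  assumes "\<And>\<beta>. \<gamma> \<noteq> \<alpha> + \<beta>"
  shows "mps_coeff (mon \<alpha> * f) \<gamma> = 0"
  unfolding mps_coeff_mult using assms by (intro sum.neutral) (auto simp: mps_coeff_mon)

lemma poly_mapping_nat_diff_add:
  fixes \<alpha> \<gamma> :: "nat \<Rightarrow>\<^sub>0 nat"
  assumes "\<And>i. lookup \<alpha> i \<le> lookup \<gamma> i"
  shows "\<alpha> + (\<gamma> - \<alpha>) = \<gamma>"
  using assms by (intro poly_mapping_eqI) (simp add: lookup_add lookup_minus)

lemma mps_coeff_mon_mult:
  "mps_coeff (mon \<alpha> * f) \<gamma> =
    (if \<forall>i. lookup \<alpha> i \<le> lookup \<gamma> i then mps_coeff f (\<gamma> - \<alpha>) else 0)"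
proof (cases "\<forall>i. lookup \<alpha> i \<le> lookup \<gamma> i")
  case True
  then show ?thesis
    using mps_coeff_mon_mult_add[of \<alpha> f "\<gamma> - \<alpha>"] poly_mapping_nat_diff_add[of \<alpha> \<gamma>] by simp
next
  case False
  then have "\<gamma> \<noteq> \<alpha> + \<beta>" for \<beta> by (auto simp: lookup_add)
  then show ?thesis using False by (subst mps_coeff_mon_mult_eq_0) auto
qed

lemma mon_0: "mon 0 = 1"
  by (rule mps_eqI) (simp add: mps_coeff_mon)

lemma mon_mult: "mon \<alpha> * mon \<beta> = mon (\<alpha> + \<beta>)"
proof (rule mps_eqI)
  fix \<gamma>
  show "mps_coeff (mon \<alpha> * mon \<beta>) \<gamma> = mps_coeff (mon (\<alpha> + \<beta>)) \<gamma>"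
  proof (cases "\<exists>\<delta>. \<gamma> = \<alpha> + \<delta>")
    case True
    then show ?thesis by (auto simp: mps_coeff_mon)
  next
    case False
    then show ?thesis using mps_coeff_mon_mult_eq_0[of \<gamma> \<alpha>] by (auto simp: mps_coeff_mon)
  qed
qed

lemma mvar_power: "mvar i ^ k = mon (single i k)"
  by (induction k) (simp_all add: mvar_def mon_0 mon_mult flip: single_add)

lemma mon_prod: "finite A \<Longrightarrow> (\<Prod>x\<in>A. mon (f x)) = mon (\<Sum>x\<in>A. f x)"
  by (induction A rule: finite_induct) (simp_all add: mon_0 mon_mult)

definition supp_below :: "nat \<Rightarrow> (nat \<Rightarrow>\<^sub>0 nat) \<Rightarrow> bool" where
  "supp_below N \<alpha> \<longleftrightarrow> (\<forall>i\<ge>N. lookup \<alpha> i = 0)"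

lemma supp_below_add: "supp_below N (\<alpha> + \<beta>) \<longleftrightarrow> supp_below N \<alpha> \<and> supp_below N \<beta>"
  by (auto simp: supp_below_def lookup_add)

lemma supp_below_0 [simp]: "supp_below N 0"
  by (simp add: supp_below_def)

lemma supp_below_mono: "supp_below M \<alpha> \<Longrightarrow> M \<le> N \<Longrightarrow> supp_below N \<alpha>"
  by (auto simp: supp_below_def)

lemma supp_below_exists: "\<exists>N. supp_below N \<alpha>"
proof -
  obtain N where "\<forall>i\<in>keys \<alpha>. i < N"
    using finite_nat_set_iff_bounded finite_keys by metis
  then show ?thesis
    by (intro exI[of _ N]) (metis supp_below_def in_keys_iff not_less)
qed

text \<open>Exponent vectors are mostly written as functions, which are easy to update and to
  compose with transpositions; only the values below N count.\<close>

definition pm :: "nat \<Rightarrow> (nat \<Rightarrow> nat) \<Rightarrow> (nat \<Rightarrow>\<^sub>0 nat)" where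
  "pm N f = (\<Sum>i<N. single i (f i))"

lemma lookup_pm [simp]: "lookup (pm N f) i = (if i < N then f i else 0)"
  by (simp add: pm_def lookup_sum lookup_single when_def)

lemma supp_below_pm [simp]: "supp_below N (pm N f)"
  by (simp add: supp_below_def)

lemma pm_lookup: "supp_below N \<alpha> \<Longrightarrow> pm N (lookup \<alpha>) = \<alpha>"
  by (intro poly_mapping_eqI) (simp add: supp_below_def)

lemma pm_cong: "(\<And>i. i < N \<Longrightarrow> f i = g i) \<Longrightarrow> pm N f = pm N g"
  by (simp add: pm_def)

lemma pm_eq_iff: "pm N f = pm N g \<longleftrightarrow> (\<forall>i<N. f i = g i)"
  by (metis lookup_pm pm_cong)

section \<open>Setting all but the first N variables to zero\<close>

definition trunc :: "nat \<Rightarrow> rat mps \<Rightarrow> rat mps" where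
  "trunc N f = Abs_mps (\<lambda>\<alpha>. if supp_below N \<alpha> then mps_coeff f \<alpha> else 0)"

lemma mps_coeff_trunc:
  "mps_coeff (trunc N f) \<alpha> = (if supp_below N \<alpha> then mps_coeff f \<alpha> else 0)"
  by (simp add: trunc_def)

lemma trunc_add: "trunc N (f + g) = trunc N f + trunc N g"
  by (rule mps_eqI) (simp add: mps_coeff_trunc)

lemma trunc_diff: "trunc N (f - g) = trunc N f - trunc N g"
  by (rule mps_eqI) (simp add: mps_coeff_trunc)

lemma trunc_scale: "trunc N (mps_scale c f) = mps_scale c (trunc N f)"
  by (rule mps_eqI) (simp add: mps_coeff_trunc)

lemma trunc_0 [simp]: "trunc N 0 = 0"
  by (rule mps_eqI) (simp add: mps_coeff_trunc)

lemma trunc_1 [simp]: "trunc N 1 = 1"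
  by (rule mps_eqI) (simp add: mps_coeff_trunc)

text \<open>Exponents are natural numbers, so a vector supported below N splits only into vectors
  supported below N.\<close>

lemma trunc_mult: "trunc N (f * g) = trunc N f * trunc N g"
proof (rule mps_eqI)
  fix \<alpha>
  show "mps_coeff (trunc N (f * g)) \<alpha> = mps_coeff (trunc N f * trunc N g) \<alpha>"
  proof (cases "supp_below N \<alpha>")
    case True
    then show ?thesis
      unfolding mps_coeff_trunc mps_coeff_mult
      by (auto intro!: sum.cong simp: supp_below_add)
  next
    case False
    then have "mps_coeff (trunc N f * trunc N g) \<alpha> = 0"
      unfolding mps_coeff_trunc mps_coeff_mult
      by (intro sum.neutral) (auto simp: supp_below_add)
    then show ?thesis using False by (simp add: mps_coeff_trunc)
  qed
qed

lemma trunc_sum: "trunc N (sum f A) = (\<Sum>x\<in>A. trunc N (f x))"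
  by (induction A rule: infinite_finite_induct) (simp_all add: trunc_add)

lemma trunc_prod: "trunc N (prod f A) = (\<Prod>x\<in>A. trunc N (f x))"
  by (induction A rule: infinite_finite_induct) (simp_all add: trunc_mult)

lemma trunc_mon: "trunc N (mon \<alpha>) = (if supp_below N \<alpha> then mon \<alpha> else 0)"
  by (rule mps_eqI) (auto simp: mps_coeff_trunc mps_coeff_mon)

lemma supp_below_single: "supp_below N (single i k) \<longleftrightarrow> i < N \<or> k = 0"
  by (auto simp: supp_below_def lookup_single when_def)

lemma trunc_mvar: "trunc N (mvar i) = (if i < N then mvar i else 0)"
  by (simp add: mvar_def trunc_mon supp_below_single)

lemma trunc_trunc: "M \<le> N \<Longrightarrow> trunc M (trunc N f) = trunc M f"
  by (rule mps_eqI) (auto simp: mps_coeff_trunc dest: supp_below_mono)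

text \<open>Each monomial involves finitely many variables. The bound \<open>N0\<close> allows the
  number of variables to be taken as large as convenient.\<close>

lemma mps_eqI_trunc:
  assumes "\<And>N. N \<ge> N0 \<Longrightarrow> trunc N f = trunc N g"
  shows "f = g"
proof (rule mps_eqI)
  fix \<alpha>
  obtain N where "supp_below N \<alpha>" using supp_below_exists by blast
  then have "supp_below (max N N0) \<alpha>" by (rule supp_below_mono) simp
  with assms[of "max N N0"] show "mps_coeff f \<alpha> = mps_coeff g \<alpha>"
    by (metis max.cobounded2 mps_coeff_trunc)
qed

section \<open>Exchanging two variables; symmetric power series\<close>

abbreviation pswap :: "nat \<Rightarrow> nat \<Rightarrow> (nat \<Rightarrow>\<^sub>0 nat) \<Rightarrow> (nat \<Rightarrow>\<^sub>0 nat)" where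
  "pswap i k \<equiv> Poly_Mapping.map_key (transpose i k)"

lemma lookup_pswap: "lookup (pswap i k \<alpha>) x = lookup \<alpha> (transpose i k x)"
  by (subst map_key.rep_eq) (simp_all add: inj_on_transpose)

lemma pswap_pswap [simp]: "pswap i k (pswap i k \<alpha>) = \<alpha>"
  by (intro poly_mapping_eqI) (simp add: lookup_pswap)

lemma pswap_add: "pswap i k (\<alpha> + \<beta>) = pswap i k \<alpha> + pswap i k \<beta>"
  by (intro poly_mapping_eqI) (simp add: lookup_pswap lookup_add)

lemma pswap_single: "pswap i k (single a n) = single (transpose i k a) n"
  by (intro poly_mapping_eqI) (auto simp: lookup_pswap lookup_single when_def)

lemma pswap_eq_iff: "pswap i k \<alpha> = \<beta> \<longleftrightarrow> \<alpha> = pswap i k \<beta>"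
  by (metis pswap_pswap)

lemma pswap_0 [simp]: "pswap i k 0 = 0"
  by (intro poly_mapping_eqI) (simp add: lookup_pswap)

definition vswap :: "nat \<Rightarrow> nat \<Rightarrow> rat mps \<Rightarrow> rat mps" where
  "vswap i k f = Abs_mps (\<lambda>\<alpha>. mps_coeff f (pswap i k \<alpha>))"

lemma mps_coeff_vswap: "mps_coeff (vswap i k f) \<alpha> = mps_coeff f (pswap i k \<alpha>)"
  by (simp add: vswap_def)

lemma vswap_add: "vswap i k (f + g) = vswap i k f + vswap i k g"
  by (rule mps_eqI) (simp add: mps_coeff_vswap)

lemma vswap_diff: "vswap i k (f - g) = vswap i k f - vswap i k g"
  by (rule mps_eqI) (simp add: mps_coeff_vswap)

lemma vswap_scale: "vswap i k (mps_scale c f) = mps_scale c (vswap i k f)"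
  by (rule mps_eqI) (simp add: mps_coeff_vswap)

lemma vswap_0 [simp]: "vswap i k 0 = 0"
  by (rule mps_eqI) (simp add: mps_coeff_vswap)

lemma vswap_1 [simp]: "vswap i k 1 = 1"
  by (rule mps_eqI) (simp add: mps_coeff_vswap pswap_eq_iff[where \<beta> = 0])

lemma vswap_mult: "vswap i k (f * g) = vswap i k f * vswap i k g"
proof (rule mps_eqI)
  fix \<alpha>
  show "mps_coeff (vswap i k (f * g)) \<alpha> = mps_coeff (vswap i k f * vswap i k g) \<alpha>"
    unfolding mps_coeff_vswap mps_coeff_mult
    by (rule sum.reindex_bij_witness[where i = "\<lambda>(\<beta>, \<gamma>). (pswap i k \<beta>, pswap i k \<gamma>)"
          and j = "\<lambda>(\<beta>, \<gamma>). (pswap i k \<beta>, pswap i k \<gamma>)"])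
      (auto simp flip: pswap_add simp: mps_coeff_vswap)
qed

lemma vswap_mon: "vswap i k (mon \<alpha>) = mon (pswap i k \<alpha>)"
  by (rule mps_eqI) (simp add: mps_coeff_vswap mps_coeff_mon pswap_eq_iff[where \<beta> = \<alpha>])

lemma vswap_sum: "vswap i k (sum f A) = (\<Sum>x\<in>A. vswap i k (f x))"
  by (induction A rule: infinite_finite_induct) (simp_all add: vswap_add)

text \<open>Transpositions generate all finite permutations, and being involutions they act on
  exponents without inverses.\<close>

definition sym_mps :: "rat mps \<Rightarrow> bool" where
  "sym_mps f \<longleftrightarrow> (\<forall>i k. vswap i k f = f)"

lemma sym_mps_0: "sym_mps 0" and sym_mps_1: "sym_mps 1"
  and sym_mps_add: "sym_mps f \<Longrightarrow> sym_mps g \<Longrightarrow> sym_mps (f + g)"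
  and sym_mps_diff: "sym_mps f \<Longrightarrow> sym_mps g \<Longrightarrow> sym_mps (f - g)"
  and sym_mps_mult: "sym_mps f \<Longrightarrow> sym_mps g \<Longrightarrow> sym_mps (f * g)"
  and sym_mps_scale: "sym_mps f \<Longrightarrow> sym_mps (mps_scale c f)"
  by (auto simp: sym_mps_def vswap_add vswap_diff vswap_mult vswap_scale)

lemma sym_mps_sum: "(\<And>x. x \<in> A \<Longrightarrow> sym_mps (f x)) \<Longrightarrow> sym_mps (sum f A)"
  by (induction A rule: infinite_finite_induct) (auto simp: sym_mps_0 sym_mps_add)

lemma trunc_vswap: "i < N \<Longrightarrow> k < N \<Longrightarrow> trunc N (vswap i k f) = vswap i k (trunc N f)"
proof (rule mps_eqI)
  fix \<alpha> assume "i < N" "k < N"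
  then have "supp_below N (pswap i k \<alpha>) \<longleftrightarrow> supp_below N \<alpha>"
    by (auto simp: supp_below_def lookup_pswap transpose_def)
  then show "mps_coeff (trunc N (vswap i k f)) \<alpha> = mps_coeff (vswap i k (trunc N f)) \<alpha>"
    by (simp add: mps_coeff_trunc mps_coeff_vswap)
qed

text \<open>The hypothesis equates the coefficient of f at \<beta> with the one at \<beta> + e_i -
  e_k, or with 0 if x_k does not occur in \<beta>. Induction on the exponent of x_k therefore kills
  every coefficient.\<close>

lemma mvar_diff_mult_eq_0:
  assumes "i \<noteq> k" and eq0: "(mvar i - mvar k) * f = 0"
  shows "f = 0"
proof (rule mps_eqI)
  fix \<beta>
  have "mps_coeff f \<beta> = 0" for \<beta>
  proof (induction "lookup \<beta> k" arbitrary: \<beta>)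
    case 0
    let ?\<gamma> = "single i 1 + \<beta>"
    have "mps_coeff (mvar k * f) ?\<gamma> = 0"
      using 0 \<open>i \<noteq> k\<close> by (auto simp: mvar_def mps_coeff_mon_mult lookup_add lookup_single when_def)
    moreover have "mps_coeff (mvar i * f) ?\<gamma> = mps_coeff f \<beta>"
      unfolding mvar_def by (rule mps_coeff_mon_mult_add)
    ultimately show ?case using arg_cong[OF eq0, of "\<lambda>f. mps_coeff f ?\<gamma>"]
      by (simp add: left_diff_distrib)
  next
    case (Suc n)
    let ?\<gamma> = "single i 1 + \<beta>" and ?\<beta> = "\<beta> - single k 1"
    have "\<beta> = single k 1 + ?\<beta>"
      by (rule poly_mapping_nat_diff_add[symmetric]) (use Suc in \<open>auto simp: lookup_single when_def\<close>)
    then have "?\<gamma> = single k 1 + (single i 1 + ?\<beta>)"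
      by (metis add.left_commute)
    then have "mps_coeff (mvar k * f) ?\<gamma> = mps_coeff f (single i 1 + ?\<beta>)"
      unfolding mvar_def using mps_coeff_mon_mult_add by metis
    moreover have "mps_coeff f (single i 1 + ?\<beta>) = 0"
      using Suc \<open>i \<noteq> k\<close> by (intro Suc.hyps(1)) (simp add: lookup_add lookup_minus lookup_single when_def)
    moreover have "mps_coeff (mvar i * f) ?\<gamma> = mps_coeff f \<beta>"
      unfolding mvar_def by (rule mps_coeff_mon_mult_add)
    ultimately show ?case using arg_cong[OF eq0, of "\<lambda>f. mps_coeff f ?\<gamma>"]
      by (simp add: left_diff_distrib)
  qed
  then show "mps_coeff f \<beta> = mps_coeff 0 \<beta>" by simp
qed

section \<open>The Vandermonde product\<close>

fun vdm :: "nat \<Rightarrow> rat mps" where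
  "vdm 0 = 1"
| "vdm (Suc N) = vdm N * (\<Prod>i<N. mvar i - mvar N)"

lemma prod_mvar_diff_cancel:
  assumes "finite A" "k \<notin> A" "(\<Prod>i\<in>A. mvar i - mvar k) * f = 0"
  shows "f = 0"
  using assms
proof (induction A rule: finite_induct)
  case (insert i A)
  then have "(mvar i - mvar k) * ((\<Prod>i\<in>A. mvar i - mvar k) * f) = 0"
    by (metis mult.assoc prod.insert)
  moreover have "i \<noteq> k" using insert.prems(1) by blast
  ultimately have "(\<Prod>i\<in>A. mvar i - mvar k) * f = 0"
    by (rule mvar_diff_mult_eq_0[rotated])
  then show ?case using insert.IH insert.prems(1) by blast
qed simp

text \<open>Cancellation of the Vandermonde product: identities between alternants descend to their
  quotients.\<close>

lemma vdm_mult_eq_0: "vdm N * f = 0 \<Longrightarrow> f = 0"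
proof (induction N arbitrary: f)
  case (Suc N)
  have "vdm N * ((\<Prod>i<N. mvar i - mvar N) * f) = 0"
    using Suc.prems by (simp only: vdm.simps mult.assoc)
  then have "(\<Prod>i<N. mvar i - mvar N) * f = 0" by (rule Suc.IH)
  then show ?case by (rule prod_mvar_diff_cancel[rotated 2]) simp_all
qed simp

section \<open>Alternants\<close>

definition altdet :: "(nat \<Rightarrow> 'a::comm_ring_1) \<Rightarrow> nat \<Rightarrow> (nat \<Rightarrow> nat) \<Rightarrow> 'a" where
  "altdet x N l = det (mat N N (\<lambda>(j, i). x i ^ l j))"

text \<open>The factorization of x^(a-b) - y^(a-b), multiplied by x^b. The left-hand differences are
  the entries of an alternant after a row operation.\<close>

lemma diff_mult_geometric_sum:
  fixes x y :: "'a::comm_ring_1"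
  assumes "b \<le> a"
  shows "(x - y) * (\<Sum>k=b..<a. y ^ (a - 1 - k) * x ^ k) = x ^ a - y ^ (a - b) * x ^ b"
  using assms
proof (induction a rule: dec_induct)
  case (step a)
  have "(\<Sum>k=b..<Suc a. y ^ (Suc a - 1 - k) * x ^ k)
      = (\<Sum>k=b..<a. y * (y ^ (a - 1 - k) * x ^ k)) + x ^ a"
  proof -
    have "(\<Sum>k=b..<a. y ^ (a - k) * x ^ k) = (\<Sum>k=b..<a. y * (y ^ (a - 1 - k) * x ^ k))"
    proof (rule sum.cong)
      fix k assume "k \<in> {b..<a}"
      then have "a - k = Suc (a - 1 - k)" by auto
      then show "y ^ (a - k) * x ^ k = y * (y ^ (a - 1 - k) * x ^ k)"
        by (metis mult.assoc power_Suc)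
    qed simp
    then show ?thesis using step.hyps by simp
  qed
  then have "(x - y) * (\<Sum>k=b..<Suc a. y ^ (Suc a - 1 - k) * x ^ k)
      = y * ((x - y) * (\<Sum>k=b..<a. y ^ (a - 1 - k) * x ^ k)) + (x - y) * x ^ a"
    by (simp add: sum_distrib_left algebra_simps)
  also have "\<dots> = y * (x ^ a - y ^ (a - b) * x ^ b) + (x - y) * x ^ a"
    by (simp only: step.IH)
  also have "\<dots> = x ^ Suc a - y ^ (Suc a - b) * x ^ b"
    using step.hyps by (simp add: Suc_diff_le algebra_simps)
  finally show ?case .
qed simp

text \<open>From row j subtract the multiple of row j + 1 that clears the last column. The other
  entries become divisible by x_i - x_N, and expanding the quotients row by row gives alternants in
  one variable less. The intervals for k_j are the interlacing condition of the branching rule for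
  tableaux, shifted by the staircase.\<close>

lemma altdet_Suc:
  fixes x :: "nat \<Rightarrow> 'a::comm_ring_1"
  assumes l: "\<And>j. j < N \<Longrightarrow> l (Suc j) \<le> l j"
  shows "altdet x (Suc N) l = x N ^ l N * (\<Prod>i<N. x i - x N) *
    (\<Sum>k\<in>PiE {..<N} (\<lambda>j. {l (Suc j)..<l j}). (\<Prod>j<N. x N ^ (l j - 1 - k j)) * altdet x N k)"
proof -
  let ?y = "x N" and ?K = "PiE {..<N} (\<lambda>j. {l (Suc j)..<l j})"
  define M where "M = mat (Suc N) (Suc N) (\<lambda>(j, i). x i ^ l j)"
  \<comment> \<open>Left multiplication by this unitriangular matrix performs all the row operations
    at once and keeps the determinant.\<close>
  define U where "U = mat (Suc N) (Suc N)
    (\<lambda>(j, k). if j = k then 1 else if k = Suc j then - (?y ^ (l j - l (Suc j))) else 0)"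
  define Q where "Q j i = (\<Sum>k=l (Suc j)..<l j. ?y ^ (l j - 1 - k) * x i ^ k)" for j i
  let ?Q = "mat N N (\<lambda>(j, i). Q j i)"
  define A where "A = mat N N (\<lambda>(j, i). (x i - ?y) * Q j i)"
  define B where "B = mat 1 N (\<lambda>(_, i). x i ^ l N)"
  define D where "D = mat 1 1 (\<lambda>_. ?y ^ l N)"
  have M: "M \<in> carrier_mat (Suc N) (Suc N)" and U: "U \<in> carrier_mat (Suc N) (Suc N)"
    by (simp_all add: M_def U_def)
  have detU: "det U = 1"
  proof -
    have "det U = prod_list (diag_mat U)"
      by (rule det_upper_triangular[OF _ U]) (auto simp: U_def)
    also have "\<dots> = 1"
      unfolding prod_list_diag_prod by (rule prod.neutral) (simp add: U_def)
    finally show ?thesis .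
  qed
  have entry: "(U * M) $$ (j, i) = x i ^ l j - (if j < N then ?y ^ (l j - l (Suc j)) * x i ^ l (Suc j) else 0)"
    if "j < Suc N" "i < Suc N" for i j
  proof -
    have "(U * M) $$ (j, i) = (\<Sum>k<Suc N. U $$ (j, k) * M $$ (k, i))"
      using that M U by (simp add: scalar_prod_def lessThan_atLeast0)
    also have "\<dots> = (\<Sum>k<Suc N. (if k = j then x i ^ l j else 0) +
        (if k = Suc j then - (?y ^ (l j - l (Suc j)) * x i ^ l (Suc j)) else 0))"
      using that by (intro sum.cong) (auto simp: U_def M_def)
    also have "\<dots> = x i ^ l j - (if j < N then ?y ^ (l j - l (Suc j)) * x i ^ l (Suc j) else 0)"
      using that by (subst sum.distrib) (simp add: sum.delta del: sum.lessThan_Suc)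
    finally show ?thesis .
  qed
  have "U * M = four_block_mat A (0\<^sub>m N 1) B D"
  proof (rule eq_matI)
    fix j i
    assume "j < dim_row (four_block_mat A (0\<^sub>m N 1) B D)" "i < dim_col (four_block_mat A (0\<^sub>m N 1) B D)"
    then have ji: "j < Suc N" "i < Suc N" by (simp_all add: A_def D_def)
    have A: "A $$ (j, i) = x i ^ l j - ?y ^ (l j - l (Suc j)) * x i ^ l (Suc j)" if "j < N" "i < N"
      using that l[of j] diff_mult_geometric_sum[of "l (Suc j)" "l j" "x i" ?y] by (simp add: A_def Q_def)
    show "(U * M) $$ (j, i) = four_block_mat A (0\<^sub>m N 1) B D $$ (j, i)"
    proof (cases "j < N")
      case True
      show ?thesis
      proof (cases "i < N")
        case True
        then show ?thesis using \<open>j < N\<close> ji A by (subst entry) (auto simp: A_def D_def B_def)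
      next
        case False
        then have "i = N" using ji by simp
        have "?y ^ (l j - l (Suc j)) * ?y ^ l (Suc j) = ?y ^ l j"
          using l[OF \<open>j < N\<close>] by (simp flip: power_add)
        then show ?thesis using \<open>j < N\<close> ji \<open>i = N\<close> by (subst entry) (auto simp: A_def D_def B_def)
      qed
    next
      case False
      then have "j = N" using ji by simp
      then show ?thesis using ji by (subst entry) (auto simp: A_def D_def B_def less_Suc_eq)
    qed
  qed (use M U in \<open>simp_all add: A_def D_def\<close>)
  then have "det M = det A * det D"
    using det_mult[OF U M] detU
      det_four_block_mat_upper_right_zero_col[of A N "0\<^sub>m N 1" B D]
    by (simp add: A_def B_def D_def)
  also have "det D = ?y ^ l N"
    by (subst det_single) (simp_all add: D_def)
  \<comment> \<open>Every entry of column i contains the factor x_i - x_N, so it is pulled out once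
    per column.\<close>
  also have "det A = (\<Prod>i<N. x i - ?y) * det ?Q"
  proof -
    have "det A = (\<Sum>p | p permutes {0..<N}. signof p * (\<Prod>i<N. A $$ (p i, i)))"
      by (rule det_col) (simp add: A_def)
    also have "\<dots> = (\<Sum>p | p permutes {0..<N}.
        (\<Prod>i<N. x i - ?y) * (signof p * (\<Prod>i<N. ?Q $$ (p i, i))))"
    proof (rule sum.cong)
      fix p assume "p \<in> {p. p permutes {0..<N}}"
      then have p: "p i < N" if "i < N" for i
        using that by (metis mem_Collect_eq permutes_in_image atLeastLessThan_iff le0)
      have "(\<Prod>i<N. A $$ (p i, i)) = (\<Prod>i<N. (x i - ?y) * ?Q $$ (p i, i))"
        using p by (intro prod.cong) (simp_all add: A_def)
      then show "signof p * (\<Prod>i<N. A $$ (p i, i)) =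
          (\<Prod>i<N. x i - ?y) * (signof p * (\<Prod>i<N. ?Q $$ (p i, i)))"
        by (simp only: prod.distrib mult.left_commute)
    qed simp
    also have "\<dots> = (\<Prod>i<N. x i - ?y) * det ?Q"
      by (subst det_col[of _ N]) (simp_all add: sum_distrib_left)
    finally show ?thesis .
  qed
  \<comment> \<open>Multilinearity in the rows: a product of sums becomes a sum over all choices of
    one exponent k_j per row.\<close>
  also have "det ?Q = (\<Sum>k\<in>?K.
      (\<Prod>j<N. ?y ^ (l j - 1 - k j)) * altdet x N k)"
  proof -
    have "det ?Q
        = (\<Sum>p | p permutes {0..<N}. signof p * (\<Prod>j<N. Q j (p j)))"
    proof (subst det_def'[of _ N])
      show "(\<Sum>p | p permutes {0..<N}. signof p * (\<Prod>i=0..<N. ?Q $$ (i, p i)))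
          = (\<Sum>p | p permutes {0..<N}. signof p * (\<Prod>j<N. Q j (p j)))"
        by (intro sum.cong arg_cong2[of _ _ _ _ "(*)"] prod.cong)
          (auto simp: lessThan_atLeast0 dest: permutes_in_image)
    qed simp
    also have "\<dots> = (\<Sum>p | p permutes {0..<N}. signof p * (\<Sum>k\<in>?K.
        (\<Prod>j<N. ?y ^ (l j - 1 - k j)) * (\<Prod>j<N. x (p j) ^ k j)))"
      unfolding Q_def by (simp add: prod_sum_PiE prod.distrib)
    also have "\<dots> = (\<Sum>k\<in>?K. (\<Prod>j<N. ?y ^ (l j - 1 - k j)) *
        (\<Sum>p | p permutes {0..<N}. signof p * (\<Prod>j<N. x (p j) ^ k j)))"
      unfolding sum_distrib_left by (subst sum.swap) (simp only: mult.left_commute)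
    also have "(\<lambda>k. \<Sum>p | p permutes {0..<N}. signof p * (\<Prod>j<N. x (p j) ^ k j)) = altdet x N"
    proof
      fix k
      show "(\<Sum>p | p permutes {0..<N}. signof p * (\<Prod>j<N. x (p j) ^ k j)) = altdet x N k"
        unfolding altdet_def
        by (subst det_def'[of _ N])
          (auto intro!: sum.cong arg_cong2[of _ _ _ _ "(*)"] prod.cong simp: lessThan_atLeast0
            dest: permutes_in_image)
    qed
    finally show ?thesis .
  qed
  finally show ?thesis by (simp add: altdet_def M_def mult_ac)
qed

section \<open>Tableaux with bounded entries\<close>

definition cells_below :: "nat \<Rightarrow> (nat \<Rightarrow> nat) \<Rightarrow> (nat \<times> nat) set" where
  "cells_below N s = Sigma {..<N} (\<lambda>i. {..<s i})"

text \<open>Semistandard tableaux with at most N rows and entries below N. The shape is a function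
  instead of a list, so that shapes with zero rows need no normalization in the induction on
  N.\<close>

definition tabs :: "nat \<Rightarrow> (nat \<Rightarrow> nat) \<Rightarrow> (nat \<times> nat \<Rightarrow> nat) set" where
  "tabs N s = {T \<in> cells_below N s \<rightarrow>\<^sub>E {..<N}.
     (\<forall>i j. i < N \<longrightarrow> Suc j < s i \<longrightarrow> T (i, j) \<le> T (i, Suc j)) \<and>
     (\<forall>i j. Suc i < N \<longrightarrow> j < s (Suc i) \<longrightarrow> T (i, j) < T (Suc i, j))}"

definition tab_gen :: "nat \<Rightarrow> (nat \<Rightarrow> nat) \<Rightarrow> rat mps" where
  "tab_gen N s = (\<Sum>T\<in>tabs N s. \<Prod>c\<in>cells_below N s. mvar (T c))"

lemma finite_cells_below [simp]: "finite (cells_below N s)"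
  by (simp add: cells_below_def)

lemma finite_tabs [simp]: "finite (tabs N s)"
  by (rule finite_subset[of _ "cells_below N s \<rightarrow>\<^sub>E {..<N}"])
    (auto simp: tabs_def intro: finite_PiE)

lemma downward_closed_nat:
  fixes A :: "nat set"
  assumes "finite A" and "\<And>x y. x \<in> A \<Longrightarrow> y < x \<Longrightarrow> y \<in> A"
  shows "A = {..<card A}"
proof (cases "A = {}")
  case False
  have "A = {..Max A}"
  proof
    show "A \<subseteq> {..Max A}" using assms(1) by auto
    show "{..Max A} \<subseteq> A"
      using assms(2)[OF Max_in[OF assms(1) False]] Max_in[OF assms(1) False]
      by (metis atMost_iff le_neq_implies_less subsetI)
  qed
  then show ?thesis by (metis card_atMost lessThan_Suc_atMost)
qed simp

section \<open>Branching of tableaux by removing the cells with the largest entry\<close>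

context
  fixes N :: nat and s :: "nat \<Rightarrow> nat"
  assumes s: "\<And>i. i < N \<Longrightarrow> s (Suc i) \<le> s i"
begin

text \<open>The part of the shape with entries below N. It is made extensional because interlacing
  shapes are enumerated by a \<open>PiE\<close> set.\<close>

definition inner_shape :: "(nat \<times> nat \<Rightarrow> nat) \<Rightarrow> nat \<Rightarrow> nat" where
  "inner_shape T = restrict (\<lambda>i. card {j. j < s i \<and> T (i, j) < N}) {..<N}"

definition extend_tab :: "(nat \<Rightarrow> nat) \<Rightarrow> (nat \<times> nat \<Rightarrow> nat) \<Rightarrow> nat \<times> nat \<Rightarrow> nat" where
  "extend_tab \<kappa> T = (\<lambda>(i, j). if i < N \<and> j < \<kappa> i then T (i, j)
     else if i < Suc N \<and> j < s i then N else undefined)"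

lemma tabs_row_mono:
  assumes "T \<in> tabs (Suc N) s" "i < Suc N" "j \<le> j'" "j' < s i"
  shows "T (i, j) \<le> T (i, j')"
  using assms(3,4)
proof (induction j' rule: dec_induct)
  case (step j')
  then have "T (i, j') \<le> T (i, Suc j')" using assms(1,2) by (auto simp: tabs_def)
  then show ?case using step by simp
qed simp

text \<open>Columns increase strictly from an entry at least 0. In the last row i = N this forces
  every entry to be N, which is why the inner shape has only N rows.\<close>

lemma tabs_ge_row:
  assumes "T \<in> tabs (Suc N) s" "i < Suc N" "j < s i"
  shows "i \<le> T (i, j)"
  using assms(2,3)
proof (induction i)
  case (Suc i)
  then have "T (i, j) < T (Suc i, j)" using assms(1) by (auto simp: tabs_def)
  moreover have "i \<le> T (i, j)" using Suc s[of i] by auto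
  ultimately show ?case by simp
qed simp

lemma tabs_less:
  assumes "T \<in> tabs (Suc N) s" "i < Suc N" "j < s i"
  shows "T (i, j) < Suc N"
proof -
  have "T \<in> cells_below (Suc N) s \<rightarrow>\<^sub>E {..<Suc N}" using assms(1) by (simp add: tabs_def)
  moreover have "(i, j) \<in> cells_below (Suc N) s" using assms by (simp add: cells_below_def)
  ultimately have "T (i, j) \<in> {..<Suc N}" by (rule PiE_mem)
  then show ?thesis by simp
qed

lemma inner_shape_iff:
  assumes "T \<in> tabs (Suc N) s" "i < N"
  shows "j < inner_shape T i \<longleftrightarrow> j < s i \<and> T (i, j) < N"
proof -
  let ?A = "{j. j < s i \<and> T (i, j) < N}"
  have "?A = {..<card ?A}"
  proof (rule downward_closed_nat)
    fix x y assume "x \<in> ?A" "y < x"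
    moreover from this have "T (i, y) \<le> T (i, x)"
      using assms by (intro tabs_row_mono) auto
    ultimately show "y \<in> ?A" by auto
  qed simp
  then have "j \<in> ?A \<longleftrightarrow> j < card ?A" by blast
  then show ?thesis using assms by (simp add: inner_shape_def)
qed

lemma inner_shape_le:
  assumes "T \<in> tabs (Suc N) s" "i < N"
  shows "inner_shape T i \<le> s i"
  using inner_shape_iff[OF assms] by (metis not_le_imp_less order_less_irrefl)

text \<open>Below a cell with the maximal entry N there can be no cell, since its entry would exceed
  N. So the removed cells form a horizontal strip.\<close>

lemma inner_shape_ge:
  assumes "T \<in> tabs (Suc N) s" "i < N"
  shows "s (Suc i) \<le> inner_shape T i"
proof (rule ccontr)
  assume "\<not> ?thesis"
  then have less: "inner_shape T i < s (Suc i)" by simp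
  moreover have "\<forall>i j. Suc i < Suc N \<longrightarrow> j < s (Suc i) \<longrightarrow> T (i, j) < T (Suc i, j)"
    using assms(1) unfolding tabs_def by blast
  ultimately have "T (i, inner_shape T i) < T (Suc i, inner_shape T i)"
    using assms(2) by simp
  moreover have "T (Suc i, inner_shape T i) < Suc N"
    using tabs_less[OF assms(1), of "Suc i"] assms(2) less by simp
  ultimately have "inner_shape T i < inner_shape T i"
    using inner_shape_iff[OF assms, of "inner_shape T i"] less s[OF assms(2)] by simp
  then show False by simp
qed

lemma inner_tab:
  assumes T: "T \<in> tabs (Suc N) s"
  shows "restrict T (cells_below N (inner_shape T)) \<in> tabs N (inner_shape T)"
proof -
  have "restrict T (cells_below N (inner_shape T)) \<in> cells_below N (inner_shape T) \<rightarrow>\<^sub>E {..<N}"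
    using inner_shape_iff[OF T] by (auto simp: cells_below_def)
  moreover have "T (i, j) \<le> T (i, Suc j)" if "i < N" "Suc j < inner_shape T i" for i j
    using that inner_shape_iff[OF T that(1)] T by (auto simp: tabs_def)
  moreover have "T (i, j) < T (Suc i, j) \<and> j < inner_shape T i" if "Suc i < N" "j < inner_shape T (Suc i)" for i j
    using that inner_shape_iff[OF T that(1)] inner_shape_ge[OF T, of i] T by (auto simp: tabs_def)
  ultimately show ?thesis by (simp add: tabs_def cells_below_def)
qed

lemma extend_inner:
  assumes T: "T \<in> tabs (Suc N) s"
  shows "extend_tab (inner_shape T) (restrict T (cells_below N (inner_shape T))) = T"
proof (rule ext, safe)
  fix i j
  show "extend_tab (inner_shape T) (restrict T (cells_below N (inner_shape T))) (i, j) = T (i, j)"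
  proof (cases "i < N \<and> j < inner_shape T i")
    case True
    then show ?thesis by (simp add: extend_tab_def cells_below_def)
  next
    case False
    show ?thesis
    proof (cases "i < Suc N \<and> j < s i")
      case True
      then have "T (i, j) < Suc N" "i \<le> T (i, j)"
        using T tabs_less tabs_ge_row by auto
      then have "T (i, j) = N"
        using False True inner_shape_iff[OF T, of i j] by (cases "i < N") auto
      then show ?thesis using True False by (auto simp: extend_tab_def)
    next
      case outer: False
      then have "(i, j) \<notin> cells_below (Suc N) s" by (auto simp: cells_below_def)
      moreover have "T \<in> cells_below (Suc N) s \<rightarrow>\<^sub>E {..<Suc N}" using T by (simp add: tabs_def)
      ultimately have "T (i, j) = undefined" by (metis PiE_arb)
      then show ?thesis using False outer by (auto simp: extend_tab_def)
    qed
  qed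
qed

context
  fixes \<kappa> T assumes \<kappa>: "\<kappa> \<in> PiE {..<N} (\<lambda>i. {s (Suc i)..s i})" and T: "T \<in> tabs N \<kappa>"
begin

lemma interlace: "i < N \<Longrightarrow> s (Suc i) \<le> \<kappa> i" "i < N \<Longrightarrow> \<kappa> i \<le> s i"
  using \<kappa> by (auto dest!: PiE_mem)

lemma inner_less: "i < N \<Longrightarrow> j < \<kappa> i \<Longrightarrow> T (i, j) < N"
proof -
  assume "i < N" "j < \<kappa> i"
  moreover have "T \<in> cells_below N \<kappa> \<rightarrow>\<^sub>E {..<N}" using T by (simp add: tabs_def)
  moreover have "(i, j) \<in> cells_below N \<kappa>" using \<open>i < N\<close> \<open>j < \<kappa> i\<close> by (simp add: cells_below_def)
  ultimately have "T (i, j) \<in> {..<N}" by (metis PiE_mem)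
  then show ?thesis by simp
qed

lemma extend_tab_in: "extend_tab \<kappa> T \<in> tabs (Suc N) s"
proof -
  have "extend_tab \<kappa> T \<in> cells_below (Suc N) s \<rightarrow>\<^sub>E {..<Suc N}"
  proof (rule PiE_I)
    fix c assume "c \<in> cells_below (Suc N) s"
    then show "extend_tab \<kappa> T c \<in> {..<Suc N}"
      using inner_less by (cases c) (simp add: extend_tab_def cells_below_def less_SucI)
  next
    fix c assume c: "c \<notin> cells_below (Suc N) s"
    obtain i j where "c = (i, j)" by (cases c)
    with c interlace(2)[of i] show "extend_tab \<kappa> T c = undefined"
      by (auto simp: extend_tab_def cells_below_def)
  qed
  moreover have "extend_tab \<kappa> T (i, j) \<le> extend_tab \<kappa> T (i, Suc j)" if "i < Suc N" "Suc j < s i" for i j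
  proof (cases "i < N \<and> Suc j < \<kappa> i")
    case True
    then show ?thesis using T by (auto simp: extend_tab_def tabs_def)
  next
    case False
    then have "extend_tab \<kappa> T (i, Suc j) = N" using that by (auto simp: extend_tab_def)
    moreover have "extend_tab \<kappa> T (i, j) \<le> N"
      using inner_less[of i j] that by (auto simp: extend_tab_def)
    ultimately show ?thesis by simp
  qed
  moreover have "extend_tab \<kappa> T (i, j) < extend_tab \<kappa> T (Suc i, j)" if "Suc i < Suc N" "j < s (Suc i)" for i j
  proof -
    have "j < \<kappa> i" using that interlace(1)[of i] by simp
    then have *: "extend_tab \<kappa> T (i, j) = T (i, j)" "T (i, j) < N"
      using that inner_less[of i j] by (auto simp: extend_tab_def)
    show ?thesis
    proof (cases "Suc i < N \<and> j < \<kappa> (Suc i)")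
      case True
      then show ?thesis using T * by (auto simp: extend_tab_def tabs_def)
    next
      case False
      then have "extend_tab \<kappa> T (Suc i, j) = N" using that by (auto simp: extend_tab_def)
      then show ?thesis using * by simp
    qed
  qed
  ultimately show ?thesis by (simp add: tabs_def)
qed

lemma inner_shape_extend: "inner_shape (extend_tab \<kappa> T) = \<kappa>"
proof (rule ext)
  fix i
  show "inner_shape (extend_tab \<kappa> T) i = \<kappa> i"
  proof (cases "i < N")
    case True
    have "{j. j < s i \<and> extend_tab \<kappa> T (i, j) < N} = {..<\<kappa> i}"
      using interlace(2)[OF True] inner_less[OF True] True by (auto simp: extend_tab_def split: if_splits)
    then show ?thesis using True by (simp add: inner_shape_def)
  next
    case False
    then show ?thesis using PiE_arb[OF \<kappa>, of i] by (simp add: inner_shape_def)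
  qed
qed

lemma restrict_extend: "restrict (extend_tab \<kappa> T) (cells_below N \<kappa>) = T"
proof (rule ext)
  fix c
  have T': "T \<in> cells_below N \<kappa> \<rightarrow>\<^sub>E {..<N}" using T by (simp add: tabs_def)
  show "restrict (extend_tab \<kappa> T) (cells_below N \<kappa>) c = T c"
  proof (cases "c \<in> cells_below N \<kappa>")
    case True
    then show ?thesis by (auto simp: extend_tab_def cells_below_def)
  next
    case False
    then show ?thesis using PiE_arb[OF T' False] by simp
  qed
qed

lemma prod_extend:
  "(\<Prod>c\<in>cells_below (Suc N) s. mvar (extend_tab \<kappa> T c)) =
    mvar N ^ (s N + (\<Sum>i<N. s i - \<kappa> i)) * (\<Prod>c\<in>cells_below N \<kappa>. mvar (T c))"
proof -
  let ?C = "cells_below (Suc N) s" and ?K = "cells_below N \<kappa>"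
  have sub: "?K \<subseteq> ?C"
    using interlace(2) by (force simp: cells_below_def)
  have "card (?C - ?K) = (\<Sum>i<Suc N. s i) - (\<Sum>i<N. \<kappa> i)"
    using sub by (simp add: card_Diff_subset) (simp add: cells_below_def)
  also have "\<dots> = s N + (\<Sum>i<N. s i - \<kappa> i)"
  proof -
    have "(\<Sum>i<N. s i - \<kappa> i) = (\<Sum>i<N. s i) - (\<Sum>i<N. \<kappa> i)"
      using interlace(2) by (intro sum_subtractf_nat) auto
    moreover have "(\<Sum>i<N. \<kappa> i) \<le> (\<Sum>i<N. s i)" using interlace(2) by (intro sum_mono) auto
    ultimately show ?thesis by simp
  qed
  finally have card: "card (?C - ?K) = s N + (\<Sum>i<N. s i - \<kappa> i)" .
  have "(\<Prod>c\<in>?C. mvar (extend_tab \<kappa> T c)) =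
      (\<Prod>c\<in>?C - ?K. mvar (extend_tab \<kappa> T c)) * (\<Prod>c\<in>?K. mvar (extend_tab \<kappa> T c))"
    using sub by (intro prod.subset_diff) simp_all
  also have "(\<Prod>c\<in>?C - ?K. mvar (extend_tab \<kappa> T c)) = (\<Prod>c\<in>?C - ?K. mvar N)"
  proof (rule prod.cong)
    fix c assume "c \<in> ?C - ?K"
    then have "extend_tab \<kappa> T c = N"
      by (cases c) (auto simp: extend_tab_def cells_below_def)
    then show "mvar (extend_tab \<kappa> T c) = mvar N" by simp
  qed simp
  also have "\<dots> = mvar N ^ (s N + (\<Sum>i<N. s i - \<kappa> i))"
    by (simp add: card)
  also have "(\<Prod>c\<in>?K. mvar (extend_tab \<kappa> T c)) = (\<Prod>c\<in>?K. mvar (T c))"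
  proof (rule prod.cong)
    fix c assume "c \<in> ?K"
    then have "extend_tab \<kappa> T c = T c"
      by (cases c) (simp add: extend_tab_def cells_below_def)
    then show "mvar (extend_tab \<kappa> T c) = mvar (T c)" by simp
  qed simp
  finally show ?thesis .
qed

end

text \<open>A tableau corresponds to its inner shape together with the inner tableau. The exponent
  of x_N counts the removed cells: the whole last row and the end of each other row.\<close>

lemma tab_gen_Suc:
  "tab_gen (Suc N) s = (\<Sum>\<kappa>\<in>PiE {..<N} (\<lambda>i. {s (Suc i)..s i}).
     mvar N ^ (s N + (\<Sum>i<N. s i - \<kappa> i)) * tab_gen N \<kappa>)"
proof -
  let ?f = "\<lambda>(\<kappa>, T). extend_tab \<kappa> T"
  let ?g = "\<lambda>T. (inner_shape T, restrict T (cells_below N (inner_shape T)))"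
  let ?P = "PiE {..<N} (\<lambda>i. {s (Suc i)..s i})"
  have "(\<Sum>\<kappa>\<in>?P. mvar N ^ (s N + (\<Sum>i<N. s i - \<kappa> i)) * tab_gen N \<kappa>) =
      (\<Sum>\<kappa>\<in>?P. \<Sum>T\<in>tabs N \<kappa>. mvar N ^ (s N + (\<Sum>i<N. s i - \<kappa> i)) *
        (\<Prod>c\<in>cells_below N \<kappa>. mvar (T c)))"
    by (simp add: tab_gen_def sum_distrib_left)
  also have "\<dots> = (\<Sum>(\<kappa>, T)\<in>Sigma ?P (tabs N). mvar N ^ (s N + (\<Sum>i<N. s i - \<kappa> i)) *
        (\<Prod>c\<in>cells_below N \<kappa>. mvar (T c)))"
    by (intro sum.Sigma) (simp_all add: finite_PiE)
  also have "\<dots> = tab_gen (Suc N) s"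
    unfolding tab_gen_def
  proof (rule sum.reindex_bij_witness[where
        j = ?f and
        i = ?g])
    fix p assume "p \<in> Sigma ?P (tabs N)"
    then obtain \<kappa> T where p: "p = (\<kappa>, T)" "\<kappa> \<in> ?P" "T \<in> tabs N \<kappa>" by blast
    show "?g (?f p) = p"
      using p inner_shape_extend restrict_extend by simp
    show "?f p \<in> tabs (Suc N) s"
      using p extend_tab_in by simp
    show "(\<Prod>c\<in>cells_below (Suc N) s. mvar (?f p c)) =
        (case p of (\<kappa>, T) \<Rightarrow> mvar N ^ (s N + (\<Sum>i<N. s i - \<kappa> i)) *
        (\<Prod>c\<in>cells_below N \<kappa>. mvar (T c)))"
      using p prod_extend by simp
  next
    fix T assume T: "T \<in> tabs (Suc N) s"
    show "?f (?g T) = T"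
      using extend_inner[OF T] by simp
    have "inner_shape T \<in> ?P"
      using inner_shape_le[OF T] inner_shape_ge[OF T] by (auto simp: inner_shape_def)
    then show "?g T \<in> Sigma ?P (tabs N)"
      using inner_tab[OF T] by simp
  qed
  finally show ?thesis ..
qed

end

text \<open>The bialternant formula. Tableaux and alternants obey the same recursion in N, by
  \<open>tab_gen_Suc\<close> and \<open>altdet_Suc\<close>.\<close>

lemma vdm_mult_tab_gen:
  assumes "\<And>i. Suc i < N \<Longrightarrow> s (Suc i) \<le> s i"
  shows "vdm N * tab_gen N s = altdet mvar N (\<lambda>j. s j + (N - 1 - j))"
  using assms
proof (induction N arbitrary: s)
  case 0
  have "tabs 0 s = {\<lambda>_. undefined}" by (auto simp: tabs_def cells_below_def)
  then show ?case by (simp add: tab_gen_def cells_below_def altdet_def det_def)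
next
  case (Suc N)
  let ?P = "PiE {..<N} (\<lambda>i. {s (Suc i)..s i})" and ?V = "\<Prod>i<N. mvar i - mvar N"
  let ?l = "\<lambda>j. s j + (Suc N - 1 - j)"
  \<comment> \<open>Adding the staircase turns the closed interlacing intervals from s_(j+1) to s_j
    into the half-open intervals from l_(j+1) to l_j: both staircases differ by one at j and agree
    at j + 1.\<close>
  let ?up = "\<lambda>\<kappa>. restrict (\<lambda>j. \<kappa> j + (N - 1 - j)) {..<N}" and ?dn = "\<lambda>k. restrict (\<lambda>j. k j - (N - 1 - j)) {..<N}"
  have s: "s (Suc i) \<le> s i" if "i < N" for i using Suc.prems that by simp
  have IH: "vdm N * tab_gen N \<kappa> = altdet mvar N (\<lambda>j. \<kappa> j + (N - 1 - j))" if "\<kappa> \<in> ?P" for \<kappa>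
  proof (rule Suc.IH)
    fix i assume "Suc i < N"
    then have "\<kappa> (Suc i) \<in> {s (Suc (Suc i))..s (Suc i)}" "\<kappa> i \<in> {s (Suc i)..s i}"
      using that PiE_mem[of \<kappa> "{..<N}"] by (metis lessThan_iff, metis Suc_lessD lessThan_iff)
    then show "\<kappa> (Suc i) \<le> \<kappa> i" by simp
  qed
  have "vdm (Suc N) * tab_gen (Suc N) s =
      ?V * (\<Sum>\<kappa>\<in>?P. mvar N ^ (s N + (\<Sum>i<N. s i - \<kappa> i)) * (vdm N * tab_gen N \<kappa>))"
    by (subst tab_gen_Suc) (use s in \<open>simp_all add: sum_distrib_left mult_ac\<close>)
  also have "\<dots> = ?V * (\<Sum>\<kappa>\<in>?P. mvar N ^ (s N + (\<Sum>i<N. s i - \<kappa> i)) *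
      altdet mvar N (\<lambda>j. \<kappa> j + (N - 1 - j)))"
    using IH by simp
  also have "\<dots> = ?V * (\<Sum>k\<in>PiE {..<N} (\<lambda>j. {?l (Suc j)..<?l j}).
      mvar N ^ (s N + (\<Sum>j<N. ?l j - 1 - k j)) * altdet mvar N k)"
  proof (rule arg_cong[of _ _ "(*) ?V"], rule sum.reindex_bij_witness[where
        j = ?up and
        i = ?dn])
    fix \<kappa> assume \<kappa>: "\<kappa> \<in> ?P"
    then have \<kappa>i: "s (Suc i) \<le> \<kappa> i" "\<kappa> i \<le> s i" if "i < N" for i
      using that by (auto dest!: PiE_mem)
    show "?dn (?up \<kappa>) = \<kappa>"
    proof
      fix i
      show "?dn (?up \<kappa>) i = \<kappa> i"
        using PiE_arb[OF \<kappa>, of i] by simp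
    qed
    show "?up \<kappa> \<in> PiE {..<N} (\<lambda>j. {?l (Suc j)..<?l j})"
    proof (rule restrict_PiE_iff[THEN iffD2], safe)
      fix j assume "j < N"
      then show "\<kappa> j + (N - 1 - j) \<in> {?l (Suc j)..<?l j}"
        using \<kappa>i[of j] by auto
    qed
    have "(\<Sum>j<N. ?l j - 1 - ?up \<kappa> j) = (\<Sum>i<N. s i - \<kappa> i)"
      by (intro sum.cong) auto
    moreover have "altdet mvar N (?up \<kappa>) =
        altdet mvar N (\<lambda>j. \<kappa> j + (N - 1 - j))"
      unfolding altdet_def by (intro arg_cong[of _ _ det] cong_mat) auto
    ultimately show "mvar N ^ (s N + (\<Sum>j<N. ?l j - 1 - ?up \<kappa> j)) *
        altdet mvar N (?up \<kappa>) =
        mvar N ^ (s N + (\<Sum>i<N. s i - \<kappa> i)) * altdet mvar N (\<lambda>j. \<kappa> j + (N - 1 - j))"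
      by simp
  next
    fix k assume k: "k \<in> PiE {..<N} (\<lambda>j. {?l (Suc j)..<?l j})"
    then have kj: "?l (Suc j) \<le> k j" "k j < ?l j" if "j < N" for j
      using that PiE_mem[OF k, of j] by auto
    show "?up (?dn k) = k"
    proof
      fix j
      show "?up (?dn k) j = k j"
        using PiE_arb[OF k, of j] kj[of j] by (cases "j < N") auto
    qed
    show "?dn k \<in> ?P"
    proof (rule restrict_PiE_iff[THEN iffD2], safe)
      fix j assume "j < N"
      then show "k j - (N - 1 - j) \<in> {s (Suc j)..s j}"
        using kj[of j] by auto
    qed
  qed
  also have "\<dots> = altdet mvar (Suc N) ?l"
  proof (subst altdet_Suc)
    fix j assume "j < N"
    then show "?l (Suc j) \<le> ?l j" using s[of j] by simp
  qed (simp add: power_add power_sum sum_distrib_left mult_ac)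
  finally show ?case .
qed

section \<open>Leibniz expansion and antisymmetry of alternants\<close>

lemma mps_coeff_sign_mult:
  "mps_coeff (of_int (sign p) * f) \<alpha> = of_int (sign p) * mps_coeff f \<alpha>"
  by (cases "evenperm p") (simp_all add: sign_def)

lemma vswap_sign: "vswap i k (of_int (sign p)) = of_int (sign p)"
proof (cases "evenperm p")
  case False
  have "vswap i k (- 1) = vswap i k (0 - 1)" by simp
  also have "\<dots> = - 1" unfolding vswap_diff by simp
  finally show ?thesis using False by (simp add: sign_def)
qed (simp add: sign_def)

lemma altdet_mvar:
  "altdet mvar N l = (\<Sum>p | p permutes {0..<N}. of_int (sign p) * mon (pm N (l \<circ> p)))"
proof -
  let ?A = "\<lambda>p. \<Prod>i<N. mat N N (\<lambda>(j, i). mvar i ^ l j) $$ (p i, i)"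
  have "altdet mvar N l = (\<Sum>p | p permutes {0..<N}. of_int (sign p) *
      ?A p)"
    unfolding altdet_def by (rule det_col) simp
  also have "\<dots> = (\<Sum>p | p permutes {0..<N}. of_int (sign p) * mon (pm N (l \<circ> p)))"
  proof (rule sum.cong)
    fix p assume "p \<in> {p. p permutes {0..<N}}"
    then have p: "p i < N" if "i < N" for i
      using that by (metis mem_Collect_eq permutes_in_image atLeastLessThan_iff le0)
    have "?A p
        = (\<Prod>i<N. mon (single i (l (p i))))"
      using p by (intro prod.cong) (simp_all add: mvar_power)
    also have "\<dots> = mon (pm N (l \<circ> p))"
      by (simp add: mon_prod pm_def)
    finally show "of_int (sign p) * ?A p =
      of_int (sign p) * mon (pm N (l \<circ> p))" by simp
  qed simp
  finally show ?thesis .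
qed

lemma pswap_pm: "i < N \<Longrightarrow> k < N \<Longrightarrow> pswap i k (pm N g) = pm N (g \<circ> transpose i k)"
  by (intro poly_mapping_eqI) (auto simp: lookup_pswap transpose_def)

lemma vswap_altdet:
  assumes "i < N" "k < N" "i \<noteq> k"
  shows "vswap i k (altdet mvar N l) = - altdet mvar N l"
proof -
  let ?P = "{p. p permutes {0..<N}}"
  have sign: "sign (p \<circ> transpose i k) = - sign p" if "p \<in> ?P" for p
    using that assms
    by (subst sign_compose) (auto simp: sign_swap_id permutation_swap_id
        intro: permutes_imp_permutation[of "{0..<N}"])
  have perm: "p \<circ> transpose i k \<in> ?P" if "p \<in> ?P" for p
    using that assms permutes_compose[OF permutes_swap_id[of i "{0..<N}" k]] by simp
  have "vswap i k (altdet mvar N l)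
      = (\<Sum>p\<in>?P. of_int (sign p) * mon (pm N (l \<circ> (p \<circ> transpose i k))))"
    using assms by (simp add: altdet_mvar vswap_sum vswap_mult vswap_sign vswap_mon pswap_pm o_assoc)
  also have "\<dots> = (\<Sum>p\<in>?P. - (of_int (sign p) * mon (pm N (l \<circ> p))))"
  proof (rule sum.reindex_bij_witness[where i = "\<lambda>p. p \<circ> transpose i k" and j = "\<lambda>p. p \<circ> transpose i k"])
    fix p assume p: "p \<in> ?P"
    show "- (of_int (sign (p \<circ> transpose i k)) * mon (pm N (l \<circ> (p \<circ> transpose i k)))) =
        of_int (sign p) * mon (pm N (l \<circ> (p \<circ> transpose i k)))"
      unfolding sign[OF p] by simp
    show "p \<circ> transpose i k \<in> ?P" "p \<circ> transpose i k \<in> ?P" using perm[OF p] by simp_all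
  qed (simp_all add: o_assoc[symmetric])
  also have "\<dots> = - altdet mvar N l" by (simp add: altdet_mvar sum_negf)
  finally show ?thesis .
qed

text \<open>The Vandermonde determinant is the bialternant formula for the empty shape, whose only
  tableau is empty.\<close>

lemma vdm_eq_altdet: "vdm N = altdet mvar N (\<lambda>j. N - 1 - j)"
proof -
  have "tabs N (\<lambda>_. 0) = {\<lambda>_. undefined}" by (auto simp: tabs_def cells_below_def)
  then have "tab_gen N (\<lambda>_. 0) = 1" by (simp add: tab_gen_def cells_below_def)
  then show ?thesis using vdm_mult_tab_gen[of N "\<lambda>_. 0"] by simp
qed

lemma vswap_vdm: "i < N \<Longrightarrow> k < N \<Longrightarrow> i \<noteq> k \<Longrightarrow> vswap i k (vdm N) = - vdm N"
  unfolding vdm_eq_altdet by (rule vswap_altdet)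

lemma trunc_vdm: "N \<le> M \<Longrightarrow> trunc M (vdm N) = vdm N"
proof (induction N)
  case (Suc N)
  then have "trunc M (\<Prod>i<N. mvar i - mvar N) = (\<Prod>i<N. mvar i - mvar N)"
    unfolding trunc_prod by (intro prod.cong) (simp_all add: trunc_diff trunc_mvar)
  then show ?case using Suc by (simp add: trunc_mult)
qed simp

text \<open>Setting x_N to 0 turns each factor x_i - x_N into x_i. The extra monomial accounts for
  the shift of the staircase by one when a variable is dropped.\<close>

lemma trunc_vdm_Suc: "trunc N (vdm (Suc N)) = vdm N * mon (pm N (\<lambda>_. 1))"
proof -
  have "trunc N (\<Prod>i<N. mvar i - mvar N) = (\<Prod>i<N. mvar i)"
    unfolding trunc_prod by (intro prod.cong) (simp_all add: trunc_diff trunc_mvar)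
  also have "\<dots> = mon (pm N (\<lambda>_. 1))"
    unfolding mvar_def pm_def by (rule mon_prod) simp
  finally show ?thesis by (simp add: trunc_mult trunc_vdm)
qed

section \<open>Partitions\<close>

lemma nth_default_pos_iff:
  assumes "is_partition \<nu>"
  shows "0 < nth_default 0 \<nu> i \<longleftrightarrow> i < length \<nu>"
  using assms by (auto simp: is_partition_def nth_default_def) (metis neq0_conv nth_mem)

lemma nth_default_antimono:
  assumes "is_partition \<nu>" "i \<le> k"
  shows "nth_default 0 \<nu> k \<le> nth_default 0 \<nu> i"
  using assms by (auto simp: is_partition_def nth_default_def sorted_wrt_iff_nth_less le_less)

lemma partition_eqI:
  assumes "is_partition \<nu>" "is_partition \<kappa>" and eq: "\<And>i. nth_default 0 \<nu> i = nth_default 0 \<kappa> i"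
  shows "\<nu> = \<kappa>"
proof -
  have "i < length \<nu> \<longleftrightarrow> i < length \<kappa>" for i
    using assms by (metis nth_default_pos_iff)
  then have len: "length \<nu> = length \<kappa>" by (metis less_irrefl linorder_neqE_nat)
  show ?thesis
  proof (rule nth_equalityI[OF len])
    fix i assume "i < length \<nu>"
    then show "\<nu> ! i = \<kappa> ! i" using eq[of i] len by (simp add: nth_default_def)
  qed
qed

lemma partition_exists:
  assumes anti: "\<And>i k. i \<le> k \<Longrightarrow> f k \<le> f i" and 0: "f n = 0"
  obtains \<kappa> where "is_partition \<kappa>" "\<And>i. nth_default 0 \<kappa> i = f i" "length \<kappa> \<le> n"
proof
  define L where "L = (LEAST i. f i = 0)"
  have L: "f L = 0" "L \<le> n" unfolding L_def using 0 by (auto intro: LeastI Least_le)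
  have pos: "f i \<noteq> 0" if "i < L" for i using that not_less_Least unfolding L_def by blast
  show "is_partition (map f [0..<L])"
    using anti by (auto simp: is_partition_def sorted_wrt_iff_nth_less dest: pos)
  show "nth_default 0 (map f [0..<L]) i = f i" for i
    using anti[of L i] L by (simp add: nth_default_def)
  show "length (map f [0..<L]) \<le> n" using L by simp
qed

lemma sum_nth_default:
  "length \<nu> \<le> N \<Longrightarrow> (\<Sum>i<N. nth_default 0 \<nu> i) = sum_list \<nu>"
proof -
  assume "length \<nu> \<le> N"
  then have "(\<Sum>i<N. nth_default 0 \<nu> i) = (\<Sum>i<length \<nu>. nth_default 0 \<nu> i)"
    by (intro sum.mono_neutral_right) (auto simp: nth_default_def)
  also have "\<dots> = sum_list \<nu>" by (simp add: sum_list_sum_nth lessThan_atLeast0 nth_default_def)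
  finally show ?thesis .
qed

definition expo :: "nat \<Rightarrow> nat list \<Rightarrow> nat \<Rightarrow> nat" where
  "expo N \<mu> i = nth_default 0 \<mu> i + (N - 1 - i)"

lemma sum_expo: "length \<mu> \<le> N \<Longrightarrow> (\<Sum>i<N. expo N \<mu> i) = sum_list \<mu> + (\<Sum>i<N. i)"
  unfolding expo_def sum.distrib sum_nth_default
  using sum.nat_diff_reindex[of "\<lambda>i. i" N] by simp

lemma expo_antimono:
  assumes "is_partition \<mu>" "i \<le> k"
  shows "expo N \<mu> k \<le> expo N \<mu> i"
  using nth_default_antimono[OF assms] assms(2) by (simp add: expo_def)

lemma strict_decreasing_gap:
  fixes g :: "nat \<Rightarrow> nat"
  assumes "\<And>i k. i < k \<Longrightarrow> k < N \<Longrightarrow> g k < g i" "i \<le> k" "k < N"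
  shows "g k + (k - i) \<le> g i"
  using assms(2,3)
proof (induction k rule: dec_induct)
  case (step k)
  then have "g (Suc k) < g k" using assms(1)[of k "Suc k"] by simp
  then show ?case using step by simp
qed simp

text \<open>The gap estimate makes every g i at least N - 1 - i, so subtracting the staircase is not
  truncated and leaves a weakly decreasing vector.\<close>

lemma strict_decreasing_expo:
  assumes "\<And>i k. i < k \<Longrightarrow> k < N \<Longrightarrow> g k < g i"
  obtains \<mu> where "is_partition \<mu>" "length \<mu> \<le> N" "\<And>i. i < N \<Longrightarrow> g i = expo N \<mu> i"
proof -
  define m where "m i = (if i < N then g i - (N - 1 - i) else 0)" for i
  have gap: "g k + (k - i) \<le> g i" if "i \<le> k" "k < N" for i k
    by (rule strict_decreasing_gap[where N = N]) (use assms that in auto)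
  have gm: "g i = m i + (N - 1 - i)" if "i < N" for i
  proof -
    have "g (N - 1) + (N - 1 - i) \<le> g i" using that by (intro gap) auto
    then have "N - 1 - i \<le> g i" by linarith
    then show ?thesis using that by (simp only: m_def if_True le_add_diff_inverse2)
  qed
  have anti: "m k \<le> m i" if "i \<le> k" for i k
  proof (cases "k < N")
    case True
    then show ?thesis using gap[OF that True] gm[of i] gm[of k] that by simp
  qed (simp add: m_def)
  have "m N = 0" by (simp add: m_def)
  then obtain \<mu> where "is_partition \<mu>" "\<And>i. nth_default 0 \<mu> i = m i" "length \<mu> \<le> N"
    using partition_exists[of m N, OF anti] by blast
  then show ?thesis using that gm by (simp add: expo_def)
qed

section \<open>Schur functions as quotients of alternants\<close>

lemma cells_eq_cells_below:
  assumes "length \<nu> \<le> N"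
  shows "cells \<nu> = cells_below N (nth_default 0 \<nu>)"
  using assms by (auto simp: cells_def cells_below_def nth_default_def split: if_splits)

lemma lookup_tableau_weight:
  "lookup (tableau_weight \<nu> T) i = (\<Sum>c\<in>cells \<nu>. if T c = i then 1 else 0)"
  by (auto simp: tableau_weight_def lookup_sum lookup_single when_def intro!: sum.cong)

text \<open>Entries in \<open>ssyt\<close> are unbounded, but the weight records every entry: if its
  support lies below N, so do all entries.\<close>

lemma ssyt_eq_tabs:
  assumes len: "length \<nu> \<le> N" and supp: "supp_below N \<alpha>"
  shows "{T \<in> ssyt \<nu>. tableau_weight \<nu> T = \<alpha>} = {T \<in> tabs N (nth_default 0 \<nu>). tableau_weight \<nu> T = \<alpha>}"
proof -
  let ?s = "nth_default 0 \<nu>"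
  have cells: "cells \<nu> = cells_below N ?s" by (rule cells_eq_cells_below) fact
  have s0: "?s i = 0" if "i \<ge> N" for i using that len by (simp add: nth_default_def)
  have row: "(\<forall>i j. (i, Suc j) \<in> cells \<nu> \<longrightarrow> T (i, j) \<le> T (i, Suc j)) \<longleftrightarrow>
      (\<forall>i j. i < N \<longrightarrow> Suc j < ?s i \<longrightarrow> T (i, j) \<le> T (i, Suc j))" for T :: "nat \<times> nat \<Rightarrow> nat"
    unfolding cells cells_below_def by auto
  have col: "(\<forall>i j. (Suc i, j) \<in> cells \<nu> \<longrightarrow> T (i, j) < T (Suc i, j)) \<longleftrightarrow>
      (\<forall>i j. Suc i < N \<longrightarrow> j < ?s (Suc i) \<longrightarrow> T (i, j) < T (Suc i, j))" for T :: "nat \<times> nat \<Rightarrow> nat"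
    unfolding cells cells_below_def by auto
  have below: "T c < N" if "tableau_weight \<nu> T = \<alpha>" "c \<in> cells \<nu>" for T c
  proof (rule ccontr)
    assume "\<not> T c < N"
    then have "lookup \<alpha> (T c) = 0" using supp by (simp add: supp_below_def)
    then have "(\<Sum>a\<in>cells \<nu>. if T a = T c then 1 else 0) = (0::nat)"
      using that(1) lookup_tableau_weight[of \<nu> T "T c"] by metis
    moreover have "finite (cells \<nu>)" by (simp add: cells)
    ultimately have "\<forall>a\<in>cells \<nu>. (if T a = T c then 1 else 0) = (0::nat)"
      by (simp only: sum_eq_0_iff)
    then show False using that(2) by (metis zero_neq_one)
  qed
  have "T \<in> cells \<nu> \<rightarrow>\<^sub>E UNIV \<longleftrightarrow> T \<in> cells \<nu> \<rightarrow>\<^sub>E {..<N}" if "tableau_weight \<nu> T = \<alpha>" for T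
    using below[OF that] by (auto simp: PiE_def Pi_def)
  then show ?thesis unfolding ssyt_def tabs_def row col by (auto simp flip: cells)
qed

lemma mps_coeff_schur:
  "mps_coeff (schur \<nu>) \<alpha> = of_nat (card {T \<in> ssyt \<nu>. tableau_weight \<nu> T = \<alpha>})"
  by (simp add: schur.rep_eq)

lemma trunc_schur:
  assumes len: "length \<nu> \<le> N"
  shows "trunc N (schur \<nu>) = tab_gen N (nth_default 0 \<nu>)"
proof (rule mps_eqI)
  fix \<alpha>
  let ?s = "nth_default 0 \<nu>"
  have cells: "cells \<nu> = cells_below N ?s" by (rule cells_eq_cells_below) fact
  have gen: "tab_gen N ?s = (\<Sum>T\<in>tabs N ?s. mon (tableau_weight \<nu> T))"
    unfolding tab_gen_def tableau_weight_def cells by (simp add: mvar_def mon_prod)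
  show "mps_coeff (trunc N (schur \<nu>)) \<alpha> = mps_coeff (tab_gen N ?s) \<alpha>"
  proof (cases "supp_below N \<alpha>")
    case True
    have "mps_coeff (tab_gen N ?s) \<alpha> = of_nat (card {T \<in> tabs N ?s. tableau_weight \<nu> T = \<alpha>})"
      by (simp add: gen mps_coeff_mon eq_commute[of \<alpha>] sum.If_cases Int_def)
    then show ?thesis using True by (simp add: mps_coeff_trunc mps_coeff_schur ssyt_eq_tabs[OF len True])
  next
    case False
    have "tableau_weight \<nu> T \<noteq> \<alpha>" if "T \<in> tabs N ?s" for T
    proof
      assume eq: "tableau_weight \<nu> T = \<alpha>"
      have "T c < N" if "c \<in> cells \<nu>" for c
        using that \<open>T \<in> tabs N ?s\<close> by (auto simp: tabs_def cells dest: PiE_mem)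
      then have "supp_below N \<alpha>"
        by (fastforce simp: supp_below_def lookup_tableau_weight simp flip: eq intro!: sum.neutral)
      then show False using False by simp
    qed
    then have "mps_coeff (tab_gen N ?s) \<alpha> = 0"
      unfolding gen mps_coeff_sum mps_coeff_mon by (intro sum.neutral ballI) metis
    then show ?thesis using False by (simp add: mps_coeff_trunc)
  qed
qed

lemma vdm_mult_schur:
  assumes "is_partition \<nu>" "length \<nu> \<le> N"
  shows "vdm N * trunc N (schur \<nu>) = altdet mvar N (expo N \<nu>)"
  using vdm_mult_tab_gen[of N "nth_default 0 \<nu>"] assms
  by (simp add: trunc_schur nth_default_antimono expo_def[abs_def])

text \<open>In N variables both the Vandermonde product and its product with the Schur polynomial
  are antisymmetric; cancelling the former leaves symmetry.\<close>

lemma sym_mps_schur: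
  assumes "is_partition \<nu>"
  shows "sym_mps (schur \<nu>)"
  unfolding sym_mps_def
proof (intro allI)
  fix i k
  show "vswap i k (schur \<nu>) = schur \<nu>"
  proof (cases "i = k")
    case True
    show ?thesis
      by (rule mps_eqI) (simp add: True mps_coeff_vswap map_key_id id_def)
  next
    case False
    show ?thesis
    proof (rule mps_eqI_trunc[of "Max {length \<nu>, Suc i, Suc k}"])
      fix N assume "N \<ge> Max {length \<nu>, Suc i, Suc k}"
      then have N: "length \<nu> \<le> N" "i < N" "k < N" by auto
      let ?t = "trunc N (schur \<nu>)"
      have "vdm N * vswap i k ?t = - vswap i k (vdm N * ?t)"
        using N False by (simp add: vswap_mult vswap_vdm)
      also have "\<dots> = vdm N * ?t"
        using N False assms by (simp add: vdm_mult_schur vswap_altdet)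
      finally have "vdm N * (vswap i k ?t - ?t) = 0" by (simp add: right_diff_distrib)
      then have "vswap i k ?t - ?t = 0" by (rule vdm_mult_eq_0)
      then show "trunc N (vswap i k (schur \<nu>)) = ?t" using N by (simp add: trunc_vswap)
    qed
  qed
qed

section \<open>Coefficients of alternants\<close>

definition psi :: "nat \<Rightarrow> rat mps \<Rightarrow> (nat \<Rightarrow> nat) \<Rightarrow> rat" where
  "psi N F g = mps_coeff (vdm N * F) (pm N g)"

lemma psi_cong: "(\<And>i. i < N \<Longrightarrow> g i = h i) \<Longrightarrow> psi N F g = psi N F h"
  unfolding psi_def by (metis pm_cong)

lemma psi_trunc: "psi N (trunc N F) g = psi N F g"
proof -
  have "psi N F g = mps_coeff (trunc N (vdm N * F)) (pm N g)" by (simp add: psi_def mps_coeff_trunc)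
  then show ?thesis by (simp add: psi_def trunc_mult trunc_vdm)
qed

lemma psi_add: "psi N (F + G) g = psi N F g + psi N G g"
  and psi_diff: "psi N (F - G) g = psi N F g - psi N G g"
  and psi_scale: "psi N (mps_scale c F) g = c * psi N F g"
  and psi_0: "psi N 0 g = 0"
  by (simp_all add: psi_def distrib_left right_diff_distrib mps_scale_mult_right)

lemma psi_sum: "psi N (sum F A) g = (\<Sum>x\<in>A. psi N (F x) g)"
  by (induction A rule: infinite_finite_induct) (simp_all add: psi_add psi_0)

lemma psi_transpose:
  assumes "sym_mps F" "i < N" "k < N" "i \<noteq> k"
  shows "psi N F (g \<circ> transpose i k) = - psi N F g"
proof -
  have "psi N F (g \<circ> transpose i k) = mps_coeff (vswap i k (vdm N * F)) (pm N g)"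
    using assms by (simp add: psi_def mps_coeff_vswap pswap_pm)
  also have "vswap i k (vdm N * F) = - (vdm N * F)"
    using assms by (simp add: vswap_mult vswap_vdm sym_mps_def)
  finally show ?thesis by (simp add: psi_def o_def)
qed

lemma psi_eq_0:
  assumes "sym_mps F" "i < N" "k < N" "i \<noteq> k" "g i = g k"
  shows "psi N F g = 0"
proof -
  have "g \<circ> transpose i k = g" using assms(5) by (auto simp: transpose_def fun_eq_iff)
  then show ?thesis using psi_transpose[OF assms(1-4), of g] by simp
qed

text \<open>Sorting: exchanging two entries in increasing order changes only the sign and lowers the
  sum of i * g i, by the rearrangement inequality; two equal entries give 0 at once.\<close>

lemma psi_strict_0:
  assumes sym: "sym_mps F"
    and 0: "\<And>g. (\<And>i k. i < k \<Longrightarrow> k < N \<Longrightarrow> g k < g i) \<Longrightarrow> psi N F g = 0"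
  shows "psi N F g = 0"
proof (induction "\<Sum>i<N. i * g i" arbitrary: g rule: less_induct)
  case less
  show ?case
  proof (cases "\<forall>i k. i < k \<longrightarrow> k < N \<longrightarrow> g k < g i")
    case True
    then show ?thesis by (intro 0) auto
  next
    case False
    then obtain i k where ik: "i < k" "k < N" "g i \<le> g k" by (auto simp: not_less)
    show ?thesis
    proof (cases "g i = g k")
      case True
      then show ?thesis using psi_eq_0[OF sym, of i N k] ik by simp
    next
      case False
      let ?h = "g \<circ> transpose i k"
      obtain d e where de: "k = i + Suc d" "g k = g i + Suc e"
        using ik False by (metis less_imp_Suc_add add_Suc_right le_neq_implies_less)
      let ?R = "{..<N} - {i, k}"
      have split: "(\<Sum>x<N. x * f x) = (\<Sum>x\<in>?R. x * f x) + i * f i + k * f k" for f :: "nat \<Rightarrow> nat"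
      proof -
        have "{..<N} = insert i (insert k ?R)" using ik by auto
        moreover have "i \<notin> insert k ?R" "k \<notin> ?R" "finite ?R" using ik by auto
        ultimately show ?thesis by (metis (no_types, lifting) add.assoc add.commute finite_insert sum.insert)
      qed
      have "(\<Sum>x\<in>?R. x * ?h x) = (\<Sum>x\<in>?R. x * g x)" by (intro sum.cong) auto
      moreover have "i * g k + k * g i < i * g i + k * g k"
        unfolding de(2) by (simp add: de(1) algebra_simps)
      ultimately have "(\<Sum>x<N. x * ?h x) < (\<Sum>x<N. x * g x)"
        unfolding split by simp
      then have "psi N F ?h = 0" by (rule less)
      then show ?thesis using psi_transpose[OF sym, of i N k g] ik by simp
    qed
  qed
qed

text \<open>Strictly decreasing exponents have the form \<mu> + \<delta>, antisymmetry takes care of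
  the others, and the Vandermonde product cancels. Identities of symmetric functions are thus
  checked on partitions only.\<close>

lemma sym_mps_eqI_psi:
  assumes "sym_mps F" "sym_mps G"
    and eq: "\<And>N \<mu>. N \<ge> N0 \<Longrightarrow> is_partition \<mu> \<Longrightarrow> length \<mu> \<le> N \<Longrightarrow>
      psi N F (expo N \<mu>) = psi N G (expo N \<mu>)"
  shows "F = G"
proof (rule mps_eqI_trunc[of N0])
  fix N assume N: "N \<ge> N0"
  have sym: "sym_mps (F - G)" using assms by (simp add: sym_mps_diff)
  have 0: "psi N (F - G) g = 0" for g
  proof (rule psi_strict_0[OF sym])
    fix g :: "nat \<Rightarrow> nat" assume "\<And>i k. i < k \<Longrightarrow> k < N \<Longrightarrow> g k < g i"
    then obtain \<mu> where \<mu>: "is_partition \<mu>" "length \<mu> \<le> N" "\<And>i. i < N \<Longrightarrow> g i = expo N \<mu> i"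
      using strict_decreasing_expo[of N g] by blast
    have "psi N (F - G) g = psi N (F - G) (expo N \<mu>)" using \<mu>(3) by (rule psi_cong)
    then show "psi N (F - G) g = 0" using eq[OF N \<mu>(1,2)] by (simp add: psi_diff)
  qed
  have "vdm N * trunc N (F - G) = 0"
  proof (rule mps_eqI)
    fix \<alpha>
    show "mps_coeff (vdm N * trunc N (F - G)) \<alpha> = mps_coeff 0 \<alpha>"
    proof (cases "supp_below N \<alpha>")
      case True
      then have "mps_coeff (vdm N * trunc N (F - G)) \<alpha> = psi N (trunc N (F - G)) (lookup \<alpha>)"
        by (simp add: psi_def pm_lookup)
      then show ?thesis using 0 by (simp add: psi_trunc)
    next
      case False
      have "vdm N * trunc N (F - G) = trunc N (vdm N * (F - G))" by (simp add: trunc_mult trunc_vdm)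
      then show ?thesis using False by (simp add: mps_coeff_trunc)
    qed
  qed
  then have "trunc N (F - G) = 0" by (rule vdm_mult_eq_0)
  then show "trunc N F = trunc N G" by (simp add: trunc_diff)
qed

text \<open>A weakly decreasing vector is a permutation of the strictly decreasing \<nu> + \<delta>
  only by the identity. Weak decrease is the right generality because lowering some exponents by
  one, as multiplication by e_m does, may create equal entries.\<close>

lemma psi_schur:
  assumes \<nu>: "is_partition \<nu>" "length \<nu> \<le> N"
    and g: "\<And>i k. i \<le> k \<Longrightarrow> k < N \<Longrightarrow> g k \<le> g i"
  shows "psi N (schur \<nu>) g = (if \<forall>i<N. g i = expo N \<nu> i then 1 else 0)"
proof -
  let ?l = "expo N \<nu>"
  have l: "?l k < ?l i" if "i < k" "k < N" for i k
    using nth_default_antimono[OF \<nu>(1), of i k] that by (simp add: expo_def)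
  have "psi N (schur \<nu>) g = mps_coeff (altdet mvar N ?l) (pm N g)"
    by (subst psi_trunc[symmetric]) (simp add: psi_def vdm_mult_schur[OF \<nu>])
  also have "\<dots> = (\<Sum>p | p permutes {0..<N}. of_int (sign p) * (if \<forall>i<N. g i = ?l (p i) then 1 else 0))"
    unfolding altdet_mvar by (simp add: mps_coeff_sign_mult mps_coeff_mon pm_eq_iff)
  also have "\<dots> = (\<Sum>p | p permutes {0..<N}. if p = id then (if \<forall>i<N. g i = ?l i then 1 else 0) else 0)"
  proof (rule sum.cong)
    fix p assume "p \<in> {p. p permutes {0..<N}}"
    then have p: "p permutes {0..<N}" by simp
    \<comment> \<open>Monotonicity of g = l o p and strict decrease of l make p strictly increasing,
      hence i \<le> p i.\<close>
    have "p = id" if eq: "\<forall>i<N. g i = ?l (p i)"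
    proof (rule permutes_natset_ge[OF p], safe)
      have mono: "p i < p k" if "i < k" "k < N" for i k
      proof (rule ccontr)
        assume "\<not> p i < p k"
        moreover have "p i \<noteq> p k" using p that by (metis less_irrefl permutes_inj inj_eq)
        moreover have "p i < N" using p that by (metis permutes_in_image atLeastLessThan_iff le0 less_trans)
        ultimately have "?l (p i) < ?l (p k)" by (intro l) auto
        then show False using eq g[of i k] that by simp
      qed
      fix i assume "i \<in> {0..<N}"
      then have "i < N" by simp
      then show "i \<le> p i"
      proof (induction i)
        case (Suc i)
        then show ?case using mono[of i "Suc i"] by simp
      qed simp
    qed
    then show "of_int (sign p) * (if \<forall>i<N. g i = ?l (p i) then 1 else 0) =
        (if p = id then (if \<forall>i<N. g i = ?l i then 1 else 0 :: rat) else 0)"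
      by auto
  qed simp
  also have "\<dots> = (if \<forall>i<N. g i = ?l i then 1 else 0)"
    by (simp add: sum.delta' finite_permutations permutes_id)
  finally show ?thesis .
qed

lemma psi_schur_expo:
  assumes "is_partition \<nu>" "length \<nu> \<le> N" "is_partition \<mu>" "length \<mu> \<le> N"
  shows "psi N (schur \<nu>) (expo N \<mu>) = (if \<nu> = \<mu> then 1 else 0)"
proof -
  have "\<nu> = \<mu>" if eq: "\<forall>i<N. expo N \<mu> i = expo N \<nu> i"
  proof (rule partition_eqI[OF assms(1,3)])
    fix i
    show "nth_default 0 \<nu> i = nth_default 0 \<mu> i"
      using eq assms(2,4) by (cases "i < N") (auto simp: expo_def nth_default_def)
  qed
  then show ?thesis
    by (subst psi_schur[OF assms(1,2)]) (auto intro: expo_antimono[OF assms(3)])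
qed

text \<open>Exponent 0 at the last variable means that this variable may be set to 0; the
  Vandermonde product then loses a variable and gains x_0 ... x_(N-1).\<close>

lemma psi_Suc_restrict:
  assumes "g N = 0"
  shows "psi (Suc N) F g = (if \<forall>i<N. 1 \<le> g i then psi N F (\<lambda>i. g i - 1) else 0)"
proof -
  have pm: "pm (Suc N) g = pm N g"
    using assms by (intro poly_mapping_eqI) (auto simp: less_Suc_eq)
  have "psi (Suc N) F g = mps_coeff (trunc N (vdm (Suc N) * F)) (pm N g)"
    by (simp add: psi_def pm mps_coeff_trunc)
  also have "\<dots> = mps_coeff (mon (pm N (\<lambda>_. 1)) * (vdm N * trunc N F)) (pm N g)"
    by (simp add: trunc_mult trunc_vdm_Suc mult_ac del: vdm.simps)
  also have "\<dots> = (if \<forall>i<N. 1 \<le> g i then psi N F (\<lambda>i. g i - 1) else 0)"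
  proof -
    have "pm N g - pm N (\<lambda>_. 1) = pm N (\<lambda>i. g i - 1)"
      by (intro poly_mapping_eqI) (simp add: lookup_minus)
    moreover have "(\<forall>i. lookup (pm N (\<lambda>_. 1)) i \<le> lookup (pm N g) i) \<longleftrightarrow> (\<forall>i<N. 1 \<le> g i)"
      by auto
    ultimately show ?thesis
      unfolding mps_coeff_mon_mult by (simp only: psi_trunc flip: psi_def)
  qed
  finally show ?thesis .
qed

section \<open>Multiplication by power sums\<close>

lemma mps_coeff_psum: "mps_coeff (psum k) \<alpha> = (if \<exists>i. \<alpha> = single i k then 1 else 0)"
  by (simp add: psum.rep_eq)

lemma single_eq_iff: "k \<noteq> 0 \<Longrightarrow> single i k = single j k \<longleftrightarrow> i = (j::nat)" for k :: nat
  by (metis lookup_single_eq lookup_single_not_eq)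

lemma trunc_psum:
  assumes "k > 0"
  shows "trunc N (psum k) = (\<Sum>i<N. mon (single i k))"
proof (rule mps_eqI)
  fix \<alpha>
  show "mps_coeff (trunc N (psum k)) \<alpha> = mps_coeff (\<Sum>i<N. mon (single i k)) \<alpha>"
  proof (cases "\<exists>i. \<alpha> = single i k")
    case True
    then obtain i where i: "\<alpha> = single i k" by blast
    then show ?thesis using assms
      by (auto simp: mps_coeff_trunc mps_coeff_psum mps_coeff_mon supp_below_single single_eq_iff)
  next
    case False
    then show ?thesis by (simp add: mps_coeff_trunc mps_coeff_psum mps_coeff_mon)
  qed
qed

lemma sym_mps_psum: "sym_mps (psum k)"
  unfolding sym_mps_def
proof (intro allI, rule mps_eqI)
  fix i j \<alpha>
  have "(\<exists>a. pswap i j \<alpha> = single a k) \<longleftrightarrow> (\<exists>a. \<alpha> = single a k)"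
    by (metis pswap_pswap pswap_single)
  then show "mps_coeff (vswap i j (psum k)) \<alpha> = mps_coeff (psum k) \<alpha>"
    by (simp add: mps_coeff_vswap mps_coeff_psum)
qed

lemma psi_mult_trunc: "psi N (F * G) g = mps_coeff (trunc N G * (vdm N * F)) (pm N g)"
proof -
  have "psi N (F * G) g = mps_coeff (trunc N (G * (vdm N * F))) (pm N g)"
    by (simp add: psi_def mps_coeff_trunc mult_ac)
  also have "\<dots> = mps_coeff (trunc N (trunc N G * (vdm N * F))) (pm N g)"
    by (simp add: trunc_mult trunc_trunc)
  finally show ?thesis by (simp add: mps_coeff_trunc)
qed

lemma psi_mult_psum:
  assumes "k > 0"
  shows "psi N (F * psum k) g = (\<Sum>i<N. if k \<le> g i then psi N F (g(i := g i - k)) else 0)"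
proof -
  have "mps_coeff (mon (single i k) * (vdm N * F)) (pm N g) =
      (if k \<le> g i then psi N F (g(i := g i - k)) else 0)" if "i < N" for i
  proof -
    have "pm N g - single i k = pm N (g(i := g i - k))"
      using that by (intro poly_mapping_eqI) (auto simp: lookup_minus lookup_single when_def)
    moreover have "(\<forall>j. lookup (single i k) j \<le> lookup (pm N g) j) \<longleftrightarrow> k \<le> g i"
      using that by (auto simp: lookup_single when_def)
    ultimately show ?thesis unfolding mps_coeff_mon_mult by (simp add: psi_def)
  qed
  then show ?thesis
    unfolding psi_mult_trunc trunc_psum[OF assms] sum_distrib_right mps_coeff_sum by simp
qed

section \<open>Elementary symmetric functions\<close>

text \<open>The alphabet is arbitrary because two are used: the variables x_i, and the products x_a
  x_b that are the monomials of h_2.\<close>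

definition esym :: "'b set \<Rightarrow> ('b \<Rightarrow> 'a::comm_ring_1) \<Rightarrow> nat \<Rightarrow> 'a" where
  "esym A f m = (\<Sum>S | S \<subseteq> A \<and> card S = m. \<Prod>x\<in>S. f x)"

lemma esym_0: "finite A \<Longrightarrow> esym A f 0 = 1"
proof -
  assume "finite A"
  then have "{S. S \<subseteq> A \<and> card S = 0} = {{}}" by (auto dest: finite_subset)
  then show ?thesis by (simp add: esym_def)
qed

lemma esym_empty: "esym {} f (Suc m) = 0"
  unfolding esym_def by (intro sum.neutral) auto

lemma esym_insert:
  assumes "finite A" "a \<notin> A"
  shows "esym (insert a A) f (Suc m) = esym A f (Suc m) + f a * esym A f m"
proof -
  let ?B = "{S. S \<subseteq> A \<and> card S = m}" and ?C = "{S. S \<subseteq> A \<and> card S = Suc m}"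
  have fin: "finite ?B" "finite ?C" using assms(1) by simp_all
  have eq: "{S. S \<subseteq> insert a A \<and> card S = Suc m} = ?C \<union> insert a ` ?B"
  proof (intro equalityI subsetI)
    fix S assume S: "S \<in> {S. S \<subseteq> insert a A \<and> card S = Suc m}"
    then have S': "S \<subseteq> insert a A" "card S = Suc m" by simp_all
    then have "finite S" using card_ge_0_finite[of S] by simp
    show "S \<in> ?C \<union> insert a ` ?B"
    proof (cases "a \<in> S")
      case True
      have "S = insert a (S - {a})" using True by blast
      moreover have "S - {a} \<in> ?B"
        using S' True \<open>finite S\<close> by (simp add: subset_insert_iff card_Diff_singleton)
      ultimately show ?thesis by blast
    next
      case False
      then show ?thesis using S' by (simp add: subset_insert)
    qed
  next
    fix S assume "S \<in> ?C \<union> insert a ` ?B"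
    then show "S \<in> {S. S \<subseteq> insert a A \<and> card S = Suc m}"
    proof
      assume "S \<in> insert a ` ?B"
      then obtain S' where S': "S = insert a S'" "S' \<subseteq> A" "card S' = m" by blast
      then have "finite S'" "a \<notin> S'" using assms finite_subset by auto
      then show ?thesis using S' by auto
    qed auto
  qed
  have "esym (insert a A) f (Suc m) = (\<Sum>S\<in>?C. \<Prod>x\<in>S. f x) + (\<Sum>S\<in>insert a ` ?B. \<Prod>x\<in>S. f x)"
    unfolding esym_def eq using assms fin by (intro sum.union_disjoint) auto
  also have "(\<Sum>S\<in>insert a ` ?B. \<Prod>x\<in>S. f x) = (\<Sum>S\<in>?B. \<Prod>x\<in>insert a S. f x)"
    using assms by (subst sum.reindex) (auto simp: inj_on_def)
  also have "\<dots> = (\<Sum>S\<in>?B. f a * (\<Prod>x\<in>S. f x))"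
    using assms by (intro sum.cong refl prod.insert) (auto intro: finite_subset)
  finally show ?thesis by (simp add: esym_def sum_distrib_left)
qed

text \<open>Induction on the alphabet. A new letter a changes e_m to e_m + a e_(m-1), and the terms
  with powers of a collapse by an alternating telescoping sum.\<close>

lemma newton_identity:
  assumes "finite A"
  shows "of_nat m * esym A f m = (\<Sum>i<m. (- 1) ^ i * ((\<Sum>x\<in>A. f x ^ Suc i) * esym A f (m - Suc i)))"
  using assms
proof (induction A arbitrary: m rule: finite_induct)
  case empty
  show ?case by (cases m) (simp_all add: esym_empty)
next
  case (insert a A)
  let ?e = "esym A f" and ?p = "\<lambda>i. \<Sum>x\<in>A. f x ^ Suc i"
  define e' where "e' = esym (insert a A) f"
  have e'0: "e' 0 = 1" and e'Suc: "e' (Suc k) = ?e (Suc k) + f a * ?e k" for k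
    using insert by (simp_all add: e'_def esym_0 esym_insert)
  have e0: "?e 0 = 1" using insert by (simp add: esym_0)
  show ?case
  proof (cases m)
    case (Suc n)
    \<comment> \<open>Substituting e'_k = e_k + a e_(k-1) cancels neighbouring terms and leaves only
      a e_k.\<close>
    have tele: "(\<Sum>i<Suc k. (- 1) ^ i * (f a ^ Suc i * e' (k - i))) = f a * ?e k" for k
    proof (induction k)
      case (Suc k)
      have "(\<Sum>i<Suc (Suc k). (- 1) ^ i * (f a ^ Suc i * e' (Suc k - i)))
          = f a * e' (Suc k) - f a * (\<Sum>i<Suc k. (- 1) ^ i * (f a ^ Suc i * e' (k - i)))"
        by (subst sum.lessThan_Suc_shift) (simp add: sum_distrib_left sum_negf mult_ac del: sum.lessThan_Suc)
      then show ?case unfolding Suc.IH by (simp add: e'Suc algebra_simps)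
    qed (simp add: e'0 e0)
    have split: "e' (n - i) = ?e (n - i) + (if i < n then f a * ?e (n - Suc i) else 0)" if "i < Suc n" for i
    proof (cases "i < n")
      case True
      then have "n - i = Suc (n - Suc i)" by simp
      then show ?thesis using True by (metis e'Suc)
    next
      case False
      then show ?thesis using that by (simp add: e'0 e0)
    qed
    have "(\<Sum>i<m. (- 1) ^ i * ((\<Sum>x\<in>insert a A. f x ^ Suc i) * e' (m - Suc i)))
        = (\<Sum>i<Suc n. (- 1) ^ i * (?p i * e' (n - i))) + (\<Sum>i<Suc n. (- 1) ^ i * (f a ^ Suc i * e' (n - i)))"
      using insert Suc by (simp add: sum.distrib[symmetric] algebra_simps del: sum.lessThan_Suc)
    also have "(\<Sum>i<Suc n. (- 1) ^ i * (?p i * e' (n - i)))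
        = (\<Sum>i<Suc n. (- 1) ^ i * (?p i * ?e (n - i))) +
          (\<Sum>i<Suc n. if i < n then f a * ((- 1) ^ i * (?p i * ?e (n - Suc i))) else 0)"
      unfolding sum.distrib[symmetric] using split
      by (intro sum.cong) (auto simp: algebra_simps)
    also have "(\<Sum>i<Suc n. if i < n then f a * ((- 1) ^ i * (?p i * ?e (n - Suc i))) else 0)
        = f a * (\<Sum>i<n. (- 1) ^ i * (?p i * ?e (n - Suc i)))"
      by (simp add: sum_distrib_left)
    also have "\<dots> = f a * (of_nat n * ?e n)"
      by (simp only: insert.IH)
    also have "(\<Sum>i<Suc n. (- 1) ^ i * (?p i * ?e (n - i))) = of_nat (Suc n) * ?e (Suc n)"
      by (simp only: insert.IH diff_Suc_Suc)
    also have "(\<Sum>i<Suc n. (- 1) ^ i * (f a ^ Suc i * e' (n - i))) = f a * ?e n"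
      by (rule tele)
    finally show ?thesis using Suc by (simp add: e'Suc algebra_simps flip: e'_def)
  qed simp
qed

definition elem :: "nat \<Rightarrow> rat mps" where
  "elem m = Abs_mps (\<lambda>\<alpha>. if (\<forall>i. lookup \<alpha> i \<le> 1) \<and> card (keys \<alpha>) = m then 1 else 0)"

lemma prod_mvar_subset:
  assumes "S \<subseteq> {..<N}"
  shows "(\<Prod>x\<in>S. mvar x) = mon (pm N (\<lambda>i. if i \<in> S then 1 else 0))"
proof -
  have S: "finite S" using assms finite_subset by blast
  have "(\<Sum>x\<in>S. single x 1) = pm N (\<lambda>i. if i \<in> S then 1 else 0)"
    using assms S by (intro poly_mapping_eqI) (auto simp: lookup_sum lookup_single when_def)
  then show ?thesis using S by (simp add: mvar_def mon_prod)
qed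

lemma trunc_elem: "trunc N (elem m) = esym {..<N} mvar m"
proof (rule mps_eqI)
  fix \<alpha>
  let ?I = "\<lambda>S. pm N (\<lambda>i. if i \<in> S then 1 else 0 :: nat)" and ?P = "{S. S \<subseteq> {..<N} \<and> card S = m}"
  have "finite ?P" by simp
  have rhs: "mps_coeff (esym {..<N} mvar m) \<alpha> = (\<Sum>S\<in>?P. if \<alpha> = ?I S then 1 else 0)"
    unfolding esym_def mps_coeff_sum
    by (intro sum.cong refl) (simp add: prod_mvar_subset[where N = N] mps_coeff_mon)
  show "mps_coeff (trunc N (elem m)) \<alpha> = mps_coeff (esym {..<N} mvar m) \<alpha>"
  proof (cases "supp_below N \<alpha> \<and> (\<forall>i. lookup \<alpha> i \<le> 1) \<and> card (keys \<alpha>) = m")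
    case True
    let ?K = "keys \<alpha>"
    have K: "?K \<in> ?P" using True by (auto simp: supp_below_def in_keys_iff not_less[symmetric])
    have "\<alpha> = ?I S \<longleftrightarrow> S = ?K" if "S \<in> ?P" for S
    proof
      assume "\<alpha> = ?I S"
      then have "lookup \<alpha> i = (if i \<in> S then 1 else 0)" for i using that by auto
      then show "S = ?K" by (auto simp: in_keys_iff split: if_splits)
    next
      assume S: "S = ?K"
      show "\<alpha> = ?I S"
      proof (rule poly_mapping_eqI)
        fix i
        have "lookup \<alpha> i \<le> 1" using True by blast
        then show "lookup \<alpha> i = lookup (?I S) i"
          using that by (cases "lookup \<alpha> i = 0") (auto simp: S in_keys_iff subset_eq)
      qed
    qed
    then have "(\<Sum>S\<in>?P. if \<alpha> = ?I S then 1 else 0) = (\<Sum>S\<in>?P. if S = ?K then 1 else (0::rat))"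
      by (intro sum.cong) auto
    then show ?thesis using True K rhs \<open>finite ?P\<close> by (simp add: mps_coeff_trunc elem_def)
  next
    case False
    have "\<alpha> \<noteq> ?I S" if "S \<in> ?P" for S
    proof
      assume \<alpha>: "\<alpha> = ?I S"
      then have l: "lookup \<alpha> i = (if i \<in> S then 1 else 0)" for i using that by auto
      then have "keys \<alpha> = S" by (auto simp: in_keys_iff split: if_splits)
      moreover have "\<forall>i. lookup \<alpha> i \<le> 1" using l by simp
      moreover have "supp_below N \<alpha>" by (simp add: \<alpha>)
      ultimately show False using False that by blast
    qed
    then have "(\<Sum>S\<in>?P. if \<alpha> = ?I S then 1 else 0) = (0::rat)" by (intro sum.neutral) auto
    moreover have "mps_coeff (trunc N (elem m)) \<alpha> = 0"
      using False by (auto simp: mps_coeff_trunc elem_def)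
    ultimately show ?thesis using rhs by simp
  qed
qed

lemma of_nat_mult_mps: "of_nat k * f = mps_scale (of_nat k) (f :: rat mps)"
  by (induction k) (simp_all add: distrib_right mps_scale_add_left)

lemma minus_one_power_mult_mps: "(- 1) ^ k * f = mps_scale ((- 1) ^ k) (f :: rat mps)"
  by (cases "even k") (simp_all add: mps_scale_minus_1)

lemma elem_newton:
  "mps_scale (of_nat m) (elem m) = (\<Sum>i<m. mps_scale ((- 1) ^ i) (psum (Suc i) * elem (m - Suc i)))"
proof (rule mps_eqI_trunc[of 0])
  fix N
  have "trunc N (psum (Suc i)) = (\<Sum>x<N. mvar x ^ Suc i)" for i
    by (simp add: trunc_psum mvar_power del: power_Suc)
  then show "trunc N (mps_scale (of_nat m) (elem m)) =
      trunc N (\<Sum>i<m. mps_scale ((- 1) ^ i) (psum (Suc i) * elem (m - Suc i)))"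
    using newton_identity[of "{..<N}" m mvar]
    by (simp add: trunc_scale trunc_elem trunc_sum trunc_mult of_nat_mult_mps minus_one_power_mult_mps
        del: power_Suc)
qed

text \<open>Newton's identity presents m e_m through power sums and earlier e's; rational
  coefficients permit division by m.\<close>

lemma sym_mps_elem: "sym_mps (elem m)"
proof (induction m rule: less_induct)
  case (less m)
  show ?case
  proof (cases "m = 0")
    case True
    have "elem 0 = 1" by (rule mps_eqI_trunc[of 0]) (simp add: trunc_elem esym_0)
    then show ?thesis using True by (simp add: sym_mps_1)
  next
    case False
    then have "elem m = mps_scale (1 / of_nat m) (mps_scale (of_nat m) (elem m))"
      by (simp add: mps_scale_scale)
    also have "sym_mps \<dots>"
      unfolding elem_newton
      by (intro sym_mps_scale sym_mps_sum sym_mps_mult sym_mps_psum less) auto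
    finally show ?thesis .
  qed
qed

lemma psi_mult_elem:
  "psi N (F * elem m) g = (\<Sum>S | S \<subseteq> {..<N} \<and> card S = m.
     if \<forall>i\<in>S. 1 \<le> g i then psi N F (\<lambda>i. g i - (if i \<in> S then 1 else 0)) else 0)"
proof -
  have "mps_coeff ((\<Prod>x\<in>S. mvar x) * (vdm N * F)) (pm N g) =
      (if \<forall>i\<in>S. 1 \<le> g i then psi N F (\<lambda>i. g i - (if i \<in> S then 1 else 0)) else 0)"
    if S: "S \<subseteq> {..<N}" for S
  proof -
    let ?\<beta> = "pm N (\<lambda>i. if i \<in> S then 1 else 0 :: nat)"
    have "pm N g - ?\<beta> = pm N (\<lambda>i. g i - (if i \<in> S then 1 else 0))"
      by (intro poly_mapping_eqI) (simp add: lookup_minus)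
    moreover have "(\<forall>i. lookup ?\<beta> i \<le> lookup (pm N g) i) \<longleftrightarrow> (\<forall>i\<in>S. 1 \<le> g i)"
      using S by auto
    ultimately show ?thesis
      unfolding prod_mvar_subset[OF S] mps_coeff_mon_mult by (simp only: flip: psi_def)
  qed
  then show ?thesis
    unfolding psi_mult_trunc trunc_elem esym_def sum_distrib_right mps_coeff_sum
    by (intro sum.cong) auto
qed

section \<open>A Pieri rule\<close>

text \<open>For \<open>length \<nu> \<le> m\<close>, a new first column of length m is placed before
  the diagram of \<nu>. Appending parts 1 to a partition changes m but not \<nu>, so \<nu> is the
  fixed datum of the growing family.\<close>

definition add_column :: "nat \<Rightarrow> nat list \<Rightarrow> nat list" where
  "add_column m \<nu> = map Suc \<nu> @ replicate (m - length \<nu>) 1"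

lemma length_add_column: "length \<nu> \<le> m \<Longrightarrow> length (add_column m \<nu>) = m"
  by (simp add: add_column_def)

lemma is_partition_add_column: "is_partition \<nu> \<Longrightarrow> is_partition (add_column m \<nu>)"
  by (auto simp: is_partition_def add_column_def sorted_wrt_iff_nth_less nth_append)

lemma nth_default_add_column:
  "length \<nu> \<le> m \<Longrightarrow> nth_default 0 (add_column m \<nu>) i = (if i < m then Suc (nth_default 0 \<nu> i) else 0)"
  by (auto simp: add_column_def nth_default_def nth_append)

text \<open>The partitions \<kappa> for which the skew shape \<nu>/\<kappa> is a vertical strip of
  any size.\<close>

definition vstrip_removals :: "nat list \<Rightarrow> nat list set" where
  "vstrip_removals \<nu> = {\<kappa>. is_partition \<kappa> \<and> length \<kappa> \<le> length \<nu> \<and>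
     (\<forall>i. nth_default 0 \<kappa> i \<le> nth_default 0 \<nu> i \<and> nth_default 0 \<nu> i \<le> Suc (nth_default 0 \<kappa> i))}"

lemma vstrip_removals_sum_le: "\<kappa> \<in> vstrip_removals \<nu> \<Longrightarrow> sum_list \<kappa> \<le> sum_list \<nu>"
  using sum_mono[of "{..<length \<nu>}" "nth_default 0 \<kappa>" "nth_default 0 \<nu>"]
  by (simp add: vstrip_removals_def sum_nth_default)

lemma vstrip_removals_sum_less:
  assumes "is_partition \<nu>" "\<kappa> \<in> vstrip_removals \<nu>" "\<kappa> \<noteq> \<nu>"
  shows "sum_list \<kappa> < sum_list \<nu>"
proof -
  have \<kappa>: "is_partition \<kappa>" "length \<kappa> \<le> length \<nu>" "\<And>i. nth_default 0 \<kappa> i \<le> nth_default 0 \<nu> i"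
    using assms by (auto simp: vstrip_removals_def)
  obtain i where i: "nth_default 0 \<kappa> i \<noteq> nth_default 0 \<nu> i"
    using partition_eqI[OF \<kappa>(1) assms(1)] assms(3) by blast
  then have "i < length \<nu>" using \<kappa>(2) by (auto simp: nth_default_def split: if_splits)
  then have "(\<Sum>i<length \<nu>. nth_default 0 \<kappa> i) < (\<Sum>i<length \<nu>. nth_default 0 \<nu> i)"
    using \<kappa>(3) i by (intro sum_strict_mono_ex1) (auto intro!: bexI[of _ i] simp: le_neq_implies_less)
  then show ?thesis using \<kappa> by (simp add: sum_nth_default)
qed

lemma self_in_vstrip_removals: "is_partition \<nu> \<Longrightarrow> \<nu> \<in> vstrip_removals \<nu>"
  by (simp add: vstrip_removals_def)

lemma finite_partitions: "finite {\<nu>. is_partition \<nu> \<and> sum_list \<nu> \<le> d}"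
proof -
  have len: "length \<nu> \<le> sum_list \<nu>" if "0 \<notin> set \<nu>" for \<nu> :: "nat list"
    using that by (induction \<nu>) (auto simp: Suc_le_eq add_pos_nonneg add_strict_increasing)
  have "{\<nu>. is_partition \<nu> \<and> sum_list \<nu> \<le> d} \<subseteq> {xs. set xs \<subseteq> {..d} \<and> length xs \<le> d}"
  proof
    fix \<nu> assume "\<nu> \<in> {\<nu>. is_partition \<nu> \<and> sum_list \<nu> \<le> d}"
    then have \<nu>: "0 \<notin> set \<nu>" "sum_list \<nu> \<le> d" by (simp_all add: is_partition_def)
    have "x \<le> d" if "x \<in> set \<nu>" for x
      using member_le_sum_list[of x \<nu>] that \<nu>(2) by simp
    moreover have "length \<nu> \<le> d" using len[OF \<nu>(1)] \<nu>(2) by (rule order_trans)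
    ultimately show "\<nu> \<in> {xs. set xs \<subseteq> {..d} \<and> length xs \<le> d}" by auto
  qed
  then show ?thesis by (rule finite_subset) (rule finite_lists_length_le, simp)
qed

lemma finite_vstrip_removals: "finite (vstrip_removals \<nu>)"
  by (rule finite_subset[OF _ finite_partitions[of "sum_list \<nu>"]])
    (use vstrip_removals_sum_le in \<open>auto simp: vstrip_removals_def\<close>)

text \<open>Multiplication by e_m raises m distinct exponents by one. Undoing this on a subset S of
  a strictly decreasing vector leaves a weakly decreasing one, so \<open>psi_schur\<close> evaluates
  each term, and only the set of positions where g exceeds l can contribute.\<close>

lemma psi_schur_mult_elem:
  assumes \<nu>: "is_partition \<nu>" "length \<nu> \<le> N"
    and g: "\<And>i k. i < k \<Longrightarrow> k < N \<Longrightarrow> g k < g i"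
  defines "l \<equiv> expo N \<nu>"
  shows "psi N (schur \<nu> * elem m) g =
    (if (\<forall>i<N. g i = l i \<or> g i = Suc (l i)) \<and> card {i. i < N \<and> g i = Suc (l i)} = m then 1 else 0)"
proof -
  let ?P = "{S. S \<subseteq> {..<N} \<and> card S = m}" and ?K = "{i. i < N \<and> g i = Suc (l i)}"
  have "finite ?P" by simp
  have summand: "(if \<forall>i\<in>S. 1 \<le> g i then psi N (schur \<nu>) (\<lambda>i. g i - (if i \<in> S then 1 else 0)) else 0)
      = (if S = ?K \<and> (\<forall>i<N. g i = l i \<or> g i = Suc (l i)) then 1 else 0)" if S: "S \<in> ?P" for S
  proof -
    have "psi N (schur \<nu>) (\<lambda>i. g i - (if i \<in> S then 1 else 0)) =
        (if \<forall>i<N. g i - (if i \<in> S then 1 else 0) = l i then 1 else 0)"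
      unfolding l_def
    proof (rule psi_schur[OF \<nu>])
      fix i k assume "i \<le> k" "k < N"
      then show "g k - (if k \<in> S then 1 else 0) \<le> g i - (if i \<in> S then 1 else 0)"
        using g[of i k] by (cases "i = k") auto
    qed
    moreover have "(\<forall>i\<in>S. 1 \<le> g i) \<and> (\<forall>i<N. g i - (if i \<in> S then 1 else 0) = l i) \<longleftrightarrow>
        S = ?K \<and> (\<forall>i<N. g i = l i \<or> g i = Suc (l i))" (is "?L \<longleftrightarrow> ?R")
    proof
      assume L: ?L
      have *: "g i = (if i \<in> S then Suc (l i) else l i)" if "i < N" for i
      proof (cases "i \<in> S")
        case True
        then have "1 \<le> g i" "g i - 1 = l i" using L that by auto
        then show ?thesis using True by simp
      next
        case False
        then show ?thesis using L that by auto
      qed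
      then have "S = ?K" using S by (auto split: if_splits)
      moreover have "\<forall>i<N. g i = l i \<or> g i = Suc (l i)" using * by simp
      ultimately show ?R by blast
    next
      assume R: ?R
      then show ?L by auto
    qed
    ultimately show ?thesis by (smt (verit))
  qed
  have "psi N (schur \<nu> * elem m) g =
      (\<Sum>S\<in>?P. if S = ?K \<and> (\<forall>i<N. g i = l i \<or> g i = Suc (l i)) then 1 else 0)"
    unfolding psi_mult_elem by (rule sum.cong[OF refl summand])
  also have "\<dots> = (\<Sum>S\<in>?P. if S = ?K then (if \<forall>i<N. g i = l i \<or> g i = Suc (l i) then 1 else 0) else 0)"
    by (intro sum.cong) auto
  also have "\<dots> = (if (\<forall>i<N. g i = l i \<or> g i = Suc (l i)) \<and> card ?K = m then 1 else 0)"
    using \<open>finite ?P\<close> by auto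
  finally show ?thesis .
qed

lemma sum_Suc_steps:
  fixes l :: "nat \<Rightarrow> nat"
  assumes "\<And>i. i < N \<Longrightarrow> g i = l i \<or> g i = Suc (l i)"
  shows "(\<Sum>i<N. g i) = (\<Sum>i<N. l i) + card {i. i < N \<and> g i = Suc (l i)}"
proof -
  have "(\<Sum>i<N. g i) = (\<Sum>i<N. l i + (if g i = Suc (l i) then 1 else 0))"
    using assms by (intro sum.cong) auto
  also have "\<dots> = (\<Sum>i<N. l i) + card {i \<in> {..<N}. g i = Suc (l i)}"
    by (simp only: sum.distrib card_eq_sum sum.inter_filter finite_lessThan)
  finally show ?thesis by simp
qed

lemma sum_list_add_column: "length \<nu> \<le> m \<Longrightarrow> sum_list (add_column m \<nu>) = sum_list \<nu> + m"
proof -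
  have "sum_list (map Suc \<nu>) = sum_list \<nu> + length \<nu>" by (induction \<nu>) auto
  then show "length \<nu> \<le> m \<Longrightarrow> ?thesis" by (simp add: add_column_def sum_list_replicate)
qed

lemma partition_remove_column:
  assumes "is_partition \<mu>"
  obtains \<nu> where "is_partition \<nu>" "length \<nu> \<le> length \<mu>" "\<mu> = add_column (length \<mu>) \<nu>"
    "\<And>i. nth_default 0 \<nu> i = nth_default 0 \<mu> i - 1"
proof -
  obtain \<nu> where \<nu>: "is_partition \<nu>" "\<And>i. nth_default 0 \<nu> i = nth_default 0 \<mu> i - 1" "length \<nu> \<le> length \<mu>"
    using partition_exists[of "\<lambda>i. nth_default 0 \<mu> i - 1" "length \<mu>"] nth_default_antimono[OF assms]
    by (metis diff_is_0_eq' diff_le_mono le0 nth_default_beyond order_refl)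
  have "\<mu> = add_column (length \<mu>) \<nu>"
  proof (rule partition_eqI[OF assms is_partition_add_column[OF \<nu>(1)]])
    fix i
    show "nth_default 0 \<mu> i = nth_default 0 (add_column (length \<mu>) \<nu>) i"
      using nth_default_pos_iff[OF assms, of i] \<nu>(2)[of i] by (auto simp: nth_default_add_column[OF \<nu>(3)])
  qed
  then show ?thesis using that \<nu> by blast
qed

text \<open>The Pieri rule, indexed by what remains after deleting the first column: if a vertical
  strip of size m is added to \<nu>, the rest \<kappa> differs from \<nu> by a vertical strip. Since
  \<open>length \<nu> \<le> m\<close>, every such \<kappa> occurs, so the index set is finite and
  independent of m.\<close>

lemma schur_mult_elem:
  assumes \<nu>: "is_partition \<nu>" "length \<nu> \<le> m"
  shows "schur \<nu> * elem m =
    (\<Sum>\<kappa>\<in>vstrip_removals \<nu>. schur (add_column (m + sum_list \<nu> - sum_list \<kappa>) \<kappa>))" (is "_ = ?R")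
\<comment> \<open>With this many variables no column on the right-hand side is longer than
  N.\<close>
proof (rule sym_mps_eqI_psi[of _ _ "m + sum_list \<nu>"])
  show "sym_mps (schur \<nu> * elem m)"
    using sym_mps_elem sym_mps_schur[OF \<nu>(1)] by (rule sym_mps_mult[rotated])
  show "sym_mps ?R"
    by (intro sym_mps_sum sym_mps_schur is_partition_add_column) (simp add: vstrip_removals_def)
next
  fix N \<mu> assume N: "m + sum_list \<nu> \<le> N" and \<mu>: "is_partition \<mu>" "length \<mu> \<le> N"
  let ?n = "nth_default (0::nat)" and ?M = "\<lambda>\<kappa>. m + sum_list \<nu> - sum_list \<kappa>"
  define C where "C \<longleftrightarrow> (\<forall>i. ?n \<mu> i = ?n \<nu> i \<or> ?n \<mu> i = Suc (?n \<nu> i)) \<and> sum_list \<mu> = sum_list \<nu> + m"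
  have \<nu>N: "length \<nu> \<le> N" using \<nu> N by simp
  have lhs: "psi N (schur \<nu> * elem m) (expo N \<mu>) = (if C then 1 else 0)"
  proof -
    let ?S = "\<forall>i<N. expo N \<mu> i = expo N \<nu> i \<or> expo N \<mu> i = Suc (expo N \<nu> i)"
      and ?K = "{i. i < N \<and> expo N \<mu> i = Suc (expo N \<nu> i)}"
    have "psi N (schur \<nu> * elem m) (expo N \<mu>) = (if ?S \<and> card ?K = m then 1 else 0)"
    proof (rule psi_schur_mult_elem[OF \<nu>(1) \<nu>N])
      fix i k assume "i < k" "k < N"
      then show "expo N \<mu> k < expo N \<mu> i"
        using nth_default_antimono[OF \<mu>(1), of i k] by (simp add: expo_def)
    qed
    moreover have "?S \<longleftrightarrow> (\<forall>i. ?n \<mu> i = ?n \<nu> i \<or> ?n \<mu> i = Suc (?n \<nu> i))"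
      using \<mu>(2) \<nu>N by (auto simp: expo_def nth_default_def)
    moreover have "card ?K = m \<longleftrightarrow> sum_list \<mu> = sum_list \<nu> + m" if ?S
      using sum_Suc_steps[of N "expo N \<mu>" "expo N \<nu>"] that \<mu>(2) \<nu>N by (auto simp: sum_expo)
    ultimately show ?thesis by (auto simp: C_def)
  qed
  obtain \<mu>' where \<mu>': "is_partition \<mu>'" "length \<mu>' \<le> length \<mu>" "\<mu> = add_column (length \<mu>) \<mu>'"
    "\<And>i. ?n \<mu>' i = ?n \<mu> i - 1" using partition_remove_column[OF \<mu>(1)] by blast
  have V: "\<mu>' \<in> vstrip_removals \<nu>" if C
  proof -
    have "?n \<mu> i = ?n \<nu> i \<or> ?n \<mu> i = Suc (?n \<nu> i)" for i using that by (simp add: C_def)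
    then have n: "?n \<mu>' i \<le> ?n \<nu> i \<and> ?n \<nu> i \<le> Suc (?n \<mu>' i)" for i
      using \<mu>'(4)[of i] by (metis diff_Suc_1 diff_le_self le_SucI order_refl Suc_pred' neq0_conv le0)
    have "\<not> length \<nu> < length \<mu>'"
      using n[of "length \<nu>"] nth_default_pos_iff[OF \<mu>'(1), of "length \<nu>"] by (simp add: nth_default_def)
    then show ?thesis using n \<mu>'(1) by (simp add: vstrip_removals_def)
  qed
  \<comment> \<open>Comparing sizes forces the length of the first column of \<mu>; this is the
    origin of m + |\<nu>| - |\<kappa>|.\<close>
  have key: "add_column (?M \<kappa>) \<kappa> = \<mu> \<longleftrightarrow> C \<and> \<kappa> = \<mu>'" if \<kappa>: "\<kappa> \<in> vstrip_removals \<nu>" for \<kappa>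
  proof -
    have k: "is_partition \<kappa>" "length \<kappa> \<le> length \<nu>" "?n \<kappa> i \<le> ?n \<nu> i" "?n \<nu> i \<le> Suc (?n \<kappa> i)"
      and M: "m \<le> ?M \<kappa>" "length \<kappa> \<le> ?M \<kappa>" "sum_list \<kappa> + ?M \<kappa> = sum_list \<nu> + m" for i
      using \<kappa> vstrip_removals_sum_le[OF \<kappa>] \<nu>(2) by (auto simp: vstrip_removals_def)
    show ?thesis
    proof
      assume eq: "add_column (?M \<kappa>) \<kappa> = \<mu>"
      have n: "?n \<mu> i = (if i < ?M \<kappa> then Suc (?n \<kappa> i) else 0)" for i
        unfolding eq[symmetric] by (rule nth_default_add_column[OF M(2)])
      have z: "?n \<nu> i = 0 \<and> ?n \<kappa> i = 0" if "\<not> i < ?M \<kappa>" for i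
        using that M(1) k(2) \<nu>(2) by (simp add: nth_default_def)
      have "?n \<mu> i = ?n \<nu> i \<or> ?n \<mu> i = Suc (?n \<nu> i)" for i
        using n[of i] z[of i] k(3,4)[of i] by (cases "i < ?M \<kappa>") auto
      moreover have "sum_list \<mu> = sum_list \<nu> + m"
        using sum_list_add_column[OF M(2)] M(3) by (simp only: eq)
      moreover have "\<kappa> = \<mu>'"
        by (rule partition_eqI[OF k(1) \<mu>'(1)]) (use n z \<mu>'(4) in \<open>metis diff_0_eq_0 diff_Suc_1\<close>)
      ultimately show "C \<and> \<kappa> = \<mu>'" by (simp add: C_def)
    next
      assume "C \<and> \<kappa> = \<mu>'"
      then have "length \<mu> = ?M \<kappa>"
        using sum_list_add_column[OF \<mu>'(2)] M(3) by (simp add: C_def flip: \<mu>'(3))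
      then show "add_column (?M \<kappa>) \<kappa> = \<mu>" using \<mu>'(3) \<open>C \<and> \<kappa> = \<mu>'\<close> by simp
    qed
  qed
  have "psi N ?R (expo N \<mu>) = (\<Sum>\<kappa>\<in>vstrip_removals \<nu>. if \<kappa> = \<mu>' then if C then 1 else 0 else 0)"
    unfolding psi_sum
  proof (rule sum.cong[OF refl])
    fix \<kappa> assume \<kappa>: "\<kappa> \<in> vstrip_removals \<nu>"
    then have "length \<kappa> \<le> ?M \<kappa>" "?M \<kappa> \<le> N"
      using vstrip_removals_sum_le[OF \<kappa>] \<nu>(2) N by (auto simp: vstrip_removals_def)
    then have "psi N (schur (add_column (?M \<kappa>) \<kappa>)) (expo N \<mu>) = (if add_column (?M \<kappa>) \<kappa> = \<mu> then 1 else 0)"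
      using \<kappa> \<mu> by (intro psi_schur_expo) (auto simp: is_partition_add_column length_add_column vstrip_removals_def)
    then show "psi N (schur (add_column (?M \<kappa>) \<kappa>)) (expo N \<mu>) = (if \<kappa> = \<mu>' then if C then 1 else 0 else 0)"
      unfolding key[OF \<kappa>] by simp
  qed
  then show "psi N (schur \<nu> * elem m) (expo N \<mu>) = psi N ?R (expo N \<mu>)"
    using lhs V by (simp add: finite_vstrip_removals)
qed

section \<open>Coordinates in a basis\<close>

definition lincomb :: "(nat list \<Rightarrow> rat mps) \<Rightarrow> (nat list \<Rightarrow>\<^sub>0 rat) \<Rightarrow> rat mps" where
  "lincomb b c = (\<Sum>\<rho>\<in>keys c. mps_scale (lookup c \<rho>) (b \<rho>))"

lemma lincomb_superset:
  assumes "finite S" "keys c \<subseteq> S"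
  shows "lincomb b c = (\<Sum>\<rho>\<in>S. mps_scale (lookup c \<rho>) (b \<rho>))"
  unfolding lincomb_def using assms by (intro sum.mono_neutral_left) (auto simp: in_keys_iff)

lemma lincomb_0 [simp]: "lincomb b 0 = 0"
  by (simp add: lincomb_def)

lemma lincomb_add: "lincomb b (c + d) = lincomb b c + lincomb b d"
proof -
  let ?S = "keys c \<union> keys d"
  have "keys (c + d) \<subseteq> ?S" by (rule keys_add)
  then show ?thesis
    by (simp add: lincomb_superset[of ?S] lookup_add mps_scale_add_left sum.distrib)
qed

lemma lincomb_diff: "lincomb b (c - d) = lincomb b c - lincomb b d"
  using lincomb_add[of b "c - d" d] by simp

lemma lincomb_sum: "lincomb b (sum f A) = (\<Sum>x\<in>A. lincomb b (f x))"
  by (induction A rule: infinite_finite_induct) (simp_all add: lincomb_add)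

lemma lincomb_single: "lincomb b (single \<rho> r) = mps_scale r (b \<rho>)"
  by (cases "r = 0") (simp_all add: lincomb_def)

lemma keys_sum_subset:
  "(\<And>x. x \<in> A \<Longrightarrow> keys (f x) \<subseteq> X) \<Longrightarrow> keys (sum f A) \<subseteq> X"
proof (induction A rule: infinite_finite_induct)
  case (insert x A)
  have "keys (f x + sum f A) \<subseteq> keys (f x) \<union> keys (sum f A)"
    by (rule keys_add)
  also have "\<dots> \<subseteq> X" using insert by (intro Un_least) auto
  finally show ?case using insert by simp
qed simp_all

abbreviation partition_supp :: "(nat list \<Rightarrow>\<^sub>0 rat) \<Rightarrow> bool" where
  "partition_supp c \<equiv> keys c \<subseteq> Collect is_partition"

text \<open>Independence makes the definite description in \<open>basis_coeffs\<close> well defined;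
  coordinates are computed only through this lemma.\<close>

lemma basis_coeffs_lincomb:
  assumes "partition_supp c"
    and indep: "\<And>c d. partition_supp c \<Longrightarrow> partition_supp d \<Longrightarrow> lincomb b c = lincomb b d \<Longrightarrow> c = d"
  shows "basis_coeffs b (lincomb b c) = c"
  unfolding basis_coeffs_def lincomb_def[symmetric]
  using assms by (intro the_equality) auto

lemma prod_list_part_union: "prod_list (map h (part_union \<rho> \<sigma>)) = prod_list (map h \<rho>) * prod_list (map h \<sigma>)"
  for h :: "nat \<Rightarrow> 'a::comm_monoid_mult"
proof -
  have "prod_list (map h xs) = prod_mset (image_mset h (mset xs))" for xs
    by (metis mset_map prod_mset_prod_list)
  then show ?thesis by (simp add: part_union_def)
qed

subsection \<open>Linear independence of the power sum products\<close>

lemma psum_part_simps [simp]: "psum_part [] = 1" "psum_part (k # \<sigma>) = psum k * psum_part \<sigma>"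
  by (simp_all add: psum_part_def)

lemma keys_add_nat: "keys (\<alpha> + \<beta>) = keys \<alpha> \<union> keys (\<beta> :: 'a \<Rightarrow>\<^sub>0 nat)"
  by (auto simp: in_keys_iff lookup_add)

lemma mps_coeff_mult_nonzero:
  assumes "mps_coeff (f * g) \<alpha> \<noteq> 0"
  shows "\<exists>\<beta> \<gamma>. \<alpha> = \<beta> + \<gamma> \<and> mps_coeff f \<beta> \<noteq> 0 \<and> mps_coeff g \<gamma> \<noteq> 0"
proof (rule ccontr)
  assume *: "\<not> ?thesis"
  have "mps_coeff f \<beta> * mps_coeff g \<gamma> = 0" if "\<beta> + \<gamma> = \<alpha>" for \<beta> \<gamma>
  proof -
    have "mps_coeff f \<beta> = 0 \<or> mps_coeff g \<gamma> = 0" using * that[symmetric] by blast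
    then show ?thesis by auto
  qed
  then have "mps_coeff (f * g) \<alpha> = 0"
    unfolding mps_coeff_mult by (intro sum.neutral) auto
  then show False using assms by simp
qed

text \<open>Each factor of a power sum product contributes a power of one variable. Coinciding
  choices lose a variable, so the maximal number of variables occurs only with exponents equal to
  the parts.\<close>

lemma psum_part_coeff_nonzero:
  assumes "0 \<notin> set \<sigma>" "mps_coeff (psum_part \<sigma>) \<alpha> \<noteq> 0"
  shows "card (keys \<alpha>) \<le> length \<sigma> \<and>
    (card (keys \<alpha>) = length \<sigma> \<longrightarrow>
      image_mset (lookup \<alpha>) (mset_set (keys \<alpha>)) = mset \<sigma>)"
  using assms
proof (induction \<sigma> arbitrary: \<alpha>)
  case Nil
  then show ?case by (simp split: if_splits)
next
  case (Cons k \<sigma>)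
  then have k: "k > 0" by simp
  have "\<exists>\<beta> \<gamma>. \<alpha> = \<beta> + \<gamma> \<and> mps_coeff (psum k) \<beta> \<noteq> 0 \<and> mps_coeff (psum_part \<sigma>) \<gamma> \<noteq> 0"
    using Cons.prems(2) unfolding psum_part_simps by (rule mps_coeff_mult_nonzero)
  then obtain i \<gamma> where \<gamma>: "\<alpha> = single i k + \<gamma>" "mps_coeff (psum_part \<sigma>) \<gamma> \<noteq> 0"
    by (auto simp: mps_coeff_psum split: if_splits)
  have IH: "card (keys \<gamma>) \<le> length \<sigma>"
    "card (keys \<gamma>) = length \<sigma> \<Longrightarrow>
      image_mset (lookup \<gamma>) (mset_set (keys \<gamma>)) = mset \<sigma>"
    using Cons.IH[OF _ \<gamma>(2)] Cons.prems by auto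
  have keys: "keys \<alpha> = insert i (keys \<gamma>)"
    using k by (simp add: \<gamma>(1) keys_add_nat)
  show ?case
  proof (intro conjI impI)
    show "card (keys \<alpha>) \<le> length (k # \<sigma>)"
      using IH(1) by (simp add: keys card_insert_if)
    assume card: "card (keys \<alpha>) = length (k # \<sigma>)"
    then have i: "i \<notin> keys \<gamma>" and "card (keys \<gamma>) = length \<sigma>"
      using IH(1) by (auto simp: keys card_insert_if split: if_splits)
    moreover have "lookup \<alpha> i = k"
      using i by (simp add: \<gamma>(1) lookup_add in_keys_iff)
    moreover have "image_mset (lookup \<alpha>) (mset_set (keys \<gamma>)) =
        image_mset (lookup \<gamma>) (mset_set (keys \<gamma>))"
      using i by (intro image_mset_cong) (auto simp: \<gamma>(1) lookup_add lookup_single when_def)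
    ultimately show "image_mset (lookup \<alpha>) (mset_set (keys \<alpha>)) = mset (k # \<sigma>)"
      using IH(2) by (simp add: keys)
  qed
qed

lemma psum_part_coeff_nonneg: "0 \<le> mps_coeff (psum_part \<sigma>) \<alpha>"
proof (induction \<sigma> arbitrary: \<alpha>)
  case (Cons k \<sigma>)
  then show ?case by (auto simp: mps_coeff_mult mps_coeff_psum intro!: sum_nonneg)
qed simp

text \<open>The monomial with the parts as exponents of consecutive variables from x_s on, a witness
  attaining the maximal number of variables.\<close>

fun stair :: "nat \<Rightarrow> nat list \<Rightarrow> (nat \<Rightarrow>\<^sub>0 nat)" where
  "stair s [] = 0"
| "stair s (k # \<sigma>) = single s k + stair (Suc s) \<sigma>"

lemma psum_part_coeff_stair: "0 < mps_coeff (psum_part \<sigma>) (stair s \<sigma>)"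
proof (induction \<sigma> arbitrary: s)
  case (Cons k \<sigma>)
  let ?A = "{(\<beta>, \<gamma>). \<beta> + \<gamma> = stair s (k # \<sigma>)}"
  show ?case unfolding psum_part_simps mps_coeff_mult
  proof (rule sum_pos2[of ?A "(single s k, stair (Suc s) \<sigma>)"])
    show "0 < (case (single s k, stair (Suc s) \<sigma>) of
        (\<beta>, \<gamma>) \<Rightarrow> mps_coeff (psum k) \<beta> * mps_coeff (psum_part \<sigma>) \<gamma>)"
      using Cons.IH by (auto simp: mps_coeff_psum)
    show "0 \<le> (case p of (\<beta>, \<gamma>) \<Rightarrow> mps_coeff (psum k) \<beta> * mps_coeff (psum_part \<sigma>) \<gamma>)" for p
      by (auto simp: mps_coeff_psum psum_part_coeff_nonneg split: prod.split)
  qed (auto simp: finite_antidiagonal)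
qed simp

lemma keys_stair: "0 \<notin> set \<sigma> \<Longrightarrow> keys (stair s \<sigma>) = {s..<s + length \<sigma>}"
  by (induction \<sigma> arbitrary: s) (auto simp: keys_add_nat)

lemma partition_eq_if_mset_eq:
  assumes "is_partition \<rho>" "is_partition \<sigma>" "mset \<rho> = mset \<sigma>"
  shows "\<rho> = \<sigma>"
proof -
  have "sorted (rev \<rho>)" "sorted (rev \<sigma>)"
    using assms by (simp_all add: is_partition_def sorted_wrt_rev)
  then have "rev \<rho> = rev \<sigma>" using assms(3)
    by (metis mset_rev properties_for_sort)
  then show ?thesis by simp
qed

text \<open>Take a longest \<rho> in a relation. The monomial with exponents \<rho> occurs in
  p_\<rho>, while any other p_\<sigma> containing it would be strictly longer.\<close>

lemma psum_part_independent:
  assumes "partition_supp c" "partition_supp d" "lincomb psum_part c = lincomb psum_part d"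
  shows "c = d"
proof (rule ccontr)
  assume "c \<noteq> d"
  define e where "e = c - d"
  have "keys e \<subseteq> keys c \<union> keys d"
    by (auto simp: e_def in_keys_iff lookup_minus)
  then have e: "partition_supp e" using assms by blast
  have e0: "lincomb psum_part e = 0" using assms(3) by (simp add: e_def lincomb_diff)
  have "keys e \<noteq> {}"
  proof
    assume "keys e = {}"
    then have "lookup e x = 0" for x by (metis empty_iff in_keys_iff)
    then have "c = d" by (intro poly_mapping_eqI) (simp add: e_def lookup_minus)
    then show False using \<open>c \<noteq> d\<close> by simp
  qed
  then have "Max (length ` keys e) \<in> length ` keys e"
    by (intro Max_in) auto
  then obtain \<rho> where \<rho>: "\<rho> \<in> keys e" "length \<rho> = Max (length ` keys e)" by auto
  have max: "length \<sigma> \<le> length \<rho>" if "\<sigma> \<in> keys e" for \<sigma>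
    using that unfolding \<rho>(2) by (intro Max_ge) auto
  have part: "is_partition \<sigma>" "0 \<notin> set \<sigma>" if "\<sigma> \<in> keys e" for \<sigma>
    using that e by (auto simp: is_partition_def)
  let ?\<alpha> = "stair 0 \<rho>"
  have card: "card (keys ?\<alpha>) = length \<rho>"
    using part[OF \<rho>(1)] by (simp add: keys_stair)
  have vals: "image_mset (lookup ?\<alpha>) (mset_set (keys ?\<alpha>)) = mset \<rho>"
    using psum_part_coeff_nonzero[OF part(2)[OF \<rho>(1)]] psum_part_coeff_stair[of \<rho> 0] card by force
  have "mps_coeff (psum_part \<sigma>) ?\<alpha> = 0" if \<sigma>: "\<sigma> \<in> keys e" "\<sigma> \<noteq> \<rho>" for \<sigma>
  proof (rule ccontr)
    assume "mps_coeff (psum_part \<sigma>) ?\<alpha> \<noteq> 0"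
    then have "length \<rho> \<le> length \<sigma>" "length \<rho> = length \<sigma> \<Longrightarrow> mset \<rho> = mset \<sigma>"
      using psum_part_coeff_nonzero[OF part(2)[OF \<sigma>(1)]] card vals by metis+
    then have "mset \<rho> = mset \<sigma>" using max[OF \<sigma>(1)] by simp
    then show False using partition_eq_if_mset_eq part \<rho>(1) \<sigma> by blast
  qed
  then have "mps_coeff (lincomb psum_part e) ?\<alpha> =
      (\<Sum>\<sigma>\<in>keys e. if \<sigma> = \<rho> then lookup e \<rho> * mps_coeff (psum_part \<rho>) ?\<alpha> else 0)"
    unfolding lincomb_def mps_coeff_sum by (intro sum.cong) auto
  also have "\<dots> = lookup e \<rho> * mps_coeff (psum_part \<rho>) ?\<alpha>"
    using \<rho>(1) by simp
  finally have "lookup e \<rho> * mps_coeff (psum_part \<rho>) ?\<alpha> = 0" by (simp add: e0)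
  then show False using \<rho>(1) psum_part_coeff_stair[of \<rho> 0] by (simp add: in_keys_iff)
qed

subsection \<open>Plethysm as a ring homomorphism\<close>

abbreviation pleth_part :: "rat mps \<Rightarrow> nat list \<Rightarrow> rat mps" where
  "pleth_part g \<equiv> \<lambda>\<rho>. prod_list (map (\<lambda>n. psum_plethysm n g) \<rho>)"

text \<open>The graph of the substitution homomorphism, generated by the ring operations. One
  derivation shows both that f is a polynomial in the power sums, without which
  \<open>plethysm\<close> has no meaning, and what its plethysm is.\<close>

inductive pleth_rel :: "rat mps \<Rightarrow> rat mps \<Rightarrow> rat mps \<Rightarrow> bool" for g where
  one: "pleth_rel g 1 1"
| psum: "k > 0 \<Longrightarrow> pleth_rel g (psum k) (psum_plethysm k g)"
| add: "pleth_rel g f F \<Longrightarrow> pleth_rel g f' F' \<Longrightarrow> pleth_rel g (f + f') (F + F')"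
| mult: "pleth_rel g f F \<Longrightarrow> pleth_rel g f' F' \<Longrightarrow> pleth_rel g (f * f') (F * F')"
| scale: "pleth_rel g f F \<Longrightarrow> pleth_rel g (mps_scale r f) (mps_scale r F)"

lemma lincomb_mult:
  assumes b: "\<And>\<rho> \<sigma>. b (part_union \<rho> \<sigma>) = b \<rho> * b \<sigma>"
  shows "lincomb b (\<Sum>\<rho>\<in>keys c. \<Sum>\<sigma>\<in>keys d.
      single (part_union \<rho> \<sigma>) (lookup c \<rho> * lookup d \<sigma>))
    = lincomb b c * lincomb b d"
  by (simp add: lincomb_sum lincomb_single b)
    (simp add: lincomb_def sum_product mps_scale_mult_left mps_scale_mult_right mps_scale_scale mult.commute)

lemma lincomb_scale:
  "lincomb b (\<Sum>\<rho>\<in>keys c. single \<rho> (r * lookup c \<rho>))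
    = mps_scale r (lincomb b c)"
  by (simp add: lincomb_sum lincomb_single) (simp add: lincomb_def mps_scale_sum mps_scale_scale)

text \<open>A common coordinate vector for f and its image follows the derivation; products of power
  sum products correspond to unions of their index partitions.\<close>

lemma pleth_rel_lincomb:
  assumes "pleth_rel g f F"
  shows "\<exists>c. partition_supp c \<and> f = lincomb psum_part c \<and>
    F = lincomb (pleth_part g) c"
  using assms
proof induction
  case one
  show ?case
    by (rule exI[of _ "single [] 1"]) (simp add: lincomb_single is_partition_def)
next
  case (psum k)
  then show ?case
    by (intro exI[of _ "single [k] 1"]) (simp add: lincomb_single is_partition_def)
next
  case (add f F f' F')
  then obtain c c' where "partition_supp c" "partition_supp c'"
    "f = lincomb psum_part c" "F = lincomb (pleth_part g) c"
    "f' = lincomb psum_part c'" "F' = lincomb (pleth_part g) c'"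
    by blast
  then show ?case using keys_add[of c c'] by (intro exI[of _ "c + c'"]) (auto simp: lincomb_add)
next
  case (mult f F f' F')
  then obtain c c' where c: "partition_supp c" "partition_supp c'"
    "f = lincomb psum_part c" "F = lincomb (pleth_part g) c"
    "f' = lincomb psum_part c'" "F' = lincomb (pleth_part g) c'"
    by blast
  define d where "d = (\<Sum>\<rho>\<in>keys c. \<Sum>\<sigma>\<in>keys c'.
      single (part_union \<rho> \<sigma>) (lookup c \<rho> * lookup c' \<sigma>))"
  have "partition_supp d" unfolding d_def
  proof (intro keys_sum_subset)
    fix \<rho> \<sigma> assume "\<rho> \<in> keys c" "\<sigma> \<in> keys c'"
    then have "is_partition (part_union \<rho> \<sigma>)" using c by (intro is_partition_part_union) auto
    then show "partition_supp (single (part_union \<rho> \<sigma>)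
        (lookup c \<rho> * lookup c' \<sigma>))" by auto
  qed
  moreover have "lincomb psum_part d = f * f'"
    unfolding d_def c(3,5) by (rule lincomb_mult) (simp add: prod_list_part_union psum_part_def)
  moreover have "lincomb (pleth_part g) d = F * F'"
    unfolding d_def c(4,6) by (rule lincomb_mult) (rule prod_list_part_union)
  ultimately show ?case by (intro exI[of _ d] conjI) simp_all
next
  case (scale f F r)
  then obtain c where c: "partition_supp c"
    "f = lincomb psum_part c" "F = lincomb (pleth_part g) c"
    by blast
  let ?d = "\<Sum>\<rho>\<in>keys c. single \<rho> (r * lookup c \<rho>)"
  have "partition_supp ?d" using c(1) by (intro keys_sum_subset) auto
  then show ?case unfolding c(2,3) by (intro exI[of _ ?d]) (auto simp: lincomb_scale)
qed

lemma pleth_rel_plethysm: "pleth_rel g f F \<Longrightarrow> plethysm f g = F"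
  using pleth_rel_lincomb[of g f F] basis_coeffs_lincomb[OF _ psum_part_independent]
  by (auto simp: plethysm_def lincomb_def[symmetric])

subsection \<open>Expansion in Schur functions\<close>

definition pdeg :: "(nat \<Rightarrow>\<^sub>0 nat) \<Rightarrow> nat" where
  "pdeg \<alpha> = (\<Sum>i\<in>keys \<alpha>. lookup \<alpha> i)"

lemma pdeg_superset: "finite S \<Longrightarrow> keys \<alpha> \<subseteq> S \<Longrightarrow> pdeg \<alpha> = (\<Sum>i\<in>S. lookup \<alpha> i)"
  unfolding pdeg_def by (intro sum.mono_neutral_left) (auto simp: in_keys_iff)

lemma pdeg_add: "pdeg (\<alpha> + \<beta>) = pdeg \<alpha> + pdeg \<beta>"
  by (simp add: pdeg_superset[of "keys \<alpha> \<union> keys \<beta>"] keys_add_nat lookup_add sum.distrib)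

lemma pdeg_single [simp]: "pdeg (single i k) = k"
  by (simp add: pdeg_superset[of "{i}"])

lemma pdeg_0 [simp]: "pdeg 0 = 0"
  by (simp add: pdeg_def)

lemma pdeg_pm: "pdeg (pm N g) = (\<Sum>i<N. g i)"
  by (subst pdeg_superset[of "{..<N}"]) (auto simp: in_keys_iff split: if_splits)

text \<open>A set of degrees covers homogeneity, as a singleton, and bounded degree, as an initial
  segment.\<close>

definition deg_in :: "nat set \<Rightarrow> rat mps \<Rightarrow> bool" where
  "deg_in D f \<longleftrightarrow> (\<forall>\<alpha>. mps_coeff f \<alpha> \<noteq> 0 \<longrightarrow> pdeg \<alpha> \<in> D)"

lemma deg_in_mult:
  assumes "deg_in D f" "deg_in E g" "\<And>d e. d \<in> D \<Longrightarrow> e \<in> E \<Longrightarrow> d + e \<in> X"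
  shows "deg_in X (f * g)"
  unfolding deg_in_def
proof (intro allI impI)
  fix \<alpha> assume "mps_coeff (f * g) \<alpha> \<noteq> 0"
  then have "\<exists>\<beta> \<gamma>. \<alpha> = \<beta> + \<gamma> \<and> mps_coeff f \<beta> \<noteq> 0 \<and> mps_coeff g \<gamma> \<noteq> 0"
    by (rule mps_coeff_mult_nonzero)
  then show "pdeg \<alpha> \<in> X" using assms by (auto simp: deg_in_def pdeg_add)
qed

lemma deg_in_add: "deg_in D f \<Longrightarrow> deg_in D g \<Longrightarrow> deg_in D (f + g)"
  and deg_in_diff: "deg_in D f \<Longrightarrow> deg_in D g \<Longrightarrow> deg_in D (f - g)"
  and deg_in_scale: "deg_in D f \<Longrightarrow> deg_in D (mps_scale r f)"
  and deg_in_mono: "deg_in D f \<Longrightarrow> D \<subseteq> E \<Longrightarrow> deg_in E f"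
  by (force simp: deg_in_def)+

lemma deg_in_mon: "deg_in {pdeg \<alpha>} (mon \<alpha>)"
  by (simp add: deg_in_def mps_coeff_mon)

lemma deg_in_1: "deg_in {0} 1"
  by (simp add: deg_in_def)

lemma deg_in_psum: "deg_in {k} (psum k)"
  by (auto simp: deg_in_def mps_coeff_psum)

lemma deg_in_sum: "(\<And>x. x \<in> A \<Longrightarrow> deg_in D (f x)) \<Longrightarrow> deg_in D (sum f A)"
  by (induction A rule: infinite_finite_induct) (auto simp: deg_in_add deg_in_def[of D 0])

lemma deg_in_prod:
  assumes "\<And>x. x \<in> A \<Longrightarrow> deg_in {d} (f x)"
  shows "deg_in {card A * d} (prod f A)"
  using assms
proof (induction A rule: infinite_finite_induct)
  case (insert x A)
  then have "deg_in {d} (f x)" "deg_in {card A * d} (prod f A)" by auto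
  then show ?case using insert by (auto intro!: deg_in_mult[of "{d}" _ "{card A * d}"])
qed (simp_all add: deg_in_1)

lemma deg_in_vdm: "deg_in {\<Sum>i<N. i} (vdm N)"
proof (induction N)
  case (Suc N)
  have "deg_in {1} (mvar i - mvar N)" for i
    using deg_in_mon[of "single i 1"] deg_in_mon[of "single N 1"]
    by (intro deg_in_diff) (simp_all add: mvar_def)
  then have "deg_in {card {..<N} * 1} (\<Prod>i<N. mvar i - mvar N)" by (intro deg_in_prod)
  then show ?case using Suc by (auto intro!: deg_in_mult)
qed (simp add: deg_in_1)

lemma psi_degree:
  assumes "deg_in D F" "psi N F g \<noteq> 0"
  shows "\<exists>d\<in>D. (\<Sum>i<N. g i) = (\<Sum>i<N. i) + d"
proof -
  have "deg_in {(\<Sum>i<N. i) + d | d. d \<in> D} (vdm N * F)"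
    using deg_in_vdm assms(1) by (rule deg_in_mult) auto
  then show ?thesis using assms(2) by (auto simp: deg_in_def psi_def pdeg_pm)
qed

text \<open>One more variable raises the entries of \<mu> + \<delta> by one and appends a 0;
  dropping that variable undoes exactly this.\<close>

lemma psi_expo_stable:
  assumes "length \<mu> \<le> M" "M \<le> N"
  shows "psi N F (expo N \<mu>) = psi M F (expo M \<mu>)"
  using assms(2)
proof (induction N rule: dec_induct)
  case (step N)
  have len: "length \<mu> \<le> N" using assms(1) step.hyps(1) by simp
  have "psi (Suc N) F (expo (Suc N) \<mu>) = psi N F (\<lambda>i. expo (Suc N) \<mu> i - 1)"
    using len by (subst psi_Suc_restrict) (auto simp: expo_def nth_default_def)
  also have "\<dots> = psi N F (expo N \<mu>)"
    by (rule psi_cong) (auto simp: expo_def)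
  finally show ?case using step by simp
qed simp

lemma psi_lincomb_schur:
  assumes "partition_supp c" "\<And>\<nu>. \<nu> \<in> keys c \<Longrightarrow> length \<nu> \<le> N"
    and "is_partition \<mu>" "length \<mu> \<le> N"
  shows "psi N (lincomb schur c) (expo N \<mu>) = lookup c \<mu>"
proof -
  have "psi N (lincomb schur c) (expo N \<mu>)
      = (\<Sum>\<nu>\<in>keys c. if \<nu> = \<mu> then lookup c \<mu> else 0)"
    unfolding lincomb_def psi_sum psi_scale
    using assms by (intro sum.cong) (auto simp: psi_schur_expo)
  then show ?thesis by (auto simp: in_keys_iff)
qed

lemma length_bound:
  obtains N where "M \<le> N" "\<And>\<nu>. \<nu> \<in> keys c \<Longrightarrow> length \<nu> \<le> N"
proof
  let ?N = "Max (insert M (length ` keys c))"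
  show "M \<le> ?N" by simp
  show "length \<nu> \<le> ?N" if "\<nu> \<in> keys c" for \<nu>
    using that by (intro Max_ge) auto
qed

lemma schur_independent:
  assumes "partition_supp c" "partition_supp d" "lincomb schur c = lincomb schur d"
  shows "c = d"
proof (rule poly_mapping_eqI)
  fix \<mu>
  show "lookup c \<mu> = lookup d \<mu>"
  proof (cases "is_partition \<mu>")
    case True
    obtain M where M: "length \<mu> \<le> M" "\<And>\<nu>. \<nu> \<in> keys c \<Longrightarrow> length \<nu> \<le> M"
      using length_bound by blast
    obtain N where N: "M \<le> N" "\<And>\<nu>. \<nu> \<in> keys d \<Longrightarrow> length \<nu> \<le> N"
      using length_bound by blast
    have "psi N (lincomb schur c) (expo N \<mu>) = lookup c \<mu>"
      using M N True by (intro psi_lincomb_schur assms(1)) (auto intro: order_trans)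
    moreover have "psi N (lincomb schur d) (expo N \<mu>) = lookup d \<mu>"
      using M N True by (intro psi_lincomb_schur assms(2)) (auto intro: order_trans)
    ultimately show ?thesis using assms(3) by simp
  next
    case False
    then have "\<mu> \<notin> keys c" "\<mu> \<notin> keys d" using assms by auto
    then show ?thesis by (simp add: in_keys_iff)
  qed
qed

lemma basis_coeffs_schur: "partition_supp c \<Longrightarrow> basis_coeffs schur (lincomb schur c) = c"
  by (rule basis_coeffs_lincomb) (auto intro: schur_independent)

lemma length_le_sum_list: "is_partition \<nu> \<Longrightarrow> length \<nu> \<le> sum_list \<nu>"
proof -
  have "0 \<notin> set \<nu> \<Longrightarrow> length \<nu> \<le> sum_list \<nu>"
    by (induction \<nu>) auto
  then show "is_partition \<nu> \<Longrightarrow> length \<nu> \<le> sum_list \<nu>" by (simp add: is_partition_def)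
qed

text \<open>The coefficients at \<mu> + \<delta> are the only candidates for coordinates. The degree
  bound leaves finitely many and annihilates F at all larger partitions.\<close>

lemma schur_expansion:
  assumes sym: "sym_mps F" and deg: "deg_in {..d} F"
  shows "\<exists>c. partition_supp c \<and> F = lincomb schur c"
proof -
  let ?P = "{\<nu>. is_partition \<nu> \<and> sum_list \<nu> \<le> d}"
  define a where "a \<nu> = psi (length \<nu>) F (expo (length \<nu>) \<nu>)" for \<nu>
  define c where "c = (\<Sum>\<nu>\<in>?P. single \<nu> (a \<nu>))"
  have c: "lincomb schur c = (\<Sum>\<nu>\<in>?P. mps_scale (a \<nu>) (schur \<nu>))"
    by (simp add: c_def lincomb_sum lincomb_single)
  have "partition_supp c" unfolding c_def by (intro keys_sum_subset) auto
  moreover have "F = lincomb schur c"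
  proof (rule sym_mps_eqI_psi[OF sym, of _ d])
    show "sym_mps (lincomb schur c)"
      unfolding c by (intro sym_mps_sum sym_mps_scale sym_mps_schur) auto
    fix N :: nat and \<mu>
    assume N: "d \<le> N" and \<mu>: "is_partition \<mu>" "length \<mu> \<le> N"
    have F: "psi N F (expo N \<mu>) = a \<mu>"
      unfolding a_def using order_refl \<mu>(2) by (rule psi_expo_stable)
    have "psi N (lincomb schur c) (expo N \<mu>) = (\<Sum>\<nu>\<in>?P. if \<nu> = \<mu> then a \<mu> else 0)"
      unfolding c psi_sum psi_scale
    proof (rule sum.cong[OF refl])
      fix \<nu> assume "\<nu> \<in> ?P"
      then have "is_partition \<nu>" "length \<nu> \<le> N" using length_le_sum_list[of \<nu>] N by auto
      then show "a \<nu> * psi N (schur \<nu>) (expo N \<mu>) = (if \<nu> = \<mu> then a \<mu> else 0)"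
        using \<mu> by (simp add: psi_schur_expo)
    qed
    also have "\<dots> = (if \<mu> \<in> ?P then a \<mu> else 0)"
      using finite_partitions by simp
    also have "\<dots> = psi N F (expo N \<mu>)"
    proof (cases "\<mu> \<in> ?P")
      case False
      then have "\<not> (\<exists>e\<in>{..d}. (\<Sum>i<N. expo N \<mu> i) = (\<Sum>i<N. i) + e)"
        using \<mu> by (auto simp: sum_expo)
      then have "psi N F (expo N \<mu>) = 0" using psi_degree[OF deg] by metis
      then show ?thesis using False by auto
    qed (simp add: F)
    finally show "psi N F (expo N \<mu>) = psi N (lincomb schur c) (expo N \<mu>)" ..
  qed
  ultimately show ?thesis by blast
qed

text \<open>The bridge from the definition of the Hall inner product to coefficients of alternants;
  it is valid with any number M of variables that accommodates \<mu>.\<close>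

lemma hall_inner_schur:
  assumes sym: "sym_mps F" and deg: "deg_in {..d} F" and \<mu>: "is_partition \<mu>" "length \<mu> \<le> M"
  shows "hall_inner F (schur \<mu>) = psi M F (expo M \<mu>)"
proof -
  obtain c where c: "partition_supp c" "F = lincomb schur c"
    using schur_expansion[OF sym deg] by blast
  have "schur \<mu> = lincomb schur (single \<mu> 1)" by (simp add: lincomb_single)
  moreover have "partition_supp (single \<mu> 1)" using \<mu> by simp
  ultimately have s: "basis_coeffs schur (schur \<mu>) = single \<mu> 1"
    using basis_coeffs_schur by metis
  have "basis_coeffs schur F = c"
    unfolding c(2) using c(1) by (rule basis_coeffs_schur)
  then have "hall_inner F (schur \<mu>) = (\<Sum>\<rho>\<in>keys c. if \<rho> = \<mu> then lookup c \<mu> else 0)"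
    unfolding hall_inner_def s by (intro sum.cong) (auto simp: lookup_single when_def)
  also have "\<dots> = lookup c \<mu>" by (auto simp: in_keys_iff)
  finally have "hall_inner F (schur \<mu>) = lookup c \<mu>" .
  moreover obtain N where N: "M \<le> N" "\<And>\<nu>. \<nu> \<in> keys c \<Longrightarrow> length \<nu> \<le> N"
    using length_bound by blast
  moreover have "psi N (lincomb schur c) (expo N \<mu>) = lookup c \<mu>"
    using \<mu> N c(1) by (intro psi_lincomb_schur) auto
  ultimately show ?thesis using psi_expo_stable[OF \<mu>(2), of N F] c(2) by simp
qed

section \<open>Plethysm with the complete symmetric function of degree two\<close>

lemma mps_coeff_psum_plethysm:
  "mps_coeff (psum_plethysm n g) \<alpha> = (if \<forall>i. n dvd lookup \<alpha> i
     then mps_coeff g (Poly_Mapping.map (\<lambda>e. e div n) \<alpha>) else 0)"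
  by (simp add: psum_plethysm.rep_eq)

lemma lookup_map_nat: "f 0 = 0 \<Longrightarrow> lookup (Poly_Mapping.map f \<alpha>) i = f (lookup \<alpha> i)"
  for f :: "nat \<Rightarrow> nat"
  by (auto simp: map.rep_eq when_def)

lemma psum_plethysm_add: "psum_plethysm n (f + g) = psum_plethysm n f + psum_plethysm n g"
  by (rule mps_eqI) (simp add: mps_coeff_psum_plethysm)

lemma psum_plethysm_scale: "psum_plethysm n (mps_scale r f) = mps_scale r (psum_plethysm n f)"
  by (rule mps_eqI) (simp add: mps_coeff_psum_plethysm)

text \<open>A splitting into vectors not divisible by n contributes 0; the remaining splittings are
  those of the divided exponent vector.\<close>

lemma psum_plethysm_mult:
  assumes n: "n > 0"
  shows "psum_plethysm n (f * g) = psum_plethysm n f * psum_plethysm n g"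
proof (rule mps_eqI)
  fix \<alpha>
  let ?d = "Poly_Mapping.map (\<lambda>e. e div n) :: (nat \<Rightarrow>\<^sub>0 nat) \<Rightarrow> _"
  let ?u = "Poly_Mapping.map (\<lambda>e. e * n) :: (nat \<Rightarrow>\<^sub>0 nat) \<Rightarrow> _"
  define dv where "dv \<beta> \<longleftrightarrow> (\<forall>i. n dvd lookup \<beta> i)" for \<beta> :: "nat \<Rightarrow>\<^sub>0 nat"
  have lk: "lookup (?d \<beta>) i = lookup \<beta> i div n"
    "lookup (?u \<beta>) i = lookup \<beta> i * n" for \<beta> i
    by (simp_all add: lookup_map_nat)
  have du: "?d (?u \<beta>) = \<beta>" for \<beta>
    using n by (intro poly_mapping_eqI) (simp add: lk)
  have ud: "?u (?d \<beta>) = \<beta>" if "dv \<beta>" for \<beta>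
    using that by (intro poly_mapping_eqI) (simp add: lk dv_def)
  have dvu: "dv (?u \<beta>)" for \<beta> by (simp add: dv_def lk)
  have u_add: "?u (\<beta> + \<gamma>) = ?u \<beta> + ?u \<gamma>" for \<beta> \<gamma>
    by (intro poly_mapping_eqI) (simp add: lk lookup_add distrib_right)
  have d_add: "?d (\<beta> + \<gamma>) = ?d \<beta> + ?d \<gamma>" if "dv \<beta>" "dv \<gamma>" for \<beta> \<gamma>
    using that by (intro poly_mapping_eqI) (simp add: lk lookup_add dv_def)
  have coeff: "mps_coeff (psum_plethysm n h) \<beta> = (if dv \<beta> then mps_coeff h (?d \<beta>) else 0)" for h \<beta>
    by (simp add: mps_coeff_psum_plethysm dv_def)
  let ?A = "{(\<beta>, \<gamma>). \<beta> + \<gamma> = \<alpha>}" and ?B = "{(\<beta>, \<gamma>). \<beta> + \<gamma> = \<alpha> \<and> dv \<beta> \<and> dv \<gamma>}"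
  let ?D = "\<lambda>(\<beta>, \<gamma>). (?d \<beta>, ?d \<gamma>)" and ?U = "\<lambda>(\<beta>, \<gamma>). (?u \<beta>, ?u \<gamma>)"
  have "mps_coeff (psum_plethysm n f * psum_plethysm n g) \<alpha> =
      (\<Sum>(\<beta>, \<gamma>)\<in>?B. mps_coeff f (?d \<beta>) * mps_coeff g (?d \<gamma>))"
    unfolding mps_coeff_mult
    by (rule sum.mono_neutral_cong_right[OF finite_antidiagonal]) (auto simp: coeff split: if_splits)
  also have "\<dots> = mps_coeff (psum_plethysm n (f * g)) \<alpha>"
  proof (cases "dv \<alpha>")
    case True
    have "(\<Sum>(\<beta>, \<gamma>)\<in>?B. mps_coeff f (?d \<beta>) * mps_coeff g (?d \<gamma>)) =
        (\<Sum>(\<beta>, \<gamma>) | \<beta> + \<gamma> = ?d \<alpha>. mps_coeff f \<beta> * mps_coeff g \<gamma>)"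
    proof (rule sum.reindex_bij_witness[where i = ?U and j = ?D])
      fix p assume "p \<in> ?B"
      then obtain \<beta> \<gamma> where p: "p = (\<beta>, \<gamma>)" "\<beta> + \<gamma> = \<alpha>" "dv \<beta>" "dv \<gamma>" by blast
      show "?U (?D p) = p" using p by (simp add: ud)
      show "?D p \<in> {(\<beta>, \<gamma>). \<beta> + \<gamma> = ?d \<alpha>}" using p by (auto simp: d_add)
      show "(case ?D p of (\<beta>, \<gamma>) \<Rightarrow> mps_coeff f \<beta> * mps_coeff g \<gamma>) =
          (case p of (\<beta>, \<gamma>) \<Rightarrow> mps_coeff f (?d \<beta>) * mps_coeff g (?d \<gamma>))" using p by simp
    next
      fix p assume "p \<in> {(\<beta>, \<gamma>). \<beta> + \<gamma> = ?d \<alpha>}"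
      then obtain \<beta> \<gamma> where p: "p = (\<beta>, \<gamma>)" "\<beta> + \<gamma> = ?d \<alpha>" by blast
      show "?D (?U p) = p" using p by (simp add: du)
      have "?u \<beta> + ?u \<gamma> = \<alpha>" using p ud[OF True] by (simp flip: u_add)
      then show "?U p \<in> ?B" using p dvu by simp
    qed
    then show ?thesis using True by (simp add: coeff mps_coeff_mult)
  next
    case False
    have "dv (\<beta> + \<gamma>)" if "dv \<beta>" "dv \<gamma>" for \<beta> \<gamma>
      using that by (simp add: dv_def lookup_add)
    then have "?B = {}" using False by blast
    then show ?thesis using False by (simp only: coeff sum.empty if_False)
  qed
  finally show "mps_coeff (psum_plethysm n (f * g)) \<alpha> = mps_coeff (psum_plethysm n f * psum_plethysm n g) \<alpha>" ..
qed

lemma psum_plethysm_psum: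
  assumes n: "n > 0"
  shows "psum_plethysm n (psum m) = psum (n * m)"
proof (rule mps_eqI)
  fix \<alpha> :: "nat \<Rightarrow>\<^sub>0 nat"
  have "(\<forall>i. n dvd lookup \<alpha> i) \<and> (\<exists>i. Poly_Mapping.map (\<lambda>e. e div n) \<alpha> = single i m)
      \<longleftrightarrow> (\<exists>i. \<alpha> = single i (n * m))" (is "?L \<longleftrightarrow> ?R")
  proof
    assume ?L
    then obtain i where dv: "\<forall>i. n dvd lookup \<alpha> i"
      and i: "Poly_Mapping.map (\<lambda>e. e div n) \<alpha> = single i m" by blast
    have "\<alpha> = single i (n * m)"
    proof (rule poly_mapping_eqI)
      fix j
      have "lookup \<alpha> j div n = lookup (single i m) j"
        by (simp add: lookup_map_nat flip: i)
      then have "lookup \<alpha> j = n * lookup (single i m) j"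
        using dv by (metis dvd_mult_div_cancel)
      then show "lookup \<alpha> j = lookup (single i (n * m)) j"
        by (auto simp: lookup_single when_def)
    qed
    then show ?R by blast
  next
    assume ?R
    then obtain i where i: "\<alpha> = single i (n * m)" by blast
    have "Poly_Mapping.map (\<lambda>e. e div n) \<alpha> = single i m"
      using n by (intro poly_mapping_eqI) (auto simp: lookup_map_nat i lookup_single when_def)
    moreover have "\<forall>j. n dvd lookup \<alpha> j" by (auto simp: i lookup_single when_def)
    ultimately show ?L by blast
  qed
  then show "mps_coeff (psum_plethysm n (psum m)) \<alpha> = mps_coeff (psum (n * m)) \<alpha>"
    by (auto simp: mps_coeff_psum_plethysm mps_coeff_psum)
qed

lemma elem_0: "elem 0 = 1"
  by (rule mps_eqI_trunc[of 0]) (simp add: trunc_elem esym_0)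

lemma schur_Nil: "schur [] = 1"
proof (rule mps_eqI)
  fix \<alpha>
  have "{T \<in> ssyt []. tableau_weight [] T = \<alpha>} = (if \<alpha> = 0 then {\<lambda>_. undefined} else {})"
    by (auto simp: ssyt_def tableau_weight_def cells_def)
  then show "mps_coeff (schur []) \<alpha> = mps_coeff 1 \<alpha>" by (simp add: mps_coeff_schur)
qed

lemma schur_replicate: "schur (replicate m 1) = elem m"
proof -
  have "vstrip_removals [] = {[]}" by (auto simp: vstrip_removals_def is_partition_def)
  then show ?thesis using schur_mult_elem[of "[]" m]
    by (simp add: schur_Nil is_partition_def add_column_def)
qed

lemma elem_1: "elem 1 = psum 1"
  using elem_newton[of 1] by (simp add: elem_0)

text \<open>The Pieri rule gives s_1 e_1 = s_2 + s_11, and Newton's identity expresses s_11 = e_2 in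
  power sums.\<close>

lemma schur_2: "schur [2] = mps_scale (1 / 2) (psum 1 * psum 1 + psum 2)"
proof -
  have "vstrip_removals [1] = {[1], []}"
  proof (intro equalityI subsetI)
    fix \<kappa> :: "nat list" assume "\<kappa> \<in> vstrip_removals [1]"
    then have \<kappa>: "is_partition \<kappa>" "length \<kappa> \<le> 1" "nth_default 0 \<kappa> 0 \<le> 1"
      by (auto simp: vstrip_removals_def nth_default_def dest: spec[of _ 0])
    then show "\<kappa> \<in> {[1], []}"
      by (cases \<kappa>) (auto simp: is_partition_def nth_default_def)
  next
    fix \<kappa> :: "nat list" assume "\<kappa> \<in> {[1], []}"
    then show "\<kappa> \<in> vstrip_removals [1]"
      by (auto simp: vstrip_removals_def is_partition_def nth_default_def)
  qed
  then have "schur [1] * elem 1 = schur [2] + schur [1, 1]"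
    using schur_mult_elem[of "[1]" 1]
    by (simp add: is_partition_def add_column_def numeral_2_eq_2)
  moreover have "schur [1] = elem 1" "schur [1, 1] = elem 2"
    using schur_replicate[of 1] schur_replicate[of 2] by (simp_all add: numeral_2_eq_2)
  ultimately have "elem 1 * elem 1 = schur [2] + elem 2" by (simp only:)
  then have s2: "schur [2] = psum 1 * psum 1 - elem 2" by (metis add_diff_cancel_right' elem_1)
  have e2: "elem 2 = mps_scale (1 / 2) (psum 1 * psum 1 - psum 2)"
  proof -
    have "mps_scale 2 (elem 2) = psum 1 * psum 1 - psum 2"
      using elem_newton[of 2] elem_1 by (simp add: numeral_2_eq_2 elem_0 mps_scale_minus_1)
    then have "mps_scale (1 / 2) (mps_scale 2 (elem 2)) = mps_scale (1 / 2) (psum 1 * psum 1 - psum 2)"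
      by simp
    then show ?thesis by (simp add: mps_scale_scale)
  qed
  show ?thesis unfolding s2 e2 by (intro mps_eqI) (simp add: field_simps)
qed

lemma psum_plethysm_schur_2:
  assumes "n > 0"
  shows "psum_plethysm n (schur [2]) = mps_scale (1 / 2) (psum n * psum n + psum (2 * n))"
  using assms
  by (simp add: schur_2 psum_plethysm_scale psum_plethysm_add psum_plethysm_mult psum_plethysm_psum mult.commute)

subsection \<open>Schur functions are polynomials in the power sums\<close>

lemma pleth_rel_0: "pleth_rel g 0 0"
  using pleth_rel.scale[OF pleth_rel.one, of g 0] by simp

lemma pleth_rel_diff: "pleth_rel g f F \<Longrightarrow> pleth_rel g f' F' \<Longrightarrow> pleth_rel g (f - f') (F - F')"
  using pleth_rel.add[of g f F "mps_scale (-1) f'" "mps_scale (-1) F'"] pleth_rel.scale[of g f' F' "-1"]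
  by (simp add: mps_scale_minus_1)

lemma pleth_rel_sum:
  "(\<And>x. x \<in> A \<Longrightarrow> pleth_rel g (f x) (F x)) \<Longrightarrow> pleth_rel g (sum f A) (sum F A)"
  by (induction A rule: infinite_finite_induct) (auto intro: pleth_rel_0 pleth_rel.add)

lemma pleth_rel_plethysmI: "\<exists>F. pleth_rel g f F \<Longrightarrow> pleth_rel g f (plethysm f g)"
  using pleth_rel_plethysm by blast

lemma elem_newton': "m > 0 \<Longrightarrow>
  elem m = mps_scale (1 / of_nat m) (\<Sum>i<m. mps_scale ((- 1) ^ i) (psum (Suc i) * elem (m - Suc i)))"
  unfolding elem_newton[symmetric] by (simp add: mps_scale_scale)

lemma pleth_rel_elem: "pleth_rel g (elem m) (plethysm (elem m) g)"
proof (induction m rule: less_induct)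
  case (less m)
  show ?case
  proof (cases "m = 0")
    case True
    then show ?thesis using pleth_rel.one by (intro pleth_rel_plethysmI) (auto simp: elem_0)
  next
    case False
    then have "pleth_rel g (elem m) (mps_scale (1 / of_nat m) (\<Sum>i<m. mps_scale ((- 1) ^ i)
        (psum_plethysm (Suc i) g * plethysm (elem (m - Suc i)) g)))"
      using less by (subst elem_newton')
        (auto intro!: pleth_rel.scale pleth_rel_sum pleth_rel.mult pleth_rel.psum)
    then show ?thesis by (intro pleth_rel_plethysmI exI)
  qed
qed

text \<open>The Pieri rule solved for its term \<kappa> = \<nu>. All other \<kappa> are smaller than
  \<nu>, though their first columns are longer, so induction on the size of \<nu> applies with m
  left free.\<close>

lemma schur_add_column:
  assumes "is_partition \<nu>" "length \<nu> \<le> m"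
  shows "schur (add_column m \<nu>) = schur \<nu> * elem m -
    (\<Sum>\<kappa>\<in>vstrip_removals \<nu> - {\<nu>}. schur (add_column (m + sum_list \<nu> - sum_list \<kappa>) \<kappa>))"
  using schur_mult_elem[OF assms]
  by (subst (asm) sum.remove[OF finite_vstrip_removals self_in_vstrip_removals[OF assms(1)]]) simp

lemma pleth_rel_schur_add_column:
  assumes "is_partition \<nu>" "length \<nu> \<le> m"
  shows "pleth_rel g (schur (add_column m \<nu>)) (plethysm (schur (add_column m \<nu>)) g)"
  using assms
proof (induction "sum_list \<nu>" arbitrary: \<nu> m rule: less_induct)
  case less
  \<comment> \<open>\<nu> is itself a smaller partition with its own first column put back, so the
    induction hypothesis also covers the factor s_\<nu>.\<close>
  have "pleth_rel g (schur \<nu>) (plethysm (schur \<nu>) g)"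
  proof (cases "\<nu> = []")
    case True
    then show ?thesis using pleth_rel.one by (intro pleth_rel_plethysmI) (auto simp: schur_Nil)
  next
    case False
    obtain \<kappa> where \<kappa>: "is_partition \<kappa>" "length \<kappa> \<le> length \<nu>" "\<nu> = add_column (length \<nu>) \<kappa>"
      using partition_remove_column[OF less.prems(1)] by blast
    then have "sum_list \<kappa> + length \<nu> = sum_list \<nu>" using sum_list_add_column by metis
    moreover have "length \<nu> > 0" using False by simp
    ultimately have "sum_list \<kappa> < sum_list \<nu>" by linarith
    then show ?thesis using less.hyps[of \<kappa> "length \<nu>"] \<kappa> by simp
  qed
  moreover have "pleth_rel g (schur (add_column (m + sum_list \<nu> - sum_list \<kappa>) \<kappa>))
      (plethysm (schur (add_column (m + sum_list \<nu> - sum_list \<kappa>) \<kappa>)) g)"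
    if "\<kappa> \<in> vstrip_removals \<nu> - {\<nu>}" for \<kappa>
    using that less.prems vstrip_removals_sum_less[OF less.prems(1), of \<kappa>]
    by (intro less.hyps) (auto simp: vstrip_removals_def)
  ultimately show ?case
    unfolding schur_add_column[OF less.prems]
    by (intro pleth_rel_plethysmI exI) (rule pleth_rel_diff pleth_rel.mult pleth_rel_sum pleth_rel_elem | assumption)+
qed

lemma pleth_rel_schur:
  assumes "is_partition \<mu>"
  shows "pleth_rel g (schur \<mu>) (plethysm (schur \<mu>) g)"
proof -
  obtain \<nu> where "is_partition \<nu>" "length \<nu> \<le> length \<mu>" "\<mu> = add_column (length \<mu>) \<nu>"
    using partition_remove_column[OF assms] by blast
  then show ?thesis using pleth_rel_schur_add_column[of \<nu> "length \<mu>" g] by simp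
qed

lemma sym_mps_pleth_rel: "pleth_rel (schur [2]) f F \<Longrightarrow> sym_mps F"
  by (induction rule: pleth_rel.induct)
    (auto simp: psum_plethysm_schur_2 intro: sym_mps_1 sym_mps_psum sym_mps_add sym_mps_mult sym_mps_scale)

lemma deg_in_pleth_rel: "pleth_rel (schur [2]) f F \<Longrightarrow> \<exists>d. deg_in {..d} F"
proof (induction rule: pleth_rel.induct)
  case one
  then show ?case using deg_in_mono[OF deg_in_1] by blast
next
  case (psum k)
  have "deg_in {2 * k} (psum k * psum k + psum (2 * k))"
    by (intro deg_in_add deg_in_mult[OF deg_in_psum deg_in_psum] deg_in_psum) auto
  then have "deg_in {2 * k} (psum_plethysm k (schur [2]))"
    using psum by (simp add: psum_plethysm_schur_2 deg_in_scale)
  then show ?case using deg_in_mono by (metis atMost_iff empty_subsetI insert_subset order_refl)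
next
  case (add f F f' F')
  then obtain d d' where "deg_in {..d} F" "deg_in {..d'} F'" by blast
  then have "deg_in {..max d d'} F" "deg_in {..max d d'} F'" by (auto intro: deg_in_mono)
  then show ?case using deg_in_add by blast
next
  case (mult f F f' F')
  then obtain d d' where "deg_in {..d} F" "deg_in {..d'} F'" by blast
  then have "deg_in {..d + d'} (F * F')" by (rule deg_in_mult) auto
  then show ?case by blast
qed (use deg_in_scale in blast)

subsection \<open>Plethysms of elementary symmetric functions\<close>

definition pairs :: "nat \<Rightarrow> (nat \<times> nat) set" where
  "pairs N = {(a, b). a \<le> b \<and> b < N}"

lemma finite_pairs [simp]: "finite (pairs N)"
  by (rule finite_subset[of _ "{..<N} \<times> {..<N}"]) (auto simp: pairs_def)

lemma pairs_0: "pairs 0 = {}"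
  by (auto simp: pairs_def)

lemma pairs_Suc: "pairs (Suc N) = pairs N \<union> (\<lambda>a. (a, N)) ` {..N}"
  by (auto simp: pairs_def less_Suc_eq)

lemma pairs_Suc_disjoint: "pairs N \<inter> (\<lambda>a. (a, N)) ` {..N} = {}"
  by (auto simp: pairs_def)

abbreviation pair_mon :: "nat \<times> nat \<Rightarrow> rat mps" where
  "pair_mon p \<equiv> mvar (fst p) * mvar (snd p)"

text \<open>The identity p_1^2 + p_2 = 2 h_2, in arbitrary letters so that k-th powers of the
  variables can be inserted.\<close>

lemma sum_pairs:
  fixes y :: "nat \<Rightarrow> 'a::comm_ring_1"
  shows "(\<Sum>a<N. y a) * (\<Sum>a<N. y a) + (\<Sum>a<N. y a * y a) = 2 * (\<Sum>p\<in>pairs N. y (fst p) * y (snd p))"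
proof (induction N)
  case (Suc N)
  have "(\<Sum>p\<in>pairs (Suc N). y (fst p) * y (snd p)) =
      (\<Sum>p\<in>pairs N. y (fst p) * y (snd p)) + (\<Sum>p\<in>(\<lambda>a. (a, N)) ` {..N}. y (fst p) * y (snd p))"
    unfolding pairs_Suc by (intro sum.union_disjoint pairs_Suc_disjoint) auto
  also have "(\<Sum>p\<in>(\<lambda>a. (a, N)) ` {..N}. y (fst p) * y (snd p)) = (\<Sum>a\<le>N. y a) * y N"
    by (subst sum.reindex) (auto simp: inj_on_def sum_distrib_right)
  also have "(\<Sum>a\<le>N. y a) = (\<Sum>a<N. y a) + y N"
    by (simp add: lessThan_Suc_atMost[symmetric])
  finally show ?case using Suc by (simp add: algebra_simps)
qed (simp add: pairs_0)

lemma trunc_psum_plethysm_schur_2: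
  assumes "k > 0"
  shows "trunc N (psum_plethysm k (schur [2])) = (\<Sum>p\<in>pairs N. pair_mon p ^ k)"
proof -
  have "trunc N (psum k) = (\<Sum>a<N. mvar a ^ k)" "trunc N (psum (2 * k)) = (\<Sum>a<N. mvar a ^ k * mvar a ^ k)"
    using assms by (simp_all add: trunc_psum mvar_power mult_2 mon_mult flip: single_add)
  then have "trunc N (psum_plethysm k (schur [2])) =
      mps_scale (1 / 2) (2 * (\<Sum>p\<in>pairs N. mvar (fst p) ^ k * mvar (snd p) ^ k))"
    using assms sum_pairs[of "\<lambda>a. mvar a ^ k" N]
    by (simp add: psum_plethysm_schur_2 trunc_scale trunc_add trunc_mult)
  also have "2 * (\<Sum>p\<in>pairs N. mvar (fst p) ^ k * mvar (snd p) ^ k) =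
      mps_scale 2 (\<Sum>p\<in>pairs N. mvar (fst p) ^ k * mvar (snd p) ^ k)"
    using of_nat_mult_mps[of 2] by simp
  finally show ?thesis by (simp add: mps_scale_scale power_mult_distrib)
qed

abbreviation elem_pleth :: "nat \<Rightarrow> rat mps" where
  "elem_pleth m \<equiv> plethysm (elem m) (schur [2])"

text \<open>By Newton's identity on both sides: p_k o h_2 is the k-th power sum of the alphabet of
  monomials of h_2, hence e_m o h_2 is its m-th elementary symmetric polynomial.\<close>

lemma trunc_elem_pleth: "trunc N (elem_pleth m) = esym (pairs N) pair_mon m"
proof (induction m rule: less_induct)
  case (less m)
  show ?case
  proof (cases "m = 0")
    case True
    have "plethysm 1 (schur [2]) = 1" using pleth_rel.one by (rule pleth_rel_plethysm)
    then show ?thesis using True by (simp add: elem_0 esym_0)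
  next
    case False
    let ?X = "mps_scale (1 / of_nat m) (\<Sum>i<m. mps_scale ((- 1) ^ i)
        (psum_plethysm (Suc i) (schur [2]) * elem_pleth (m - Suc i)))"
    have "pleth_rel (schur [2]) (elem m) ?X"
      using False by (subst elem_newton')
        (auto intro!: pleth_rel.scale pleth_rel_sum pleth_rel.mult pleth_rel.psum pleth_rel_elem)
    then have "elem_pleth m = ?X"
      by (rule pleth_rel_plethysm)
    then have "trunc N (elem_pleth m) = mps_scale (1 / of_nat m) (\<Sum>i<m. mps_scale ((- 1) ^ i)
        ((\<Sum>p\<in>pairs N. pair_mon p ^ Suc i) * esym (pairs N) pair_mon (m - Suc i)))"
      using False by (simp add: trunc_scale trunc_sum trunc_mult trunc_psum_plethysm_schur_2 less del: power_Suc)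
    also have "\<dots> = mps_scale (1 / of_nat m) (of_nat m * esym (pairs N) pair_mon m)"
      unfolding newton_identity[OF finite_pairs] by (simp add: minus_one_power_mult_mps)
    also have "\<dots> = esym (pairs N) pair_mon m"
      using False by (simp add: of_nat_mult_mps mps_scale_scale)
    finally show ?thesis .
  qed
qed

lemma sym_mps_elem_pleth: "sym_mps (elem_pleth m)"
  by (rule sym_mps_pleth_rel[OF pleth_rel_elem])

section \<open>The symplectic denominator\<close>

text \<open>The exponent e of x_n becomes w - e. Subtraction is truncated, so this is an involution
  only on exponents at most w.\<close>

definition refl :: "nat \<Rightarrow> nat \<Rightarrow> (nat \<Rightarrow>\<^sub>0 nat) \<Rightarrow> (nat \<Rightarrow>\<^sub>0 nat)" where
  "refl n w \<alpha> = Poly_Mapping.update n (w - lookup \<alpha> n) \<alpha>"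

lemma lookup_refl: "lookup (refl n w \<alpha>) i = (if i = n then w - lookup \<alpha> n else lookup \<alpha> i)"
  by (auto simp: refl_def lookup_update)

lemma refl_refl: "lookup \<alpha> n \<le> w \<Longrightarrow> refl n w (refl n w \<alpha>) = \<alpha>"
  by (intro poly_mapping_eqI) (auto simp: lookup_refl)

text \<open>\<open>pal n w \<epsilon> f\<close> says that substituting \<open>1/x\<^sub>n\<close> for \<open>x\<^sub>n\<close> in \<open>f\<close> and multiplying
  by \<open>x\<^sub>n\<^sup>w\<close> gives \<open>\<epsilon> f\<close>.\<close>

definition pal :: "nat \<Rightarrow> nat \<Rightarrow> rat \<Rightarrow> rat mps \<Rightarrow> bool" where
  "pal n w \<epsilon> f \<longleftrightarrow> (\<forall>\<alpha>. if lookup \<alpha> n \<le> w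
     then mps_coeff f (refl n w \<alpha>) = \<epsilon> * mps_coeff f \<alpha> else mps_coeff f \<alpha> = 0)"

lemma palD: "pal n w \<epsilon> f \<Longrightarrow> lookup \<alpha> n \<le> w \<Longrightarrow> mps_coeff f (refl n w \<alpha>) = \<epsilon> * mps_coeff f \<alpha>"
  and pal_zero: "pal n w \<epsilon> f \<Longrightarrow> w < lookup \<alpha> n \<Longrightarrow> mps_coeff f \<alpha> = 0"
  unfolding pal_def by (metis not_le)+

lemma palI:
  assumes "\<And>\<alpha>. lookup \<alpha> n \<le> w \<Longrightarrow> mps_coeff f (refl n w \<alpha>) = \<epsilon> * mps_coeff f \<alpha>"
    and "\<And>\<alpha>. w < lookup \<alpha> n \<Longrightarrow> mps_coeff f \<alpha> = 0"
  shows "pal n w \<epsilon> f"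
  unfolding pal_def using assms by (simp add: not_le)

text \<open>Widths add and signs multiply: splittings exceeding one of the widths contribute 0, and
  the others are permuted by reflecting both summands.\<close>

lemma pal_mult:
  assumes f: "pal n w \<epsilon> f" and g: "pal n w' \<epsilon>' g"
  shows "pal n (w + w') (\<epsilon> * \<epsilon>') (f * g)"
proof -
  let ?l = "\<lambda>\<alpha>. lookup \<alpha> n"
  let ?A = "\<lambda>\<alpha>. {(\<beta>, \<gamma>). \<beta> + \<gamma> = \<alpha> \<and> ?l \<beta> \<le> w \<and> ?l \<gamma> \<le> w'}"
  let ?r = "\<lambda>(\<beta>, \<gamma>). (refl n w \<beta>, refl n w' \<gamma>)"
  have coeff: "mps_coeff (f * g) \<alpha> = (\<Sum>(\<beta>, \<gamma>)\<in>?A \<alpha>. mps_coeff f \<beta> * mps_coeff g \<gamma>)" for \<alpha>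
  proof -
    have "?l \<beta> \<le> w" if "mps_coeff f \<beta> \<noteq> 0" for \<beta> using pal_zero[OF f] that by (meson not_le)
    moreover have "?l \<gamma> \<le> w'" if "mps_coeff g \<gamma> \<noteq> 0" for \<gamma> using pal_zero[OF g] that by (meson not_le)
    ultimately show ?thesis
      unfolding mps_coeff_mult by (intro sum.mono_neutral_right finite_antidiagonal) auto
  qed
  show ?thesis
  proof (rule palI)
    fix \<alpha> assume "?l \<alpha> > w + w'"
    then have "?A \<alpha> = {}" by (auto simp: lookup_add)
    then show "mps_coeff (f * g) \<alpha> = 0" unfolding coeff by (simp only: sum.empty)
  next
    fix \<alpha> assume \<alpha>: "?l \<alpha> \<le> w + w'"
    have A: "(refl n w \<beta>, refl n w' \<gamma>) \<in> ?A (refl n (w + w') \<delta>)" if "(\<beta>, \<gamma>) \<in> ?A \<delta>" for \<beta> \<gamma> \<delta>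
      using that by (auto simp: lookup_refl lookup_add intro!: poly_mapping_eqI)
    have "mps_coeff (f * g) (refl n (w + w') \<alpha>)
        = (\<Sum>(\<beta>, \<gamma>)\<in>?A \<alpha>. mps_coeff f (refl n w \<beta>) * mps_coeff g (refl n w' \<gamma>))"
      unfolding coeff
    proof (rule sum.reindex_bij_witness[where i = ?r
          and j = ?r])
      fix p assume p: "p \<in> ?A (refl n (w + w') \<alpha>)"
      obtain \<beta> \<gamma> where \<beta>\<gamma>: "p = (\<beta>, \<gamma>)" by (cases p)
      show "?r (?r p) = p"
        using p by (simp add: \<beta>\<gamma> refl_refl)
      show "?r p \<in> ?A \<alpha>"
        using A[of \<beta> \<gamma> "refl n (w + w') \<alpha>"] p by (simp add: \<beta>\<gamma> refl_refl[OF \<alpha>])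
      show "(case ?r p of
          (\<beta>, \<gamma>) \<Rightarrow> mps_coeff f (refl n w \<beta>) * mps_coeff g (refl n w' \<gamma>)) =
          (case p of (\<beta>, \<gamma>) \<Rightarrow> mps_coeff f \<beta> * mps_coeff g \<gamma>)"
        using p by (simp add: \<beta>\<gamma> refl_refl)
    next
      fix p assume p: "p \<in> ?A \<alpha>"
      obtain \<beta> \<gamma> where \<beta>\<gamma>: "p = (\<beta>, \<gamma>)" by (cases p)
      show "?r (?r p) = p"
        using p by (simp add: \<beta>\<gamma> refl_refl)
      show "?r p \<in> ?A (refl n (w + w') \<alpha>)"
        using A[of \<beta> \<gamma> \<alpha>] p by (simp add: \<beta>\<gamma>)
    qed
    also have "\<dots> = (\<Sum>(\<beta>, \<gamma>)\<in>?A \<alpha>. \<epsilon> * \<epsilon>' * (mps_coeff f \<beta> * mps_coeff g \<gamma>))"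
      by (intro sum.cong) (auto simp: palD[OF f] palD[OF g])
    also have "\<dots> = \<epsilon> * \<epsilon>' * mps_coeff (f * g) \<alpha>"
      by (simp add: coeff sum_distrib_left case_prod_unfold)
    finally show "mps_coeff (f * g) (refl n (w + w') \<alpha>) = \<epsilon> * \<epsilon>' * mps_coeff (f * g) \<alpha>" .
  qed
qed

lemma pal_trunc:
  assumes "trunc n f = f"
  shows "pal n 0 1 f"
proof (rule palI)
  fix \<alpha> :: "nat \<Rightarrow>\<^sub>0 nat" assume "0 < lookup \<alpha> n"
  then have "\<not> supp_below n \<alpha>" by (auto simp: supp_below_def)
  then show "mps_coeff f \<alpha> = 0" using mps_coeff_trunc[of n f \<alpha>] assms by simp
next
  fix \<alpha> :: "nat \<Rightarrow>\<^sub>0 nat" assume "lookup \<alpha> n \<le> 0"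
  then have "refl n 0 \<alpha> = \<alpha>" by (intro poly_mapping_eqI) (auto simp: lookup_refl)
  then show "mps_coeff f (refl n 0 \<alpha>) = 1 * mps_coeff f \<alpha>" by simp
qed

lemma pal_mon_pair:
  assumes \<beta>: "lookup \<beta> n \<le> w" and \<epsilon>: "\<epsilon> * \<epsilon> = 1"
  shows "pal n w \<epsilon> (mon \<beta> + mps_scale \<epsilon> (mon (refl n w \<beta>)))"
proof (rule palI)
  fix \<alpha> assume "lookup \<alpha> n \<le> w"
  then have "refl n w \<alpha> = \<beta> \<longleftrightarrow> \<alpha> = refl n w \<beta>" "refl n w \<alpha> = refl n w \<beta> \<longleftrightarrow> \<alpha> = \<beta>"
    using \<beta> refl_refl by metis+
  then show "mps_coeff (mon \<beta> + mps_scale \<epsilon> (mon (refl n w \<beta>))) (refl n w \<alpha>) =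
      \<epsilon> * mps_coeff (mon \<beta> + mps_scale \<epsilon> (mon (refl n w \<beta>))) \<alpha>"
    using \<epsilon> by (simp add: mps_coeff_mon distrib_left flip: mult.assoc)
next
  fix \<alpha> assume "w < lookup \<alpha> n"
  then have "\<alpha> \<noteq> \<beta>" "\<alpha> \<noteq> refl n w \<beta>" using \<beta> by (auto simp: lookup_refl)
  then show "mps_coeff (mon \<beta> + mps_scale \<epsilon> (mon (refl n w \<beta>))) \<alpha> = 0" by (simp add: mps_coeff_mon)
qed

lemma pal_mon_fixed:
  assumes "lookup \<beta> n \<le> w" "refl n w \<beta> = \<beta>"
  shows "pal n w 1 (mon \<beta>)"
proof (rule palI)
  fix \<alpha> assume "lookup \<alpha> n \<le> w"
  then have "refl n w \<alpha> = \<beta> \<longleftrightarrow> \<alpha> = \<beta>" using assms refl_refl by metis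
  then show "mps_coeff (mon \<beta>) (refl n w \<alpha>) = 1 * mps_coeff (mon \<beta>) \<alpha>" by (simp add: mps_coeff_mon)
next
  fix \<alpha> assume "w < lookup \<alpha> n"
  then show "mps_coeff (mon \<beta>) \<alpha> = 0" using assms(1) by (auto simp: mps_coeff_mon)
qed

lemma pal_diff: "pal n w \<epsilon> f \<Longrightarrow> pal n w \<epsilon> g \<Longrightarrow> pal n w \<epsilon> (f - g)"
  by (rule palI) (simp_all add: palD pal_zero right_diff_distrib)

lemma pal_1: "pal n 0 1 1"
  by (rule pal_trunc) simp

lemma pal_prod:
  assumes "\<And>x. x \<in> A \<Longrightarrow> pal n w 1 (f x)"
  shows "pal n (card A * w) 1 (prod f A)"
  using assms
proof (induction A rule: infinite_finite_induct)
  case (insert x A)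
  then have "pal n (w + card A * w) (1 * 1) (f x * prod f A)" by (intro pal_mult) auto
  then show ?case using insert by simp
qed (simp_all add: pal_1)

definition cden :: "nat \<Rightarrow> rat mps" where
  "cden N = vdm N * (\<Prod>p\<in>pairs N. 1 - pair_mon p)"

lemma cden_Suc:
  "cden (Suc N) = cden N * ((1 - mvar N * mvar N) * (\<Prod>i<N. (mvar i - mvar N) * (1 - mvar i * mvar N)))"
proof -
  have "(\<Prod>p\<in>pairs (Suc N). 1 - pair_mon p) =
      (\<Prod>p\<in>pairs N. 1 - pair_mon p) * (\<Prod>p\<in>(\<lambda>a. (a, N)) ` {..N}. 1 - pair_mon p)"
    unfolding pairs_Suc by (intro prod.union_disjoint pairs_Suc_disjoint) auto
  also have "(\<Prod>p\<in>(\<lambda>a. (a, N)) ` {..N}. 1 - pair_mon p) = (\<Prod>a\<le>N. 1 - mvar a * mvar N)"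
    by (subst prod.reindex) (auto simp: inj_on_def)
  also have "\<dots> = (\<Prod>a<N. 1 - mvar a * mvar N) * (1 - mvar N * mvar N)"
    by (simp add: lessThan_Suc_atMost[symmetric])
  finally show ?thesis by (simp add: cden_def prod.distrib mult_ac)
qed

lemma trunc_cden: "trunc N (cden N) = cden N"
proof -
  have "trunc N (\<Prod>p\<in>pairs N. 1 - pair_mon p) = (\<Prod>p\<in>pairs N. 1 - pair_mon p)"
    unfolding trunc_prod by (intro prod.cong) (auto simp: pairs_def trunc_diff trunc_mult trunc_mvar)
  then show ?thesis by (simp add: cden_def trunc_mult trunc_vdm)
qed

text \<open>Only the factors containing x_N matter: 1 - x_N^2 has width 2 and sign -1, and the N
  products (x_i - x_N)(1 - x_i x_N) have width 2 and sign 1. The total width is 2 (N + 1).\<close>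

lemma pal_cden: "pal N (2 * Suc N) (- 1) (cden (Suc N))"
proof -
  let ?s = "single :: nat \<Rightarrow> nat \<Rightarrow> _"
  have z: "pal N 2 (- 1) (1 - mvar N * mvar N)"
  proof -
    have "refl N 2 0 = ?s N 2"
      by (intro poly_mapping_eqI) (auto simp: lookup_refl lookup_single when_def)
    then have "mon 0 + mps_scale (- 1) (mon (refl N 2 0)) = 1 - mvar N * mvar N"
      by (simp add: mon_0 mps_scale_minus_1 mvar_def mon_mult numeral_2_eq_2 flip: single_add)
    moreover have "pal N 2 (- 1) (mon 0 + mps_scale (- 1) (mon (refl N 2 0)))"
      by (intro pal_mon_pair) simp_all
    ultimately show ?thesis by simp
  qed
  \<comment> \<open>In the expansion x_i + x_i x_N^2 - x_N - x_i^2 x_N the first two terms are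
    exchanged, and the others have exponent 1 at x_N and are fixed.\<close>
  have x: "pal N 2 1 ((mvar i - mvar N) * (1 - mvar i * mvar N))" if "i < N" for i
  proof -
    have r: "refl N 2 (?s i 1) = ?s i 1 + ?s N 2"
      using that by (intro poly_mapping_eqI) (auto simp: lookup_refl lookup_add lookup_single when_def)
    have "pal N 2 1 (mon (?s i 1) + mps_scale 1 (mon (refl N 2 (?s i 1))) - mon (?s N 1) - mon (?s i 2 + ?s N 1))"
      using that by (intro pal_diff pal_mon_pair pal_mon_fixed)
        (auto simp: lookup_refl lookup_add lookup_single when_def intro!: poly_mapping_eqI)
    moreover have "(mvar i - mvar N) * (1 - mvar i * mvar N) =
        mon (?s i 1) + mps_scale 1 (mon (refl N 2 (?s i 1))) - mon (?s N 1) - mon (?s i 2 + ?s N 1)"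
    proof -
      have "mon (?s i 1 + ?s N 2) = mvar i * (mvar N * mvar N)" "mon (?s i 2 + ?s N 1) = mvar i * mvar i * mvar N"
        by (simp_all add: mvar_def mon_mult numeral_2_eq_2 add.assoc flip: single_add)
      then show ?thesis unfolding r mps_scale_1 mvar_def[symmetric] by (simp add: algebra_simps)
    qed
    ultimately show ?thesis by simp
  qed
  have "pal N (card {..<N} * 2) 1 (\<Prod>i<N. (mvar i - mvar N) * (1 - mvar i * mvar N))"
    using x by (intro pal_prod) auto
  then have "pal N (0 + (2 + card {..<N} * 2)) (1 * (- 1 * 1)) (cden (Suc N))"
    unfolding cden_Suc by (intro pal_mult pal_trunc trunc_cden z)
  then show ?thesis by (simp add: mult.commute)
qed

section \<open>Coefficients of the denominator and their symmetries\<close>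

definition cden_coeff :: "nat \<Rightarrow> (nat \<Rightarrow> nat) \<Rightarrow> rat" where
  "cden_coeff N g = mps_coeff (cden N) (pm N g)"

lemma cden_coeff_cong: "(\<And>i. i < N \<Longrightarrow> g i = h i) \<Longrightarrow> cden_coeff N g = cden_coeff N h"
  unfolding cden_coeff_def by (metis pm_cong)

text \<open>Beyond the size of the alphabet e_m vanishes. The free bound K lets expansions for N and
  N + 1 variables share one range of summation.\<close>

lemma prod_one_minus_esym:
  assumes "finite A" "card A \<le> K"
  shows "(\<Prod>x\<in>A. 1 - f x) = (\<Sum>m\<le>K. (- 1) ^ m * esym A f m)"
  using assms
proof (induction A arbitrary: K rule: finite_induct)
  case empty
  have "(- 1) ^ m * esym {} f m = (if m = 0 then 1 else 0)" for m
    by (cases m) (simp_all add: esym_0 esym_empty)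
  then show ?case by simp
next
  case (insert a A)
  obtain K' where K: "K = Suc K'" "card A \<le> K'" using insert by (cases K) auto
  have "(\<Sum>m\<le>K. (- 1) ^ m * esym (insert a A) f m)
      = 1 + (\<Sum>m\<le>K'. (- 1) ^ Suc m * (esym A f (Suc m) + f a * esym A f m))"
    using insert unfolding K by (subst sum.atMost_Suc_shift) (simp add: esym_0 esym_insert)
  also have "\<dots> = (1 + (\<Sum>m\<le>K'. (- 1) ^ Suc m * esym A f (Suc m))) - f a * (\<Sum>m\<le>K'. (- 1) ^ m * esym A f m)"
    by (simp add: sum_distrib_left sum.distrib algebra_simps sum_negf sum_subtractf)
  also have "1 + (\<Sum>m\<le>K'. (- 1) ^ Suc m * esym A f (Suc m)) = (\<Sum>m\<le>K. (- 1) ^ m * esym A f m)"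
    using insert unfolding K by (subst sum.atMost_Suc_shift) (simp add: esym_0)
  also have "\<dots> = (\<Prod>x\<in>A. 1 - f x)" using K by (intro insert.IH[symmetric]) simp
  also have "(\<Sum>m\<le>K'. (- 1) ^ m * esym A f m) = (\<Prod>x\<in>A. 1 - f x)" using K by (intro insert.IH[symmetric])
  finally show ?case using insert by (simp add: algebra_simps)
qed

lemma cden_coeff_sum:
  assumes "card (pairs N) \<le> K"
  shows "cden_coeff N g = (\<Sum>m\<le>K. (- 1) ^ m * psi N (elem_pleth m) g)"
proof -
  have "psi N (elem_pleth m) g = mps_coeff (vdm N * esym (pairs N) pair_mon m) (pm N g)" for m
    by (subst psi_trunc[symmetric]) (simp add: psi_def trunc_elem_pleth)
  moreover have "cden N = (\<Sum>m\<le>K. mps_scale ((- 1) ^ m) (vdm N * esym (pairs N) pair_mon m))"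
    using assms by (simp add: cden_def prod_one_minus_esym[of _ K] sum_distrib_left
        minus_one_power_mult_mps mps_scale_mult_right)
  ultimately show ?thesis by (simp add: cden_coeff_def)
qed

lemma deg_in_trunc_elem_pleth: "deg_in {2 * m} (trunc N (elem_pleth m))"
  unfolding trunc_elem_pleth esym_def
proof (rule deg_in_sum)
  fix S assume "S \<in> {S. S \<subseteq> pairs N \<and> card S = m}"
  then have "card S = m" by simp
  have "deg_in {2} (pair_mon p)" for p
    using deg_in_mon[of "single (fst p) 1 + single (snd p) 1"]
    by (simp add: mvar_def mon_mult pdeg_add numeral_2_eq_2)
  then have "deg_in {card S * 2} (\<Prod>p\<in>S. pair_mon p)" by (intro deg_in_prod)
  then show "deg_in {2 * m} (\<Prod>p\<in>S. pair_mon p)" using \<open>card S = m\<close> by (simp add: mult.commute)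
qed

text \<open>Since e_m o h_2 is homogeneous of degree 2 m, the size of g selects a single term of the
  expanded denominator.\<close>

lemma psi_elem_pleth:
  "psi N (elem_pleth m) g = (if (\<Sum>i<N. g i) = (\<Sum>i<N. i) + 2 * m then (- 1) ^ m * cden_coeff N g else 0)"
proof -
  have deg: "(\<Sum>i<N. g i) = (\<Sum>i<N. i) + 2 * m'" if "psi N (elem_pleth m') g \<noteq> 0" for m'
    using psi_degree[OF deg_in_trunc_elem_pleth[of m' N], of N g] that by (simp add: psi_trunc)
  show ?thesis
  proof (cases "(\<Sum>i<N. g i) = (\<Sum>i<N. i) + 2 * m")
    case True
    have "cden_coeff N g = (\<Sum>m'\<le>max m (card (pairs N)). (- 1) ^ m' * psi N (elem_pleth m') g)"
      by (rule cden_coeff_sum) simp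
    also have "\<dots> = (\<Sum>m'\<in>{m}. (- 1) ^ m' * psi N (elem_pleth m') g)"
      using deg True by (intro sum.mono_neutral_right) auto
    finally have "cden_coeff N g = (- 1) ^ m * psi N (elem_pleth m) g" by simp
    then have "(- 1) ^ m * cden_coeff N g = ((- 1) ^ m * (- 1) ^ m) * psi N (elem_pleth m) g"
      by (simp only: mult.assoc)
    then show ?thesis using True by (simp flip: power_mult_distrib)
  next
    case False
    then show ?thesis using deg by auto
  qed
qed

lemma cden_coeff_transpose:
  assumes "i < N" "k < N" "i \<noteq> k"
  shows "cden_coeff N (g \<circ> transpose i k) = - cden_coeff N g"
  unfolding cden_coeff_sum[OF order_refl]
  using psi_transpose[OF sym_mps_elem_pleth assms] by (simp add: sum_negf)

lemma cden_coeff_eq_0: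
  assumes "i < N" "k < N" "i \<noteq> k" "g i = g k"
  shows "cden_coeff N g = 0"
proof -
  have "g \<circ> transpose i k = g" using assms(4) by (auto simp: transpose_def fun_eq_iff)
  then show ?thesis using cden_coeff_transpose[OF assms(1-3), of g] by simp
qed

lemma cden_coeff_restrict:
  assumes "g N = 0" "\<And>i. i < N \<Longrightarrow> 1 \<le> g i"
  shows "cden_coeff (Suc N) g = cden_coeff N (\<lambda>i. g i - 1)"
proof -
  let ?K = "max (card (pairs N)) (card (pairs (Suc N)))"
  have "cden_coeff (Suc N) g = (\<Sum>m\<le>?K. (- 1) ^ m * psi (Suc N) (elem_pleth m) g)"
    by (rule cden_coeff_sum) simp
  also have "\<dots> = (\<Sum>m\<le>?K. (- 1) ^ m * psi N (elem_pleth m) (\<lambda>i. g i - 1))"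
    using assms by (simp add: psi_Suc_restrict)
  also have "\<dots> = cden_coeff N (\<lambda>i. g i - 1)"
    by (rule cden_coeff_sum[symmetric]) simp
  finally show ?thesis .
qed

lemma cden_coeff_reflect_last:
  assumes "g N \<le> 2 * Suc N"
  shows "cden_coeff (Suc N) (g(N := 2 * Suc N - g N)) = - cden_coeff (Suc N) g"
proof -
  have "pm (Suc N) (g(N := 2 * Suc N - g N)) = refl N (2 * Suc N) (pm (Suc N) g)"
    by (intro poly_mapping_eqI) (simp add: lookup_refl)
  then show ?thesis
    using palD[OF pal_cden, of "pm (Suc N) g" N] assms by (simp add: cden_coeff_def)
qed

lemma cden_coeff_large_last:
  assumes "2 * Suc N < g N"
  shows "cden_coeff (Suc N) g = 0"
  using pal_zero[OF pal_cden, of N "pm (Suc N) g"] assms by (simp add: cden_coeff_def)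

lemma cden_coeff_large:
  assumes "i < N" "2 * N < g i"
  shows "cden_coeff N g = 0"
proof -
  obtain M where M: "N = Suc M" using assms by (cases N) auto
  show ?thesis
  proof (cases "i = M")
    case True
    then show ?thesis using assms cden_coeff_large_last[of M g] by (simp add: M)
  next
    case False
    have "cden_coeff (Suc M) (g \<circ> transpose i M) = 0"
      using assms by (intro cden_coeff_large_last) (simp add: M)
    then show ?thesis using cden_coeff_transpose[of i N M g] assms False by (simp add: M)
  qed
qed

text \<open>Transposing position i to the end, reflecting there and transposing back; the two signs
  of the transpositions cancel.\<close>

lemma cden_coeff_reflect:
  assumes "i < N" "g i \<le> 2 * N"
  shows "cden_coeff N (g(i := 2 * N - g i)) = - cden_coeff N g"
proof -
  obtain M where M: "N = Suc M" using assms by (cases N) auto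
  show ?thesis
  proof (cases "i = M")
    case True
    then show ?thesis using assms cden_coeff_reflect_last[of g M] by (simp add: M)
  next
    case False
    let ?h = "g \<circ> transpose i M"
    have "?h(M := 2 * N - ?h M) = g(i := 2 * N - g i) \<circ> transpose i M"
      using False by (auto simp: fun_eq_iff transpose_def)
    moreover have "cden_coeff N (?h(M := 2 * N - ?h M)) = - cden_coeff N ?h"
      using assms(2) unfolding M by (intro cden_coeff_reflect_last) simp
    ultimately show ?thesis
      using cden_coeff_transpose[of i N M g] cden_coeff_transpose[of i N M "g(i := 2 * N - g i)"] assms False M
      by simp
  qed
qed

text \<open>If no exponent is \<open>0\<close> or \<open>2 N\<close>, then by the pigeonhole principle two of the \<open>N\<close> exponents
  have the same distance to \<open>N\<close>, or one of them equals \<open>N\<close>.\<close>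

lemma cden_coeff_vanish:
  assumes N: "0 < N" and g: "\<And>i. i < N \<Longrightarrow> g i \<noteq> 0 \<and> g i \<noteq> 2 * N"
  shows "cden_coeff N g = 0"
proof (rule ccontr)
  assume nz: "cden_coeff N g \<noteq> 0"
  have le: "g i \<le> 2 * N" if "i < N" for i
    using cden_coeff_large[OF that] nz by (meson not_le)
  have ne: "g i \<noteq> N" if "i < N" for i
  proof
    assume "g i = N"
    then have "g(i := 2 * N - g i) = g" by auto
    then show False using cden_coeff_reflect[of i N g] le[OF that] that nz by simp
  qed
  define d where "d i = (if g i < N then N - g i else g i - N)" for i
  have "d ` {..<N} \<subseteq> {1..<N}"
  proof
    fix x assume "x \<in> d ` {..<N}"
    then obtain i where i: "i < N" "x = d i" by auto
    then show "x \<in> {1..<N}" using le[of i] ne[of i] g[of i] by (auto simp: d_def)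
  qed
  then have "card (d ` {..<N}) \<le> card {1..<N}" by (intro card_mono) auto
  then have "card (d ` {..<N}) \<noteq> card {..<N}" using N by simp
  then have "\<not> inj_on d {..<N}" using card_image by blast
  then obtain i k where ik: "i < N" "k < N" "i \<noteq> k" "d i = d k" by (auto simp: inj_on_def)
  then consider "g i = g k" | "g k = 2 * N - g i"
    using le[of i] le[of k] by (auto simp: d_def split: if_splits)
  then show False
  proof cases
    case 1
    then show ?thesis using cden_coeff_eq_0 ik nz by metis
  next
    case 2
    then have "cden_coeff N (g(i := 2 * N - g i)) = 0"
      using ik by (intro cden_coeff_eq_0[of i N k]) auto
    then show ?thesis using cden_coeff_reflect[of i N g] le ik nz by simp
  qed
qed

text \<open>The effect on \<mu> + \<delta> of adding one cell to the first row and one to the first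
  column: the longer staircase adds 1 everywhere, the row one more at position 0, and the new row of
  length 1 has exponent 1.\<close>

definition hook_step :: "nat \<Rightarrow> (nat \<Rightarrow> nat) \<Rightarrow> nat \<Rightarrow> nat" where
  "hook_step N g i = (if i = 0 then g 0 + 2 else if i < N then g i + 1 else 1)"

lemma cden_coeff_hook_step:
  assumes N: "0 < N" and g: "g 0 = 2 * N"
  shows "cden_coeff (Suc N) (hook_step N g) = - cden_coeff N g"
proof -
  let ?g = "hook_step N g"
  \<comment> \<open>The new first exponent is 2 N + 2, which the reflection for N + 1 variables
    sends to 0.\<close>
  have "cden_coeff (Suc N) ?g = - cden_coeff (Suc N) (?g(0 := 0))"
    using cden_coeff_reflect[of 0 "Suc N" ?g] g by (simp add: hook_step_def)
  also have "cden_coeff (Suc N) (?g(0 := 0)) = - cden_coeff (Suc N) (?g(0 := 0) \<circ> transpose 0 N)"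
    using N by (subst cden_coeff_transpose) auto
  also have "cden_coeff (Suc N) (?g(0 := 0) \<circ> transpose 0 N) =
      cden_coeff N (\<lambda>i. (?g(0 := 0) \<circ> transpose 0 N) i - 1)"
    using N by (intro cden_coeff_restrict) (auto simp: hook_step_def transpose_def)
  \<comment> \<open>The transposition has brought the last entry 1 to the front; dropping a variable
    lowers it to 0, which a reflection for N variables turns back into 2 N.\<close>
  also have "\<dots> = cden_coeff N (g(0 := 0))"
    using N by (intro cden_coeff_cong) (auto simp: hook_step_def transpose_def)
  also have "\<dots> = - cden_coeff N g"
    using cden_coeff_reflect[of 0 N g] N g by simp
  finally show ?thesis by simp
qed

text \<open>The sum of the exponents grows by N + 2, matching a staircase with N more and a degree
  with 2 more. The sign of the hook step cancels against the sign of e_(m+1).\<close>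

lemma psi_elem_pleth_hook_step:
  assumes N: "0 < N" and g: "g 0 = 2 * N"
  shows "psi (Suc N) (elem_pleth (Suc m)) (hook_step N g) = psi N (elem_pleth m) g"
proof -
  have "(\<Sum>i<Suc N. hook_step N g i) = (\<Sum>i<N. hook_step N g i) + 1"
    using N by (simp add: hook_step_def)
  also have "(\<Sum>i<N. hook_step N g i) = (\<Sum>i<N. g i + 1 + (if i = 0 then 1 else 0))"
    by (intro sum.cong) (auto simp: hook_step_def)
  also have "\<dots> = (\<Sum>i<N. g i) + N + 1"
    using N by (simp only: sum.distrib sum.delta finite_lessThan) simp
  finally have "(\<Sum>i<Suc N. hook_step N g i) = (\<Sum>i<Suc N. i) + 2 * Suc m \<longleftrightarrow> (\<Sum>i<N. g i) = (\<Sum>i<N. i) + 2 * m"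
    by simp
  then show ?thesis
    unfolding psi_elem_pleth cden_coeff_hook_step[of N g, OF N g] by simp
qed

section \<open>Stability\<close>

definition ev_const :: "(nat \<Rightarrow> rat) \<Rightarrow> bool" where
  "ev_const f \<longleftrightarrow> (\<exists>c. \<forall>\<^sub>F j in sequentially. f j = c)"

lemma ev_const_cong: "ev_const f \<Longrightarrow> \<forall>\<^sub>F j in sequentially. g j = f j \<Longrightarrow> ev_const g"
  unfolding ev_const_def by (auto elim: eventually_elim2)

lemma ev_const_map2:
  assumes "ev_const f" "ev_const g"
  shows "ev_const (\<lambda>j. h (f j) (g j))"
proof -
  obtain c d where "\<forall>\<^sub>F j in sequentially. f j = c" "\<forall>\<^sub>F j in sequentially. g j = d"
    using assms by (auto simp: ev_const_def)
  then have "\<forall>\<^sub>F j in sequentially. h (f j) (g j) = h c d" by eventually_elim simp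
  then show ?thesis by (auto simp: ev_const_def)
qed

lemma ev_const_const: "ev_const (\<lambda>_. c)"
  by (auto simp: ev_const_def)

lemma ev_const_sum: "(\<And>x. x \<in> A \<Longrightarrow> ev_const (f x)) \<Longrightarrow> ev_const (\<lambda>j. \<Sum>x\<in>A. f x j)"
  by (induction A rule: infinite_finite_induct)
    (simp_all add: ev_const_const ev_const_map2[where h = "(+)"])

lemma ev_const_shift: "ev_const f \<Longrightarrow> ev_const (\<lambda>j. f (j - k))"
proof -
  assume "ev_const f"
  then obtain c J where "\<And>j. j \<ge> J \<Longrightarrow> f j = c" by (auto simp: ev_const_def eventually_sequentially)
  then show ?thesis
    unfolding ev_const_def eventually_sequentially by (intro exI[of _ c] exI[of _ "J + k"]) auto
qed

lemma ev_const_Suc: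
  assumes "\<forall>\<^sub>F j in sequentially. f (Suc j) = f j"
  shows "ev_const f"
proof -
  obtain J where J: "\<And>j. j \<ge> J \<Longrightarrow> f (Suc j) = f j" using assms by (auto simp: eventually_sequentially)
  have "f j = f J" if "j \<ge> J" for j using that by (induction j rule: dec_induct) (simp_all add: J)
  then show ?thesis unfolding ev_const_def eventually_sequentially by blast
qed

text \<open>The exponent vector of \<open>\<mu>\<^sup>j\<close>, shifted by the staircase, has this form: a first entry growing
  like \<open>2 j\<close>, entries growing like \<open>j\<close>, and the tail \<open>j, \<dots>, 2, 1\<close> coming from the long column.
  Entries of \<open>v\<close> may be negative, so \<open>gam\<close> is meaningful only for large \<open>j\<close>.\<close>

definition gam :: "nat \<Rightarrow> (nat \<Rightarrow> int) \<Rightarrow> nat \<Rightarrow> nat \<Rightarrow> nat" where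
  "gam l v j i = (if i = 0 then nat (v 0 + 2 * int j) else if i < l then nat (v i + int j) else l + j - i)"

text \<open>All offsets v and r are included because multiplication by power sums changes both, and
  the Pieri rule changes r.\<close>

definition stable :: "nat \<Rightarrow> (nat \<Rightarrow> rat mps) \<Rightarrow> bool" where
  "stable l H \<longleftrightarrow> (\<forall>v r. ev_const (\<lambda>j. psi (l + j) (H (j + r)) (gam l v j)))"

text \<open>From such a j on, the conversions \<open>nat\<close> and the subtractions of a constant
  are not truncated at the leading entries.\<close>

lemma eventually_bound:
  fixes v :: "nat \<Rightarrow> int" and b :: int
  shows "\<forall>\<^sub>F j in sequentially. b < int j \<and> (\<forall>i<l. \<bar>v i\<bar> + b < int j)"
proof -
  have "\<forall>\<^sub>F j in sequentially. x < int j" for x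
  proof -
    have "\<forall>j\<ge>nat (x + 1). x < int j" by (auto simp: nat_le_iff)
    then show ?thesis unfolding eventually_sequentially by blast
  qed
  then have "\<forall>\<^sub>F j in sequentially. b < int j" "\<forall>\<^sub>F j in sequentially. \<forall>i\<in>{..<l}. \<bar>v i\<bar> + b < int j"
    by (simp_all add: eventually_ball_finite_distrib)
  then show ?thesis by eventually_elim auto
qed

text \<open>With N = l + j, the entries other than the first eventually lie strictly between 0 and 2
  N. So some exponent equals 0 or 2 N for large j only if the first is 2 N, that is v 0 = 2 l; then
  increasing j is a hook step, and otherwise the coefficient vanishes.\<close>

lemma stable_elem_pleth:
  assumes l: "0 < l"
  shows "stable l elem_pleth"
  unfolding stable_def
proof (intro allI)
  fix v r
  show "ev_const (\<lambda>j. psi (l + j) (elem_pleth (j + r)) (gam l v j))"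
  proof (cases "v 0 = 2 * int l")
    case True
    have "\<forall>\<^sub>F j in sequentially. psi (l + Suc j) (elem_pleth (Suc j + r)) (gam l v (Suc j))
        = psi (l + j) (elem_pleth (j + r)) (gam l v j)"
      using eventually_bound[of 0 l v]
    proof eventually_elim
      case (elim j)
      have "psi (Suc (l + j)) (elem_pleth (Suc (j + r))) (gam l v (Suc j)) =
          psi (Suc (l + j)) (elem_pleth (Suc (j + r))) (hook_step (l + j) (gam l v j))"
      proof (rule psi_cong)
        fix i assume "i < Suc (l + j)"
        moreover have "nat (v i + int (Suc j)) = nat (v i + int j) + 1" if "i < l"
        proof -
          have "\<bar>v i\<bar> + 0 < int j" using elim that by blast
          then show ?thesis by simp
        qed
        ultimately show "gam l v (Suc j) i = hook_step (l + j) (gam l v j) i"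
          using l True by (auto simp: gam_def hook_step_def)
      qed
      also have "\<dots> = psi (l + j) (elem_pleth (j + r)) (gam l v j)"
        using l True by (intro psi_elem_pleth_hook_step) (auto simp: gam_def)
      finally show ?case by simp
    qed
    then show ?thesis by (rule ev_const_Suc)
  next
    case False
    have "\<forall>\<^sub>F j in sequentially. psi (l + j) (elem_pleth (j + r)) (gam l v j) = 0"
      using eventually_bound[of 0 l v]
    proof eventually_elim
      case (elim j)
      have "cden_coeff (l + j) (gam l v j) = 0"
      proof (rule cden_coeff_vanish)
        fix i assume i: "i < l + j"
        have b: "\<bar>v i\<bar> < int j" if "i < l" using elim that by simp
        show "gam l v j i \<noteq> 0 \<and> gam l v j i \<noteq> 2 * (l + j)"
          using i b False l by (auto simp: gam_def)
      qed (use l in simp)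
      then show ?case by (simp add: psi_elem_pleth)
    qed
    then show ?thesis unfolding ev_const_def by blast
  qed
qed

text \<open>Removing a border strip of size \<open>k\<close> from a column longer than \<open>k\<close>: the vanishing exponent is
  moved to the end of the tail by \<open>k - 1\<close> transpositions.\<close>

lemma psi_remove_column_strip:
  assumes "sym_mps F" "0 < k" "k \<le> N" "g (N - k) = 0"
    and "\<And>r. 0 < r \<Longrightarrow> r < k \<Longrightarrow> g (N - k + r) = k - r"
    and "\<And>i. i < N - k \<Longrightarrow> k \<le> g i"
  shows "psi N F g = (- 1) ^ (k - 1) * psi (N - k) F (\<lambda>i. g i - k)"
  using assms(2-)
proof (induction k arbitrary: N g)
  case (Suc k)
  obtain M where M: "N = Suc M" using Suc.prems(2) by (cases N) auto
  show ?case
  proof (cases "k = 0")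
    case True
    then show ?thesis using Suc.prems(3,5) by (simp add: M psi_Suc_restrict)
  next
    case False
    then have k: "0 < k" "k \<le> M" using Suc.prems M by auto
    \<comment> \<open>The entry 0 is exchanged with the last entry 1. Dropping the last variable
      lowers this 1 to 0 again, in a tail that is shorter by one.\<close>
    let ?h = "g \<circ> transpose (M - k) M"
    have gM: "g M = 1" using Suc.prems(4)[of k] k by (simp add: M)
    have g0: "g (M - k) = 0" using Suc.prems(3) by (simp add: M)
    have tail: "?h (M - k + r) = Suc k - r" if "0 < r" "r < k" for r
      using Suc.prems(4)[of r] that k by (simp add: M)
    have small: "?h i = g i" if "i < M - k" for i using that k by simp
    have ge1: "1 \<le> ?h i" if "i < M" for i
    proof (rule linorder_cases[of i "M - k"])
      assume "i < M - k"
      then show ?thesis using small Suc.prems(5)[of i] by (simp add: M)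
    next
      assume "i = M - k"
      then show ?thesis using gM by simp
    next
      assume "M - k < i"
      then have "0 < i - (M - k)" "i - (M - k) < k" "M - k + (i - (M - k)) = i" using that k by auto
      then show ?thesis using tail[of "i - (M - k)"] by (metis Suc_leI less_SucI zero_less_diff One_nat_def)
    qed
    have "psi N F g = - psi N F ?h"
      using psi_transpose[OF assms(1), of "M - k" N M g] k by (simp add: M)
    also have "psi N F ?h = psi M F (\<lambda>i. ?h i - 1)"
      unfolding M using ge1 g0 by (subst psi_Suc_restrict) auto
    also have "\<dots> = (- 1) ^ (k - 1) * psi (M - k) F (\<lambda>i. ?h i - 1 - k)"
    proof (rule Suc.IH[OF k])
      show "?h (M - k) - 1 = 0" using gM by simp
      show "?h (M - k + r) - 1 = k - r" if "0 < r" "r < k" for r using tail[OF that] by simp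
      show "k \<le> ?h i - 1" if "i < M - k" for i using small[OF that] Suc.prems(5)[of i] that by (simp add: M)
    qed
    also have "psi (M - k) F (\<lambda>i. ?h i - 1 - k) = psi (M - k) F (\<lambda>i. g i - Suc k)"
      using small by (intro psi_cong) simp
    also have "- ((- 1) ^ (k - 1) * psi (M - k) F (\<lambda>i. g i - Suc k)) = (- 1) ^ k * psi (M - k) F (\<lambda>i. g i - Suc k)"
      using k by (cases k) auto
    finally show ?thesis by (simp add: M)
  qed
qed simp

lemma stable_mult_psum:
  assumes l: "0 < l" and sym: "\<And>j. sym_mps (H j)" and H: "stable l H" and k: "0 < k"
  shows "stable l (\<lambda>j. H j * psum k)"
  unfolding stable_def
proof (intro allI)
  fix v r
  let ?t = "\<lambda>j i. if k \<le> gam l v j i then psi (l + j) (H (j + r)) ((gam l v j)(i := gam l v j i - k)) else 0"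
  \<comment> \<open>Removing k rows replaces j by j - k and lowers all remaining entries by k. This
    fits the new j except at the first entry, where v 0 + 2 j - k = (v 0 + k) + 2 (j - k); likewise
    j + r = (j - k) + (r + k).\<close>
  let ?w = "v(0 := v 0 + int k)"
  have head: "ev_const (\<lambda>j. ?t j i)" if "i < l" for i
  proof (rule ev_const_cong)
    show "ev_const (\<lambda>j. psi (l + j) (H (j + r)) (gam l (v(i := v i - int k)) j))"
      using H by (simp add: stable_def)
    show "\<forall>\<^sub>F j in sequentially. ?t j i = psi (l + j) (H (j + r)) (gam l (v(i := v i - int k)) j)"
      using eventually_bound[of "int k" l v]
    proof eventually_elim
      case (elim j)
      then have b: "\<bar>v i\<bar> + int k < int j" using that by blast
      then have "k \<le> gam l v j i" using that by (auto simp: gam_def le_nat_iff)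
      moreover have "(gam l v j)(i := gam l v j i - k) = gam l (v(i := v i - int k)) j"
        using that b by (auto simp: gam_def fun_eq_iff nat_diff_distrib)
      ultimately show ?case by simp
    qed
  qed
  have tail: "ev_const (\<lambda>j. \<Sum>i=l..<l+j. ?t j i)"
  proof (rule ev_const_cong)
    have "ev_const (\<lambda>j. psi (l + j) (H (j + (r + k))) (gam l ?w j))" using H by (simp add: stable_def)
    then have "ev_const (\<lambda>j. psi (l + (j - k)) (H (j - k + (r + k))) (gam l ?w (j - k)))"
      by (rule ev_const_shift)
    then show "ev_const (\<lambda>j. (- 1) ^ (k - 1) * psi (l + (j - k)) (H (j - k + (r + k))) (gam l ?w (j - k)))"
      by (rule ev_const_map2[OF ev_const_const])
    show "\<forall>\<^sub>F j in sequentially. (\<Sum>i=l..<l+j. ?t j i) =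
        (- 1) ^ (k - 1) * psi (l + (j - k)) (H (j - k + (r + k))) (gam l ?w (j - k))"
      using eventually_bound[of "int k" l v]
    proof eventually_elim
      case (elim j)
      let ?g = "gam l v j" and ?N = "l + j"
      let ?h = "?g(?N - k := 0)"
      have kj: "k < j" using elim by simp
      have gt: "?g i = l + j - i" if "l \<le> i" for i using that l by (simp add: gam_def)
      \<comment> \<open>An exponent of the tail above k, lowered by k, equals the exponent k places
        further on, so antisymmetry gives 0; one below k cannot be lowered.\<close>
      have "?t j i = 0" if "l \<le> i" "i < l + j" "i \<noteq> l + j - k" for i
      proof (cases "k \<le> ?g i")
        case True
        then have "i + k < l + j" using that gt[of i] kj by auto
        then have "psi ?N (H (j + r)) (?g(i := ?g i - k)) = 0"
          using that k gt[of i] gt[of "i + k"] by (intro psi_eq_0[OF sym, of i _ "i + k"]) auto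
        then show ?thesis by simp
      qed simp
      then have "(\<Sum>i=l..<l+j. ?t j i) = (\<Sum>i\<in>{l + j - k}. ?t j i)"
        using kj k by (intro sum.mono_neutral_right) auto
      also have "\<dots> = psi ?N (H (j + r)) ?h"
        using kj gt[of "l + j - k"] by simp
      also have "\<dots> = (- 1) ^ (k - 1) * psi (?N - k) (H (j + r)) (\<lambda>i. ?h i - k)"
      proof (rule psi_remove_column_strip[OF sym k])
        fix s assume "0 < s" "s < k"
        then show "?h (?N - k + s) = k - s" using gt[of "?N - k + s"] kj by simp
      next
        fix i assume i: "i < ?N - k"
        show "k \<le> ?h i"
        proof (cases "i < l")
          case True
          then have "\<bar>v i\<bar> + int k < int j" using elim by blast
          then show ?thesis using i True by (auto simp: gam_def le_nat_iff)
        next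
          case False
          then show ?thesis using i gt[of i] by simp
        qed
      qed (use kj in auto)
      also have "psi (?N - k) (H (j + r)) (\<lambda>i. ?h i - k) = psi (?N - k) (H (j + r)) (gam l ?w (j - k))"
      proof (rule psi_cong)
        fix i assume i: "i < ?N - k"
        show "?h i - k = gam l ?w (j - k) i"
        proof (cases "i < l")
          case True
          then have "\<bar>v i\<bar> + int k < int j" using elim by blast
          then show ?thesis using i True kj by (auto simp: gam_def nat_diff_distrib' of_nat_diff)
        next
          case False
          then show ?thesis using i gt[of i] kj l by (simp add: gam_def)
        qed
      qed
      finally show ?case using kj by (simp add: add.commute add.left_commute)
    qed
  qed
  have "psi (l + j) (H (j + r) * psum k) (gam l v j) = (\<Sum>i<l. ?t j i) + (\<Sum>i=l..<l+j. ?t j i)" for j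
  proof -
    have split: "{..<l+j} = {..<l} \<union> {l..<l+j}" by auto
    show ?thesis unfolding psi_mult_psum[OF k] split by (rule sum.union_disjoint) auto
  qed
  moreover have "ev_const (\<lambda>j. (\<Sum>i<l. ?t j i) + (\<Sum>i=l..<l+j. ?t j i))"
    using head tail by (intro ev_const_map2[where h = "(+)"] ev_const_sum) auto
  ultimately show "ev_const (\<lambda>j. psi (l + j) (H (j + r) * psum k) (gam l v j))" by simp
qed

lemma stable_add: "stable l H \<Longrightarrow> stable l K \<Longrightarrow> stable l (\<lambda>j. H j + K j)"
  unfolding stable_def psi_add by (intro allI ev_const_map2[where h = "(+)"]) auto

lemma stable_scale: "stable l H \<Longrightarrow> stable l (\<lambda>j. mps_scale c (H j))"
  unfolding stable_def psi_scale by (intro allI ev_const_map2[OF ev_const_const, where h = "(*)"]) auto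

text \<open>Reduces to power sums by p_k o h_2 = (p_k^2 + p_(2k)) / 2. The family H stays general so
  that the factors of a product can be absorbed one after another.\<close>

lemma stable_mult_pleth_rel:
  assumes l: "0 < l"
  shows "pleth_rel (schur [2]) f F \<Longrightarrow> (\<And>j. sym_mps (H j)) \<Longrightarrow> stable l H \<Longrightarrow> stable l (\<lambda>j. H j * F)"
proof (induction arbitrary: H rule: pleth_rel.induct)
  case (psum k)
  have "stable l (\<lambda>j. mps_scale (1 / 2) (H j * psum k * psum k + H j * psum (2 * k)))"
    using psum l by (intro stable_scale stable_add stable_mult_psum sym_mps_mult sym_mps_psum) auto
  then show ?case
    using psum by (simp add: psum_plethysm_schur_2 mps_scale_mult_right distrib_left mult.assoc)
next
  case (add f F f' F')
  then show ?case by (simp add: distrib_left stable_add)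
next
  case (mult f F f' F')
  have "stable l (\<lambda>j. H j * F * F')"
    using mult sym_mps_pleth_rel[OF mult.hyps(1)] by (intro mult.IH sym_mps_mult) auto
  then show ?case by (simp add: mult.assoc)
next
  case (scale f F r)
  then show ?case by (simp add: mps_scale_mult_right stable_scale)
qed simp

text \<open>In the Pieri recursion the main term is e_m o h_2 times a fixed plethysm, and each
  correction has a smaller \<kappa> with an index shifted by the constant |\<nu>| - |\<kappa>|,
  which the quantification over r absorbs.\<close>

lemma stable_schur_add_column:
  assumes l: "0 < l" and \<nu>: "is_partition \<nu>"
  shows "stable l (\<lambda>m. plethysm (schur (add_column m \<nu>)) (schur [2]))"
  using \<nu>
proof (induction "sum_list \<nu>" arbitrary: \<nu> rule: less_induct)
  case less
  let ?P = "\<lambda>m \<kappa>. plethysm (schur (add_column m \<kappa>)) (schur [2])"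
  let ?K = "vstrip_removals \<nu> - {\<nu>}" and ?G = "plethysm (schur \<nu>) (schur [2])"
  have K: "is_partition \<kappa>" "sum_list \<kappa> < sum_list \<nu>" "length \<kappa> \<le> length \<nu>" if "\<kappa> \<in> ?K" for \<kappa>
    using that vstrip_removals_sum_less[OF less.prems, of \<kappa>] by (auto simp: vstrip_removals_def)
  have P: "?P m \<nu> = ?G * elem_pleth m - (\<Sum>\<kappa>\<in>?K. ?P (m + sum_list \<nu> - sum_list \<kappa>) \<kappa>)"
    if "length \<nu> \<le> m" for m
    unfolding schur_add_column[OF less.prems that]
    using K by (intro pleth_rel_plethysm pleth_rel_diff pleth_rel.mult pleth_rel_sum pleth_rel_elem
        pleth_rel_schur is_partition_add_column less.prems)
  show ?case
    unfolding stable_def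
  proof (intro allI)
    fix v r
    let ?M = "\<lambda>j. psi (l + j) (elem_pleth (j + r) * ?G) (gam l v j)"
      and ?R = "\<lambda>j. \<Sum>\<kappa>\<in>?K. psi (l + j) (?P (j + r + sum_list \<nu> - sum_list \<kappa>) \<kappa>) (gam l v j)"
    have "stable l (\<lambda>m. elem_pleth m * ?G)"
      by (rule stable_mult_pleth_rel[OF l pleth_rel_schur[OF less.prems] sym_mps_elem_pleth stable_elem_pleth[OF l]])
    then have main: "ev_const ?M"
      by (simp add: stable_def)
    have rest: "ev_const (\<lambda>j. psi (l + j) (?P (j + r + sum_list \<nu> - sum_list \<kappa>) \<kappa>) (gam l v j))"
      if "\<kappa> \<in> ?K" for \<kappa>
    proof -
      have "ev_const (\<lambda>j. psi (l + j) (?P (j + (r + (sum_list \<nu> - sum_list \<kappa>))) \<kappa>) (gam l v j))"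
        using less.hyps[OF K(2,1)[OF that]] by (simp add: stable_def)
      moreover have "j + (r + (sum_list \<nu> - sum_list \<kappa>)) = j + r + sum_list \<nu> - sum_list \<kappa>" for j
        using K(2)[OF that] by simp
      ultimately show ?thesis by simp
    qed
    show "ev_const (\<lambda>j. psi (l + j) (?P (j + r) \<nu>) (gam l v j))"
    proof (rule ev_const_cong)
      show "ev_const (\<lambda>j. ?M j - ?R j)"
        by (intro ev_const_map2[where h = "(-)"] main ev_const_sum rest)
      have "psi (l + j) (?P (j + r) \<nu>) (gam l v j) = ?M j - ?R j"
        if "length \<nu> \<le> j" for j
        using that by (subst P) (simp_all add: psi_diff psi_sum mult.commute)
      then show "\<forall>\<^sub>F j in sequentially. psi (l + j) (?P (j + r) \<nu>) (gam l v j) =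
          ?M j - ?R j"
        unfolding eventually_sequentially by blast
    qed
  qed
qed

section \<open>The partitions of the theorem as exponent vectors\<close>

lemma part_union_replicate_1:
  assumes "is_partition \<mu>"
  shows "part_union \<mu> (replicate j 1) = \<mu> @ replicate j 1"
proof (rule partition_eq_if_mset_eq)
  show "is_partition (part_union \<mu> (replicate j 1))"
    using assms by (intro is_partition_part_union) (auto simp: is_partition_def sorted_wrt_iff_nth_less)
  have "1 \<le> \<mu> ! i" if "i < length \<mu>" for i
  proof -
    have "\<mu> ! i \<noteq> 0" using assms nth_mem[OF that] unfolding is_partition_def by metis
    then show ?thesis by simp
  qed
  then show "is_partition (\<mu> @ replicate j 1)"
    using assms by (auto simp: is_partition_def sorted_wrt_iff_nth_less nth_append)
qed (simp add: part_union_def)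

lemma nth_default_part_add_row:
  "nth_default 0 (part_add \<mu> [j]) i = nth_default 0 \<mu> i + (if i = 0 then j else 0)"
proof -
  have "nth_default 0 (part_add \<mu> [j]) i =
      nth_default 0 (map (\<lambda>i. nth_default 0 \<mu> i + nth_default 0 [j] i) [0..<max (length \<mu>) (length [j])]) i"
    by (simp add: part_add_def nth_default_strip_while_dflt)
  also have "\<dots> = nth_default 0 \<mu> i + (if i = 0 then j else 0)"
    by (auto simp: nth_default_def simp del: upt_Suc)
  finally show ?thesis .
qed

theorem proposition5p3:
  fixes lam mu :: "nat list"
  assumes "is_partition lam" and "is_partition mu"
  shows "\<exists>c. \<forall>\<^sub>F j in sequentially.
    plethysm_coeff (part_union lam (replicate j 1)) [2]
      (part_union (part_add mu [j]) (replicate j 1)) = c"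
proof -
  \<comment> \<open>At least 1, so that the growing first row is among the leading entries even if
    \<open>mu\<close> is empty.\<close>
  define l where "l = max 1 (length mu)"
  \<comment> \<open>With N = l + j the entry of \<mu> + \<delta> is mu_i + l + j - 1 - i; taking off
    j leaves v i. The first row's own growth supplies the second j at position 0.\<close>
  define v where "v i = int (nth_default 0 mu i + l) - 1 - int i" for i
  have l: "0 < l" "length mu \<le> l" by (simp_all add: l_def)
  obtain \<nu> where \<nu>: "is_partition \<nu>" "length \<nu> \<le> length lam" "lam = add_column (length lam) \<nu>"
    using partition_remove_column[OF assms(1)] by blast
  let ?P = "\<lambda>m. plethysm (schur (add_column m \<nu>)) (schur [2])"
  have coeff: "plethysm_coeff (part_union lam (replicate j 1)) [2]
      (part_union (part_add mu [j]) (replicate j 1)) = psi (l + j) (?P (j + length lam)) (gam l v j)"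
    if "1 \<le> j" for j
  proof -
    let ?mu = "part_add mu [j]"
    have mu: "is_partition ?mu" by (rule is_partition_part_add_row[OF assms(2)])
    \<comment> \<open>For empty \<open>mu\<close> the row j is a new part, nonzero because 1 \<le>
      j.\<close>
    have "length ?mu = l"
    proof -
      have "i < length ?mu \<longleftrightarrow> i < l" for i
        using nth_default_pos_iff[OF mu, of i] nth_default_pos_iff[OF assms(2), of i] that
        by (auto simp: nth_default_part_add_row l_def split: if_splits)
      then show ?thesis by (metis less_irrefl linorder_neqE_nat)
    qed
    moreover have union: "part_union ?mu (replicate j 1) = ?mu @ replicate j 1"
      by (rule part_union_replicate_1[OF mu])
    ultimately have len: "length (part_union ?mu (replicate j 1)) = l + j" by simp
    have "part_union lam (replicate j 1) = lam @ replicate j 1"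
      by (rule part_union_replicate_1[OF assms(1)])
    \<comment> \<open>The additional parts 1 only lengthen the first column, so \<nu> is the same
      for all j.\<close>
    also have "\<dots> = add_column (j + length lam) \<nu>"
      using \<nu>(2) by (subst \<nu>(3)) (simp add: add_column_def replicate_add[symmetric])
    finally have lam: "part_union lam (replicate j 1) = add_column (j + length lam) \<nu>" .
    have pl: "pleth_rel (schur [2]) (schur (add_column (j + length lam) \<nu>)) (?P (j + length lam))"
      using \<nu> by (intro pleth_rel_schur_add_column) auto
    obtain d where d: "deg_in {..d} (?P (j + length lam))" using deg_in_pleth_rel[OF pl] by blast
    have "is_partition (part_union ?mu (replicate j 1))"
      using mu by (intro is_partition_part_union) (auto simp: is_partition_def sorted_wrt_iff_nth_less)
    then have "plethysm_coeff (part_union lam (replicate j 1)) [2] (part_union ?mu (replicate j 1)) =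
        psi (l + j) (?P (j + length lam)) (expo (l + j) (part_union ?mu (replicate j 1)))"
      unfolding plethysm_coeff_def lam
      by (rule hall_inner_schur[OF sym_mps_pleth_rel[OF pl] d]) (simp only: len order_refl)
    also have "\<dots> = psi (l + j) (?P (j + length lam)) (gam l v j)"
    proof (rule psi_cong)
      fix i assume i: "i < l + j"
      show "expo (l + j) (part_union ?mu (replicate j 1)) i = gam l v j i"
      proof (cases "i < l")
        case True
        then have "nth_default 0 (part_union ?mu (replicate j 1)) i = nth_default 0 ?mu i"
          using \<open>length ?mu = l\<close> unfolding union by (simp add: nth_default_append nth_default_nth)
        then show ?thesis using True by (auto simp: expo_def gam_def v_def nth_default_part_add_row)
      next
        case False
        then have "nth_default 0 (part_union ?mu (replicate j 1)) i = 1"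
          using \<open>length ?mu = l\<close> i unfolding union by (simp add: nth_default_def nth_append)
        then show ?thesis using False i l by (auto simp: expo_def gam_def)
      qed
    qed
    finally show ?thesis .
  qed
  have "ev_const (\<lambda>j. psi (l + j) (?P (j + length lam)) (gam l v j))"
    using stable_schur_add_column[OF l(1) \<nu>(1)] by (simp add: stable_def)
  moreover have "\<forall>\<^sub>F j in sequentially. plethysm_coeff (part_union lam (replicate j 1)) [2]
      (part_union (part_add mu [j]) (replicate j 1)) = psi (l + j) (?P (j + length lam)) (gam l v j)"
    using eventually_ge_at_top[of 1] by eventually_elim (rule coeff)
  ultimately show ?thesis unfolding ev_const_def[symmetric] by (rule ev_const_cong)
qed

end
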